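(* Let $\{a_i:i=1,2,\dots\}$ be a sequence of self-adjoint operators in a $C^*$-probability space $(\mathcal{A},\varphi)$ and let $\{\lambda_i>0:i=1,2,\dots\}$ be real numbers with $\sup\{\lambda_i:i\ge1\}=\lambda<\infty$. For each $N\in\mathbb{N}$ with $N\ge\lambda$, let $(\mathcal{C}_N,\psi_N)$ be a $C^*$-probability space having projections $p_N^{(i)}\in\mathcal{C}_N$ with $\psi_N(p_N^{(i)})=\frac{\lambda_i}{N}$ for $i\in\mathbb{N}$, and let $\mathcal{A}_N=\mathcal{A}\otimes\mathcal{C}_N$ be the spatial tensor product of $\mathcal{A}$ and $\mathcal{C}_N$, with the state $\varphi_N=\varphi\otimes\psi_N$. Let $a_N^{(i)}=a_i\otimes p_N^{(i)}$, and let $\{a_{N,j}^{(i)}=a_i\otimes p_{N,j}^{(i)}:i=1,2,\dots\}$, $j=1,2,\dots,N$ (with $p_{N,j}^{(i)}\in\mathcal{C}_N$), be a freely independent family of $N$ identically distributed sequences of self-adjoint operators in $\mathcal{A}_N$ such that the distribution of $\{a_{N,j}^{(i)}:i=1,2,\dots\}$ is the same as that of $\{a_N^{(i)}:i=1,2,\dots\}$ for $j=1,\dots,N$. Let $s_N^{(i)}=\sum_{j=1}^N a_{N,j}^{(i)}$. Then there are a sequence $\{b_i:i=1,2,\dots\}$ of compound free Poisson random variables in a $C^*$-probability space $(\mathcal{B},\phi)$ and a free ultrafilter $\omega\in\beta\mathbb{N}\setminus\mathbb{N}$ such that $\{s_N^{(i)}:i=1,2,\dots\}$ converges in distribution to $\{b_i:i=1,2,\dots\}$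 as $N\to\omega$, and $$\kappa_n(b_{i(1)},b_{i(2)},\dots,b_{i(n)})=\varphi(a_{i(1)}a_{i(2)}\cdots a_{i(n)})\lim_{N\to\omega}N\psi_N\bigl(p_N^{(i(1))}p_N^{(i(2))}\cdots p_N^{(i(n))}\bigr)$$ for all $n\in\mathbb{N}$ and all $(i(1),i(2),\dots,i(n))\in\mathbb{N}^n$.
   Context: A $C^*$-probability space $(\mathcal{A},\varphi)$ is a unital $C^*$-algebra $\mathcal{A}$ with a state $\varphi$; its elements are called random variables. A projection is a self-adjoint idempotent. Unital subalgebras $\{\mathcal{A}_i\}_{i\in I}$ are freely independent (free) if $\varphi(x_1\cdots x_n)=0$ whenever $x_k\in\mathcal{A}_{l(k)}$, $\varphi(x_k)=0$ for all $k$, and $l(k)\ne l(k+1)$ for $1\le k\le n-1$. Sequences of random variables are freely independent if the unital subalgebras they generate are free. The distribution of a sequence is the collection of all its joint moments $\varphi(x_{i_1}\cdots x_{i_m})$; sequences are identically distributed if these agree. Points of $\beta\mathbb{N}\setminus\mathbb{N}$ are identified with free ultrafilters on $\mathbb{N}$ (ultrafilters containing no finite set). For a bounded sequence $(x_N)$ of complex numbers, $\lim_{N\to\omega}x_N=l$ means $\{N:|x_N-l|<\varepsilon\}\in\omega$ for every $\varepsilon>0$; finitely many indices $N<\lambda$ are irrelevant. Convergence in distribution of $\{s_N^{(i)}\}_i$ to $\{b_i\}_i$ as $N\to\omega$ means $\lim_{N\to\omega}\varphi_N(s_N^{(i(1))}\cdots s_N^{(i(m))})=\phi(b_{i(1)}\cdots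 b_{i(m)})$ for all $m$ and $i(1),\dots,i(m)$. Free cumulants: $\kappa_n(x_1,\dots,x_n)=\sum_{\pi\in NC(n)}\varphi_\pi(x_1,\dots,x_n)\mu_n(\pi,1_n)$, where $NC(n)$ is the lattice of non-crossing partitions of $\{1,\dots,n\}$ ordered by refinement, $\mu_n$ its Möbius function, $1_n$ the one-block partition, and $\varphi_\pi(x_1,\dots,x_n)$ is the product over blocks $V=\{v_1<\dots<v_s\}$ of $\pi$ of $\varphi(x_{v_1}\cdots x_{v_s})$. A random variable $b$ is a compound free Poisson random variable if there are $c>0$ and a self-adjoint element $a$ of some $C^*$-probability space $(\mathcal{D},\theta)$ such that $\kappa_n(b,\dots,b)=c\,\theta(a^n)$ for all $n\ge1$. *)

theory Defs
  imports "HOL-Analysis.Analysis" "HOL-Algebra.Ring"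
begin

section \<open>Unital C*-algebras and states\<close>

text \<open>C*-algebras are carrier-based, so that the members of a sequence of algebras
  may all be different.\<close>

record 'a cstar_algebra = "'a ring" +
  scale :: "complex \<Rightarrow> 'a \<Rightarrow> 'a" (infixr "\<odot>\<index>" 75)
  adj :: "'a \<Rightarrow> 'a"
  nrm :: "'a \<Rightarrow> real"

locale unital_cstar_algebra = ring A for A :: "'a cstar_algebra" (structure) +
  assumes scale_closed: "x \<in> carrier A \<Longrightarrow> c \<odot> x \<in> carrier A"
    and scale_right_distrib:
      "\<lbrakk>x \<in> carrier A; y \<in> carrier A\<rbrakk> \<Longrightarrow> c \<odot> (x \<oplus> y) = c \<odot> x \<oplus> c \<odot> y"
    and scale_left_distrib: "x \<in> carrier A \<Longrightarrow> (c + d) \<odot> x = c \<odot> x \<oplus> d \<odot> x"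
    and scale_scale: "x \<in> carrier A \<Longrightarrow> c \<odot> d \<odot> x = (c * d) \<odot> x"
    and scale_one: "x \<in> carrier A \<Longrightarrow> 1 \<odot> x = x"
    and mult_scale_left:
      "\<lbrakk>x \<in> carrier A; y \<in> carrier A\<rbrakk> \<Longrightarrow> (c \<odot> x) \<otimes> y = c \<odot> (x \<otimes> y)"
    and mult_scale_right:
      "\<lbrakk>x \<in> carrier A; y \<in> carrier A\<rbrakk> \<Longrightarrow> x \<otimes> (c \<odot> y) = c \<odot> (x \<otimes> y)"
    and adj_closed: "x \<in> carrier A \<Longrightarrow> adj A x \<in> carrier A"
    and adj_add:
      "\<lbrakk>x \<in> carrier A; y \<in> carrier A\<rbrakk> \<Longrightarrow> adj A (x \<oplus> y) = adj A x \<oplus> adj A y"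
    and adj_scale: "x \<in> carrier A \<Longrightarrow> adj A (c \<odot> x) = cnj c \<odot> adj A x"
    and adj_mult:
      "\<lbrakk>x \<in> carrier A; y \<in> carrier A\<rbrakk> \<Longrightarrow> adj A (x \<otimes> y) = adj A y \<otimes> adj A x"
    and adj_adj: "x \<in> carrier A \<Longrightarrow> adj A (adj A x) = x"
    and nrm_eq_zero_iff: "x \<in> carrier A \<Longrightarrow> nrm A x = 0 \<longleftrightarrow> x = \<zero>"
    and nrm_triangle:
      "\<lbrakk>x \<in> carrier A; y \<in> carrier A\<rbrakk> \<Longrightarrow> nrm A (x \<oplus> y) \<le> nrm A x + nrm A y"
    and nrm_scale: "x \<in> carrier A \<Longrightarrow> nrm A (c \<odot> x) = cmod c * nrm A x"
    and nrm_mult: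
      "\<lbrakk>x \<in> carrier A; y \<in> carrier A\<rbrakk> \<Longrightarrow> nrm A (x \<otimes> y) \<le> nrm A x * nrm A y"
    and cstar_identity: "x \<in> carrier A \<Longrightarrow> nrm A (adj A x \<otimes> x) = (nrm A x)\<^sup>2"
    and complete:
      "\<lbrakk>\<And>n. X n \<in> carrier A;
        \<And>e. e > 0 \<Longrightarrow> \<exists>M. \<forall>m\<ge>M. \<forall>n\<ge>M. nrm A (X m \<ominus> X n) < e\<rbrakk>
       \<Longrightarrow> \<exists>x\<in>carrier A. (\<lambda>n. nrm A (X n \<ominus> x)) \<longlonglongrightarrow> 0"

locale cstar_prob_space = unital_cstar_algebra A
  for A :: "'a cstar_algebra" (structure) and \<phi> :: "'a \<Rightarrow> complex" +
  assumes state_add: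
      "\<lbrakk>x \<in> carrier A; y \<in> carrier A\<rbrakk> \<Longrightarrow> \<phi> (x \<oplus> y) = \<phi> x + \<phi> y"
    and state_scale: "x \<in> carrier A \<Longrightarrow> \<phi> (c \<odot> x) = c * \<phi> x"
    and state_positive: "x \<in> carrier A \<Longrightarrow> \<phi> (adj A x \<otimes> x) \<in> \<real>\<^sub>\<ge>\<^sub>0"
    and state_one: "\<phi> \<one> = 1"

definition self_adjoint :: "'a cstar_algebra \<Rightarrow> 'a \<Rightarrow> bool" where
  "self_adjoint A x \<longleftrightarrow> x \<in> carrier A \<and> adj A x = x"

definition projection :: "'a cstar_algebra \<Rightarrow> 'a \<Rightarrow> bool" where
  "projection A p \<longleftrightarrow> self_adjoint A p \<and> p \<otimes>\<^bsub>A\<^esub> p = p"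


section \<open>Spatial tensor products\<close>

text \<open>Every complex Hilbert space is isometrically isomorphic to some \<open>\<ell>\<^sup>2(X)\<close>, realised here
  as the square-summable functions vanishing off \<open>X\<close>; the Hilbert space tensor product of
  \<open>\<ell>\<^sup>2(X)\<close> and \<open>\<ell>\<^sup>2(Y)\<close> is \<open>\<ell>\<^sup>2(X \<times> Y)\<close>.\<close>

definition ell2 :: "'x set \<Rightarrow> ('x \<Rightarrow> complex) set" where
  "ell2 X = {f. (\<forall>x. x \<notin> X \<longrightarrow> f x = 0) \<and> (\<lambda>x. (cmod (f x))\<^sup>2) summable_on X}"

definition ell2_inner :: "'x set \<Rightarrow> ('x \<Rightarrow> complex) \<Rightarrow> ('x \<Rightarrow> complex) \<Rightarrow> complex" where
  "ell2_inner X f g = (\<Sum>\<^sub>\<infinity>x\<in>X. cnj (f x) * g x)"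

definition ell2_norm :: "'x set \<Rightarrow> ('x \<Rightarrow> complex) \<Rightarrow> real" where
  "ell2_norm X f = sqrt (\<Sum>\<^sub>\<infinity>x\<in>X. (cmod (f x))\<^sup>2)"

definition ell2_tensor :: "('x \<Rightarrow> complex) \<Rightarrow> ('y \<Rightarrow> complex) \<Rightarrow> 'x \<times> 'y \<Rightarrow> complex" where
  "ell2_tensor f g = (\<lambda>(x, y). f x * g y)"

definition bounded_operator ::
  "'x set \<Rightarrow> (('x \<Rightarrow> complex) \<Rightarrow> ('x \<Rightarrow> complex)) \<Rightarrow> bool" where
  "bounded_operator X T \<longleftrightarrow>
     (\<forall>f\<in>ell2 X. T f \<in> ell2 X) \<and>
     (\<forall>f\<in>ell2 X. \<forall>g\<in>ell2 X. T (\<lambda>x. f x + g x) = (\<lambda>x. T f x + T g x)) \<and>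
     (\<forall>f\<in>ell2 X. \<forall>c. T (\<lambda>x. c * f x) = (\<lambda>x. c * T f x)) \<and>
     (\<exists>K. \<forall>f\<in>ell2 X. ell2_norm X (T f) \<le> K * ell2_norm X f)"

definition operator_norm ::
  "'x set \<Rightarrow> (('x \<Rightarrow> complex) \<Rightarrow> ('x \<Rightarrow> complex)) \<Rightarrow> real" where
  "operator_norm X T = Sup {ell2_norm X (T f) | f. f \<in> ell2 X \<and> ell2_norm X f \<le> 1}"

text \<open>A unital *-representation on \<open>\<ell>\<^sup>2(X)\<close>. Operators only matter on \<open>\<ell>\<^sup>2(X)\<close>; their values
  elsewhere are junk.\<close>

definition representation ::
  "'a cstar_algebra \<Rightarrow> 'x set \<Rightarrow> ('a \<Rightarrow> ('x \<Rightarrow> complex) \<Rightarrow> ('x \<Rightarrow> complex)) \<Rightarrow> bool" where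
  "representation A X \<pi> \<longleftrightarrow>
     (\<forall>a\<in>carrier A. bounded_operator X (\<pi> a)) \<and>
     (\<forall>a\<in>carrier A. \<forall>b\<in>carrier A. \<forall>f\<in>ell2 X. \<pi> (a \<oplus>\<^bsub>A\<^esub> b) f = (\<lambda>x. \<pi> a f x + \<pi> b f x)) \<and>
     (\<forall>a\<in>carrier A. \<forall>c. \<forall>f\<in>ell2 X. \<pi> (c \<odot>\<^bsub>A\<^esub> a) f = (\<lambda>x. c * \<pi> a f x)) \<and>
     (\<forall>a\<in>carrier A. \<forall>b\<in>carrier A. \<forall>f\<in>ell2 X. \<pi> (a \<otimes>\<^bsub>A\<^esub> b) f = \<pi> a (\<pi> b f)) \<and>
     (\<forall>f\<in>ell2 X. \<pi> \<one>\<^bsub>A\<^esub> f = f) \<and>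
     (\<forall>a\<in>carrier A. \<forall>f\<in>ell2 X. \<forall>g\<in>ell2 X.
        ell2_inner X (\<pi> (adj A a) f) g = ell2_inner X f (\<pi> a g))"

definition faithful_representation ::
  "'a cstar_algebra \<Rightarrow> 'x set \<Rightarrow> ('a \<Rightarrow> ('x \<Rightarrow> complex) \<Rightarrow> ('x \<Rightarrow> complex)) \<Rightarrow> bool" where
  "faithful_representation A X \<pi> \<longleftrightarrow> representation A X \<pi> \<and>
     (\<forall>a\<in>carrier A. (\<forall>f\<in>ell2 X. \<pi> a f = (\<lambda>_. 0)) \<longrightarrow> a = \<zero>\<^bsub>A\<^esub>)"

text \<open>\<open>T\<close>, with elementary tensors \<open>\<tau> a c\<close>, is a completion of the algebraic tensor product
  *-algebra of \<open>A\<close> and \<open>C\<close> in the norm of \<open>B(\<ell>\<^sup>2(X \<times> Y))\<close> obtained from faithful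
  representations \<open>\<pi>\<^sub>1\<close> on \<open>\<ell>\<^sup>2(X)\<close> and \<open>\<pi>\<^sub>2\<close> on \<open>\<ell>\<^sup>2(Y)\<close>: the isometric representation \<open>\<rho>\<close>
  carries \<open>\<tau> a c\<close> to \<open>\<pi>\<^sub>1(a) \<otimes> \<pi>\<^sub>2(c)\<close>. Injectivity on the algebraic tensor product follows.
  This norm does not depend on the choice of \<open>\<pi>\<^sub>1\<close> and \<open>\<pi>\<^sub>2\<close>. Index sets inside \<open>'a\<close> and \<open>'c\<close>
  are large enough, because a C*-algebra has a faithful representation on a Hilbert space
  whose dimension is at most the cardinality of the algebra.\<close>

definition spatial_tensor_product ::
  "'a cstar_algebra \<Rightarrow> 'c cstar_algebra \<Rightarrow> 't cstar_algebra \<Rightarrow> ('a \<Rightarrow> 'c \<Rightarrow> 't) \<Rightarrow> bool" where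
  "spatial_tensor_product A C T \<tau> \<longleftrightarrow>
     unital_cstar_algebra T \<and>
     (\<forall>a\<in>carrier A. \<forall>c\<in>carrier C. \<tau> a c \<in> carrier T) \<and>
     (\<forall>a\<in>carrier A. \<forall>a'\<in>carrier A. \<forall>c\<in>carrier C. \<tau> (a \<oplus>\<^bsub>A\<^esub> a') c = \<tau> a c \<oplus>\<^bsub>T\<^esub> \<tau> a' c) \<and>
     (\<forall>a\<in>carrier A. \<forall>c\<in>carrier C. \<forall>c'\<in>carrier C. \<tau> a (c \<oplus>\<^bsub>C\<^esub> c') = \<tau> a c \<oplus>\<^bsub>T\<^esub> \<tau> a c') \<and>
     (\<forall>a\<in>carrier A. \<forall>c\<in>carrier C. \<forall>z. \<tau> (z \<odot>\<^bsub>A\<^esub> a) c = z \<odot>\<^bsub>T\<^esub> \<tau> a c) \<and>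
     (\<forall>a\<in>carrier A. \<forall>c\<in>carrier C. \<forall>z. \<tau> a (z \<odot>\<^bsub>C\<^esub> c) = z \<odot>\<^bsub>T\<^esub> \<tau> a c) \<and>
     (\<forall>a\<in>carrier A. \<forall>a'\<in>carrier A. \<forall>c\<in>carrier C. \<forall>c'\<in>carrier C.
        \<tau> a c \<otimes>\<^bsub>T\<^esub> \<tau> a' c' = \<tau> (a \<otimes>\<^bsub>A\<^esub> a') (c \<otimes>\<^bsub>C\<^esub> c')) \<and>
     (\<forall>a\<in>carrier A. \<forall>c\<in>carrier C. adj T (\<tau> a c) = \<tau> (adj A a) (adj C c)) \<and>
     \<tau> \<one>\<^bsub>A\<^esub> \<one>\<^bsub>C\<^esub> = \<one>\<^bsub>T\<^esub> \<and>
     (\<exists>(X :: 'a set) (Y :: 'c set) \<pi>\<^sub>1 \<pi>\<^sub>2 \<rho>.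
        faithful_representation A X \<pi>\<^sub>1 \<and> faithful_representation C Y \<pi>\<^sub>2 \<and>
        representation T (X \<times> Y) \<rho> \<and>
        (\<forall>t\<in>carrier T. operator_norm (X \<times> Y) (\<rho> t) = nrm T t) \<and>
        (\<forall>a\<in>carrier A. \<forall>c\<in>carrier C. \<forall>f\<in>ell2 X. \<forall>g\<in>ell2 Y.
           \<rho> (\<tau> a c) (ell2_tensor f g) = ell2_tensor (\<pi>\<^sub>1 a f) (\<pi>\<^sub>2 c g))) \<and>
     (\<forall>t\<in>carrier T. \<forall>e>0. \<exists>(n :: nat) a c.
        (\<forall>k\<in>{1..n}. a k \<in> carrier A \<and> c k \<in> carrier C) \<and>
        nrm T (t \<ominus>\<^bsub>T\<^esub> (\<Oplus>\<^bsub>T\<^esub>k\<in>{1..n}. \<tau> (a k) (c k))) < e)"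

definition tensor_state ::
  "'a cstar_algebra \<Rightarrow> ('a \<Rightarrow> complex) \<Rightarrow> 'c cstar_algebra \<Rightarrow> ('c \<Rightarrow> complex) \<Rightarrow>
   't cstar_algebra \<Rightarrow> ('a \<Rightarrow> 'c \<Rightarrow> 't) \<Rightarrow> ('t \<Rightarrow> complex) \<Rightarrow> bool" where
  "tensor_state A \<phi> C \<psi> T \<tau> \<eta> \<longleftrightarrow> cstar_prob_space T \<eta> \<and>
     (\<forall>a\<in>carrier A. \<forall>c\<in>carrier C. \<eta> (\<tau> a c) = \<phi> a * \<psi> c)"


section \<open>Joint moments, freeness and free cumulants\<close>

text \<open>The product of the \<open>x v\<close>, \<open>v \<in> V\<close>, in increasing order of the positions \<open>v\<close>.
  A tuple \<open>(x\<^sub>1, \<dots>, x\<^sub>n)\<close> is given by a function on \<open>nat\<close> of which only the values on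
  \<open>{1..n}\<close> matter.\<close>

definition ordered_prod :: "'a cstar_algebra \<Rightarrow> (nat \<Rightarrow> 'a) \<Rightarrow> nat set \<Rightarrow> 'a" where
  "ordered_prod A x V = foldr (\<lambda>v y. x v \<otimes>\<^bsub>A\<^esub> y) (sorted_list_of_set V) \<one>\<^bsub>A\<^esub>"

definition same_distribution ::
  "'a cstar_algebra \<Rightarrow> ('a \<Rightarrow> complex) \<Rightarrow> ('i \<Rightarrow> 'a) \<Rightarrow>
   'b cstar_algebra \<Rightarrow> ('b \<Rightarrow> complex) \<Rightarrow> ('i \<Rightarrow> 'b) \<Rightarrow> bool" where
  "same_distribution A \<phi> x B \<psi> y \<longleftrightarrow>
     (\<forall>m i. \<phi> (ordered_prod A (\<lambda>k. x (i k)) {1..m}) = \<psi> (ordered_prod B (\<lambda>k. y (i k)) {1..m}))"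

definition unital_subalgebra :: "'a cstar_algebra \<Rightarrow> 'a set \<Rightarrow> bool" where
  "unital_subalgebra A S \<longleftrightarrow> S \<subseteq> carrier A \<and> \<one>\<^bsub>A\<^esub> \<in> S \<and>
     (\<forall>x\<in>S. \<forall>y\<in>S. x \<oplus>\<^bsub>A\<^esub> y \<in> S \<and> x \<otimes>\<^bsub>A\<^esub> y \<in> S) \<and> (\<forall>x\<in>S. \<forall>c. c \<odot>\<^bsub>A\<^esub> x \<in> S)"

definition free_subalgebras ::
  "'a cstar_algebra \<Rightarrow> ('a \<Rightarrow> complex) \<Rightarrow> 'j set \<Rightarrow> ('j \<Rightarrow> 'a set) \<Rightarrow> bool" where
  "free_subalgebras A \<phi> J S \<longleftrightarrow> (\<forall>j\<in>J. unital_subalgebra A (S j)) \<and>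
     (\<forall>n\<ge>1. \<forall>x l.
        (\<forall>k\<in>{1..n}. l k \<in> J \<and> x k \<in> S (l k) \<and> \<phi> (x k) = 0) \<longrightarrow>
        (\<forall>k\<in>{1..<n}. l k \<noteq> l (k + 1)) \<longrightarrow>
        \<phi> (ordered_prod A x {1..n}) = 0)"

definition free_sequences ::
  "'a cstar_algebra \<Rightarrow> ('a \<Rightarrow> complex) \<Rightarrow> 'j set \<Rightarrow> ('j \<Rightarrow> 'i \<Rightarrow> 'a) \<Rightarrow> bool" where
  "free_sequences A \<phi> J x \<longleftrightarrow>
     free_subalgebras A \<phi> J (\<lambda>j. unital_subalgebra A hull range (x j))"

definition NC :: "nat \<Rightarrow> nat set set set" where
  "NC n = {P. partition_on {1..n} P \<and>
     (\<forall>V\<in>P. \<forall>W\<in>P. \<forall>a b c d.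
        a < b \<and> b < c \<and> c < d \<and> a \<in> V \<and> c \<in> V \<and> b \<in> W \<and> d \<in> W \<longrightarrow> V = W)}"

lemma finite_NC: "finite (NC n)"
  by (rule finite_subset[OF _ finitely_many_partition_on[of "{1..n}"]]) (auto simp: NC_def)

function mobius_NC :: "nat \<Rightarrow> nat set set \<Rightarrow> nat set set \<Rightarrow> int" where
  "mobius_NC n P Q = (if P = Q then 1 else
     - (\<Sum>R\<in>{R \<in> NC n. refines {1..n} P R \<and> refines {1..n} R Q \<and> R \<noteq> Q}. mobius_NC n P R))"
  by pat_completeness auto
termination
proof (relation "Wellfounded.measure (\<lambda>(n, P, Q).
    card {R \<in> NC n. refines {1..n} P R \<and> refines {1..n} R Q \<and> R \<noteq> Q})")
  fix n P Q R
  assume R: "R \<in> {R \<in> NC n. refines {1..n} P R \<and> refines {1..n} R Q \<and> R \<noteq> Q}"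
  let ?I = "\<lambda>Q. {R \<in> NC n. refines {1..n} P R \<and> refines {1..n} R Q \<and> R \<noteq> Q}"
  have "?I R \<subset> ?I Q"
    using R by (auto intro: refines_trans dest: refines_asym)
  moreover have "finite (?I Q)"
    using finite_NC by (rule rev_finite_subset) auto
  ultimately show "((n, P, R), (n, P, Q)) \<in> Wellfounded.measure (\<lambda>(n, P, Q).
      card {R \<in> NC n. refines {1..n} P R \<and> refines {1..n} R Q \<and> R \<noteq> Q})"
    by (simp add: psubset_card_mono)
qed auto

declare mobius_NC.simps [simp del]

definition partition_moment ::
  "'a cstar_algebra \<Rightarrow> ('a \<Rightarrow> complex) \<Rightarrow> nat set set \<Rightarrow> (nat \<Rightarrow> 'a) \<Rightarrow> complex" where
  "partition_moment A \<phi> P x = (\<Prod>V\<in>P. \<phi> (ordered_prod A x V))"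

definition free_cumulant ::
  "'a cstar_algebra \<Rightarrow> ('a \<Rightarrow> complex) \<Rightarrow> nat \<Rightarrow> (nat \<Rightarrow> 'a) \<Rightarrow> complex" where
  "free_cumulant A \<phi> n x =
     (\<Sum>P\<in>NC n. partition_moment A \<phi> P x * of_int (mobius_NC n P {{1..n}}))"


section \<open>Compound free Poisson variables and convergence along ultrafilters\<close>

text \<open>A C*-algebra generated by countably many elements has at most the cardinality of the
  continuum, so it has an isomorphic copy carried by a subset of the following type.
  Existential claims about C*-probability spaces in which only countably many elements
  matter therefore lose no generality by being stated over this type.\<close>

type_synonym cstar_universe = "(nat \<Rightarrow> complex) \<Rightarrow> (nat \<Rightarrow> complex)"

definition compound_free_poisson ::
  "'b cstar_algebra \<Rightarrow> ('b \<Rightarrow> complex) \<Rightarrow> 'b \<Rightarrow> bool" where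
  "compound_free_poisson B \<phi> b \<longleftrightarrow> b \<in> carrier B \<and>
     (\<exists>c>0. \<exists>(D :: cstar_universe cstar_algebra) \<theta> a.
        cstar_prob_space D \<theta> \<and> self_adjoint D a \<and>
        (\<forall>n\<ge>1. free_cumulant B \<phi> n (\<lambda>_. b) = complex_of_real c * \<theta> (a [^]\<^bsub>D\<^esub> n)))"

definition free_ultrafilter :: "nat filter \<Rightarrow> bool" where
  "free_ultrafilter \<omega> \<longleftrightarrow> \<omega> \<noteq> bot \<and>
     (\<forall>P. eventually P \<omega> \<or> eventually (\<lambda>N. \<not> P N) \<omega>) \<and>
     (\<forall>S. finite S \<longrightarrow> \<not> eventually (\<lambda>N. N \<in> S) \<omega>)"

definition converges_in_distribution ::
  "nat filter \<Rightarrow> (nat \<Rightarrow> 'a cstar_algebra) \<Rightarrow> (nat \<Rightarrow> 'a \<Rightarrow> complex) \<Rightarrow> (nat \<Rightarrow> 'i \<Rightarrow> 'a) \<Rightarrow>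
   'b cstar_algebra \<Rightarrow> ('b \<Rightarrow> complex) \<Rightarrow> ('i \<Rightarrow> 'b) \<Rightarrow> bool" where
  "converges_in_distribution \<omega> A \<phi> x B \<psi> y \<longleftrightarrow>
     (\<forall>m i. ((\<lambda>N. \<phi> N (ordered_prod (A N) (\<lambda>k. x N (i k)) {1..m}))
        \<longlongrightarrow> \<psi> (ordered_prod B (\<lambda>k. y (i k)) {1..m})) \<omega>)"

end

theory Submission
  imports Defs "HOL-Library.Sublist"
begin

text \<open>
  The ultrafilter \<open>\<omega>\<close> can be any free one. A product of projections has a state
  of modulus at most the largest state of its factors (\<open>state_projections_bound\<close>), so
  \<open>N\<close> times such a state is bounded by \<open>lam_sup\<close> and has a limit along \<open>\<omega>\<close>. Multiplied by the moment
  of the corresponding \<open>a i\<close>, this limit is the prescribed cumulant \<open>\<kappa>(u)\<close> of the word \<open>u\<close> of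
  indices. As states of elementary tensors are products, \<open>\<kappa>(u)\<close> is the limit of \<open>N\<close> times the
  moment \<open>u\<close> of one summand.

  A moment of the sums \<open>s\<^sub>N\<close> is a sum over all colourings of the positions by \<open>1, \<dots>, N\<close>. Freeness
  and identical distribution imply that a term only depends on the kernel of the colouring, that is
  on the partition \<open>P\<close> of the positions by colour (\<open>free_iid_moments_rename\<close>). After multiplication
  by \<open>N\<close> to the power \<open>|P|\<close> the term converges to the product of \<open>\<kappa>\<close> over the blocks if \<open>P\<close> is
  non-crossing, and to zero otherwise (\<open>free_iid_moments_limit\<close>): centring all factors expresses
  a moment through shorter ones, in which only the singleton colours survive in the limit. As
  \<open>N (N - 1) \<cdots> (N - |P| + 1)\<close> colourings have kernel \<open>P\<close>, the moments of \<open>s\<^sub>N\<close> converge to the sum of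
  the products of \<open>\<kappa>\<close> over all non-crossing partitions (\<open>sum_colourings_limit\<close>). Moebius inversion
  (\<open>mobius_inversion_of_moments\<close>) turns this into the statement that any variables with these moments
  have the free cumulants \<open>\<kappa>\<close>.

  Such variables exist as bounded operators. The limit functional on non-commuting polynomials is
  positive as a limit of positive functionals, and it grows at most exponentially with the length of a
  word, since there are at most \<open>4\<^sup>n\<close> non-crossing partitions (\<open>card_NC_on_le\<close>) and states are
  bounded by the norm (\<open>state_le_nrm\<close>). A Gelfand-Naimark-Segal construction realises every such
  functional (\<open>moment_realization\<close>): Gram-Schmidt turns multiplication by a letter into a Hermitian
  matrix with finite rows, the growth bounds it on square-summable sequences, and all adjointable
  operators there form the C*-algebra. The same construction, applied to the moments of the \<open>a\<^sub>i\<close> themselves,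
  gives the space in which \<open>b\<^sub>i\<close> is seen to be compound free Poisson with rate \<open>\<lambda>\<^sub>i\<close>, because
  a projection \<open>p\<close> equals its powers, so that \<open>N \<psi>\<^sub>N(p\<^sup>n) = \<lambda>\<^sub>i\<close>.
\<close>

section \<open>Products of lists and the Cauchy-Schwarz inequality for states\<close>

definition lprod :: "'a cstar_algebra \<Rightarrow> 'a list \<Rightarrow> 'a" where
  "lprod A xs = foldr (\<lambda>x y. x \<otimes>\<^bsub>A\<^esub> y) xs \<one>\<^bsub>A\<^esub>"

lemma lprod_Nil [simp]: "lprod A [] = \<one>\<^bsub>A\<^esub>"
  and lprod_Cons [simp]: "lprod A (x # xs) = x \<otimes>\<^bsub>A\<^esub> lprod A xs"
  by (simp_all add: lprod_def)

lemma ordered_prod_eq_lprod: "ordered_prod A x V = lprod A (map x (sorted_list_of_set V))"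
  by (simp add: ordered_prod_def lprod_def foldr_map comp_def)

lemma sorted_list_of_set_Icc: "sorted_list_of_set {1..n} = [1..<Suc n]"
  by (metis atLeastLessThanSuc_atLeastAtMost sorted_list_of_set_range)

text \<open>The Cauchy-Schwarz inequality for the span of two vectors, read off from the four values of
  the form on them. In scalar form it serves both for a state on an algebra and for the form on
  formal polynomials used further below.\<close>

lemma psd_two_by_two:
  fixes a b c d :: complex
  assumes "\<And>s t. cnj s * s * a + cnj s * t * b + cnj t * s * c + cnj t * t * d \<in> \<real>\<^sub>\<ge>\<^sub>0"
  shows "a \<in> \<real>\<^sub>\<ge>\<^sub>0" "d \<in> \<real>\<^sub>\<ge>\<^sub>0" "c = cnj b" "(cmod b)\<^sup>2 \<le> Re a * Re d"
proof -
  show a: "a \<in> \<real>\<^sub>\<ge>\<^sub>0" and d: "d \<in> \<real>\<^sub>\<ge>\<^sub>0"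
    using assms[of 1 0] assms[of 0 1] by auto
  show cb: "c = cnj b"
    using assms[of 1 1] assms[of 1 \<i>] a d
    by (auto simp: complex_nonneg_Reals_iff complex_eq_iff)
  have r: "Re a \<ge> 0" "Im a = 0" "Re d \<ge> 0" "Im d = 0"
    using a d by (auto simp: complex_nonneg_Reals_iff)
  have bb: "cnj b * b = complex_of_real ((cmod b)\<^sup>2)"
    by (metis complex_norm_square mult.commute)
  show "(cmod b)\<^sup>2 \<le> Re a * Re d"
  proof (cases "Re a = 0")
    case True
    then have a0: "a = 0" using r by (simp add: complex_eq_iff)
    have "2 * k * (cmod b)\<^sup>2 \<le> Re d" for k :: real
    proof -
      have "cnj (- (k *\<^sub>R b)) * (- (k *\<^sub>R b)) * a + cnj (- (k *\<^sub>R b)) * 1 * b + cnj 1 * (- (k *\<^sub>R b)) * c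
            + cnj 1 * 1 * d = - 2 * k * (cnj b * b) + d"
        using a0 cb by (simp add: scaleR_conv_of_real)
      with assms[of "- (k *\<^sub>R b)" 1] have "- 2 * k * (cnj b * b) + d \<in> \<real>\<^sub>\<ge>\<^sub>0"
        by metis
      then show ?thesis unfolding bb
        by (simp add: complex_nonneg_Reals_iff)
    qed
    note k = this
    have "b = 0"
    proof (rule ccontr)
      assume "b \<noteq> 0"
      then have "(cmod b)\<^sup>2 > 0" by simp
      moreover have "2 * ((Re d + 1) / (cmod b)\<^sup>2) * (cmod b)\<^sup>2 \<le> Re d"
        by (rule k)
      ultimately show False using r by simp
    qed
    then show ?thesis using True by simp
  next
    case False
    have a': "cnj a = a"
      using r by (simp add: complex_eq_iff)
    have "cnj (- b) * (- b) * a + cnj (- b) * a * b + cnj a * (- b) * c + cnj a * a * d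
        = a * (a * d - cnj b * b)"
      unfolding cb a' by (simp add: algebra_simps)
    with assms[of "- b" a] have "a * (a * d - cnj b * b) \<in> \<real>\<^sub>\<ge>\<^sub>0" by metis
    then have "Re a * (Re a * Re d - (cmod b)\<^sup>2) \<ge> 0"
      unfolding bb using r by (simp add: complex_nonneg_Reals_iff)
    then show ?thesis using False r by (simp add: zero_le_mult_iff)
  qed
qed

context unital_cstar_algebra
begin

lemma lprod_closed [intro, simp]: "set xs \<subseteq> carrier A \<Longrightarrow> lprod A xs \<in> carrier A"
  by (induction xs) auto

lemma lprod_append:
  "\<lbrakk>set xs \<subseteq> carrier A; set ys \<subseteq> carrier A\<rbrakk> \<Longrightarrow> lprod A (xs @ ys) = lprod A xs \<otimes> lprod A ys"
  by (induction xs) (auto simp: m_assoc)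

lemma lprod_replicate: "x \<in> carrier A \<Longrightarrow> lprod A (replicate n x) = x [^] n"
proof (induction n)
  case (Suc n)
  then show ?case using nat_pow_Suc2[of x n] by simp
qed simp

lemma scale_zero: "x \<in> carrier A \<Longrightarrow> 0 \<odot> x = \<zero>"
  by (metis add.right_cancel scale_closed scale_left_distrib add_0 l_zero zero_closed)

lemma scale_minus_one: "x \<in> carrier A \<Longrightarrow> (- 1) \<odot> x = \<ominus> x"
  using scale_left_distrib[of x "- 1" 1] add.inv_equality[of "(- 1) \<odot> x" x]
  by (simp add: scale_one scale_zero scale_closed a_inv_def)

lemma minus_eq_scale: "\<lbrakk>x \<in> carrier A; y \<in> carrier A\<rbrakk> \<Longrightarrow> x \<ominus> y = x \<oplus> (- 1) \<odot> y"
  by (simp add: minus_eq scale_minus_one)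

lemma adj_one: "adj A \<one> = \<one>"
  by (metis adj_adj adj_closed adj_mult l_one one_closed)

lemma adj_lprod:
  "(\<And>x. x \<in> set xs \<Longrightarrow> self_adjoint A x) \<Longrightarrow> adj A (lprod A xs) = lprod A (rev xs)"
proof (induction xs)
  case (Cons x xs)
  then have "set (x # xs) \<subseteq> carrier A" by (auto simp: self_adjoint_def)
  with Cons show ?case by (simp add: adj_mult lprod_append self_adjoint_def)
qed (simp add: adj_one)

lemma nrm_zero: "nrm A \<zero> = 0"
  using nrm_eq_zero_iff by blast

lemma nrm_uminus: "x \<in> carrier A \<Longrightarrow> nrm A (\<ominus> x) = nrm A x"
  by (simp flip: scale_minus_one add: nrm_scale)

lemma nrm_nonneg: "x \<in> carrier A \<Longrightarrow> 0 \<le> nrm A x"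
  using nrm_triangle[of x "\<ominus> x"] by (simp add: r_neg nrm_zero nrm_uminus)

lemma nrm_minus: "\<lbrakk>x \<in> carrier A; y \<in> carrier A\<rbrakk> \<Longrightarrow> nrm A (x \<ominus> y) \<le> nrm A x + nrm A y"
  using nrm_triangle[of x "\<ominus> y"] by (simp add: minus_eq nrm_uminus)

lemma nrm_lprod:
  assumes "set xs \<subseteq> carrier A" "nrm A \<one> \<le> 1"
  shows "nrm A (lprod A xs) \<le> prod_list (map (nrm A) xs)"
  using assms(1)
proof (induction xs)
  case (Cons x xs)
  have "nrm A (x \<otimes> lprod A xs) \<le> nrm A x * nrm A (lprod A xs)"
    using Cons.prems by (intro nrm_mult) auto
  also have "\<dots> \<le> nrm A x * prod_list (map (nrm A) xs)"
    using Cons by (intro mult_left_mono nrm_nonneg) auto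
  finally show ?case by simp
qed (use assms in simp)

lemma nrm_one: "nrm A \<one> \<le> 1"
  using cstar_identity[of \<one>] nrm_nonneg[of \<one>] by (auto simp: adj_one power2_eq_square)

lemma nrm_adj:
  assumes "x \<in> carrier A"
  shows "nrm A (adj A x) = nrm A x"
proof -
  have *: "nrm A y \<le> nrm A (adj A y)" if y: "y \<in> carrier A" for y
  proof -
    have "nrm A y * nrm A y \<le> nrm A (adj A y) * nrm A y"
      using cstar_identity[OF y] nrm_mult[OF adj_closed[OF y] y] by (simp add: power2_eq_square)
    then show ?thesis
      using nrm_nonneg[OF y] nrm_nonneg[OF adj_closed[OF y]]
      by (cases "nrm A y = 0") (auto simp: mult_le_cancel_right)
  qed
  show ?thesis
    using *[OF assms] *[OF adj_closed[OF assms]] by (simp add: adj_adj assms)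
qed

end

context cstar_prob_space
begin

lemma state_sesquilinear:
  assumes x: "x \<in> carrier A" and y: "y \<in> carrier A"
  shows "\<phi> (adj A (s \<odot> x \<oplus> t \<odot> y) \<otimes> (s \<odot> x \<oplus> t \<odot> y)) =
    cnj s * s * \<phi> (adj A x \<otimes> x) + cnj s * t * \<phi> (adj A x \<otimes> y) +
    cnj t * s * \<phi> (adj A y \<otimes> x) + cnj t * t * \<phi> (adj A y \<otimes> y)"
proof -
  have "adj A (s \<odot> x \<oplus> t \<odot> y) \<otimes> (s \<odot> x \<oplus> t \<odot> y)
      = (cnj s * s) \<odot> (adj A x \<otimes> x) \<oplus> (cnj t * s) \<odot> (adj A y \<otimes> x)
        \<oplus> ((cnj s * t) \<odot> (adj A x \<otimes> y) \<oplus> (cnj t * t) \<odot> (adj A y \<otimes> y))"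
    using x y
    by (simp add: adj_add adj_scale scale_closed adj_closed l_distr r_distr mult_scale_left
        mult_scale_right scale_right_distrib scale_scale mult.commute)
  then show ?thesis
    using x y by (simp add: state_add state_scale scale_closed adj_closed)
qed

lemma state_cauchy_schwarz_facts:
  assumes x: "x \<in> carrier A" and y: "y \<in> carrier A"
  shows "\<phi> (adj A y \<otimes> x) = cnj (\<phi> (adj A x \<otimes> y))"
    and "(cmod (\<phi> (adj A x \<otimes> y)))\<^sup>2 \<le> Re (\<phi> (adj A x \<otimes> x)) * Re (\<phi> (adj A y \<otimes> y))"
proof -
  have "cnj s * s * \<phi> (adj A x \<otimes> x) + cnj s * t * \<phi> (adj A x \<otimes> y) +
    cnj t * s * \<phi> (adj A y \<otimes> x) + cnj t * t * \<phi> (adj A y \<otimes> y) \<in> \<real>\<^sub>\<ge>\<^sub>0" for s t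
    unfolding state_sesquilinear[OF x y, symmetric] using x y
    by (intro state_positive) (simp add: scale_closed)
  note psd = psd_two_by_two[OF this]
  from psd(3) show "\<phi> (adj A y \<otimes> x) = cnj (\<phi> (adj A x \<otimes> y))" .
  from psd(4) show "(cmod (\<phi> (adj A x \<otimes> y)))\<^sup>2 \<le> Re (\<phi> (adj A x \<otimes> x)) * Re (\<phi> (adj A y \<otimes> y))" .
qed

lemma state_kadison: "x \<in> carrier A \<Longrightarrow> (cmod (\<phi> x))\<^sup>2 \<le> Re (\<phi> (adj A x \<otimes> x))"
  using state_cauchy_schwarz_facts(2)[of \<one> x] by (simp add: adj_one state_one)

lemma state_positive_Re: "x \<in> carrier A \<Longrightarrow> 0 \<le> Re (\<phi> (adj A x \<otimes> x))"
  using state_positive[of x] by (simp add: complex_nonneg_Reals_iff)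

lemma state_zero: "\<phi> \<zero> = 0"
  using state_scale[of \<one> 0] by (simp add: scale_zero)

lemma state_finsum:
  "\<lbrakk>finite J; \<And>j. j \<in> J \<Longrightarrow> f j \<in> carrier A\<rbrakk> \<Longrightarrow> \<phi> (\<Oplus>j\<in>J. f j) = (\<Sum>j\<in>J. \<phi> (f j))"
proof (induction J rule: finite_induct)
  case (insert j J)
  then have "f \<in> J \<rightarrow> carrier A" by auto
  with insert show ?case by (simp add: finsum_insert state_add)
qed (simp add: state_zero)

lemma state_minus: "\<lbrakk>x \<in> carrier A; y \<in> carrier A\<rbrakk> \<Longrightarrow> \<phi> (x \<ominus> y) = \<phi> x - \<phi> y"
  by (simp add: minus_eq_scale state_add state_scale scale_closed)

end

section \<open>States are bounded by the norm\<close>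

context unital_cstar_algebra
begin

text \<open>If \<open>y = (h + y\<^sup>2) / 2\<close> then \<open>(1 - y)\<^sup>2 = 1 - h\<close>. The map \<open>y \<mapsto> (h + y\<^sup>2) / 2\<close> preserves the
  ball of radius \<open>r\<close> and contracts it by the factor \<open>r\<close>, so its iterates from \<open>0\<close> converge to such
  a \<open>y\<close>, which is self-adjoint because all iterates are.\<close>

lemma sqrt_one_minus:
  assumes h: "h \<in> carrier A" "adj A h = h" and r: "nrm A h \<le> r" "r < 1"
  shows "\<exists>y\<in>carrier A. adj A y = y \<and> y \<otimes> y = \<one> \<ominus> h"
proof -
  define F where "F y = (1/2) \<odot> (h \<oplus> y \<otimes> y)" for y
  define Y where "Y n = (F ^^ n) \<zero>" for n
  have r0: "0 \<le> r" using nrm_nonneg[OF h(1)] r(1) by linarith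
  have Fc: "F y \<in> carrier A" if "y \<in> carrier A" for y
    using that h by (simp add: F_def scale_closed)
  have Y0: "Y 0 = \<zero>" and YS: "Y (Suc n) = F (Y n)" for n
    by (simp_all add: Y_def)
  have Yc: "Y n \<in> carrier A" for n
    by (induction n) (auto simp: Y0 YS Fc)
  have Ya: "adj A (Y n) = Y n" for n
  proof (induction n)
    case 0
    show ?case unfolding Y0 using adj_scale[of \<one> 0] by (simp add: scale_zero adj_one)
  next
    case (Suc n)
    then show ?case unfolding YS F_def using h Yc[of n]
      by (simp add: adj_scale adj_add adj_mult scale_closed)
  qed
  have Yr: "nrm A (Y n) \<le> r" for n
  proof (induction n)
    case 0
    show ?case using r0 by (simp add: Y0 nrm_zero)
  next
    case (Suc n)
    have "nrm A (Y (Suc n)) = nrm A (h \<oplus> Y n \<otimes> Y n) / 2"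
      using h Yc[of n] by (simp add: YS F_def nrm_scale)
    also have "\<dots> \<le> (nrm A h + nrm A (Y n) * nrm A (Y n)) / 2"
      using nrm_triangle[of h "Y n \<otimes> Y n"] nrm_mult[of "Y n" "Y n"] h Yc[of n] by simp
    also have "\<dots> \<le> (r + r * 1) / 2"
      using r(1) mult_mono[of "nrm A (Y n)" r "nrm A (Y n)" 1] Suc r(2) r0 nrm_nonneg[OF Yc[of n]]
      by simp
    finally show ?case by simp
  qed
  have contr: "nrm A (F y \<ominus> F z) \<le> r * nrm A (y \<ominus> z)"
    if yz: "y \<in> carrier A" "z \<in> carrier A" "nrm A y \<le> r" "nrm A z \<le> r" for y z
  proof -
    have "F y \<ominus> F z = (1/2) \<odot> (h \<oplus> y \<otimes> y) \<oplus> (1/2) \<odot> ((-1) \<odot> (h \<oplus> z \<otimes> z))"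
      using yz h by (simp add: F_def minus_eq_scale scale_scale scale_closed)
    also have "\<dots> = (1/2) \<odot> ((h \<oplus> y \<otimes> y) \<ominus> (h \<oplus> z \<otimes> z))"
      using yz h by (simp add: minus_eq_scale scale_right_distrib scale_closed)
    also have "(h \<oplus> y \<otimes> y) \<ominus> (h \<oplus> z \<otimes> z) = y \<otimes> (y \<ominus> z) \<oplus> (y \<ominus> z) \<otimes> z"
      using yz h by algebra
    finally have "nrm A (F y \<ominus> F z) = nrm A (y \<otimes> (y \<ominus> z) \<oplus> (y \<ominus> z) \<otimes> z) / 2"
      using yz by (simp add: nrm_scale)
    also have "\<dots> \<le> (nrm A y * nrm A (y \<ominus> z) + nrm A (y \<ominus> z) * nrm A z) / 2"
      using yz nrm_triangle[of "y \<otimes> (y \<ominus> z)" "(y \<ominus> z) \<otimes> z"] nrm_mult[of y "y \<ominus> z"]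
        nrm_mult[of "y \<ominus> z" z] by simp
    also have "\<dots> \<le> (r * nrm A (y \<ominus> z) + nrm A (y \<ominus> z) * r) / 2"
      using yz by (intro divide_right_mono add_mono mult_right_mono mult_left_mono) (auto intro!: nrm_nonneg)
    finally show ?thesis by simp
  qed
  have step: "nrm A (Y (Suc n) \<ominus> Y n) \<le> r ^ n" for n
  proof (induction n)
    case 0
    have "Y (Suc 0) \<ominus> Y 0 = Y (Suc 0)"
      unfolding Y0 using Yc[of "Suc 0"] by algebra
    then show ?case using Yr[of "Suc 0"] r(2) by simp
  next
    case (Suc n)
    have "nrm A (Y (Suc (Suc n)) \<ominus> Y (Suc n)) \<le> r * nrm A (Y (Suc n) \<ominus> Y n)"
      using contr[OF Yc Yc Yr Yr, of "Suc n" n] by (simp add: YS)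
    also have "\<dots> \<le> r * r ^ n" using Suc r0 by (rule mult_left_mono)
    finally show ?case by simp
  qed
  have far: "nrm A (Y (n + k) \<ominus> Y n) \<le> r ^ n / (1 - r)" for n k
  proof -
    have "nrm A (Y (n + k) \<ominus> Y n) \<le> (\<Sum>i<k. r ^ (n + i))"
    proof (induction k)
      case 0
      have "Y n \<ominus> Y n = \<zero>" using Yc[of n] by algebra
      then show ?case by (simp add: nrm_zero)
    next
      case (Suc k)
      have "Y (n + Suc k) \<ominus> Y n = (Y (n + Suc k) \<ominus> Y (n + k)) \<oplus> (Y (n + k) \<ominus> Y n)"
        using Yc[of "n + Suc k"] Yc[of "n + k"] Yc[of n] by algebra
      then have "nrm A (Y (n + Suc k) \<ominus> Y n) \<le>
          nrm A (Y (n + Suc k) \<ominus> Y (n + k)) + nrm A (Y (n + k) \<ominus> Y n)"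
        using nrm_triangle[of "Y (n + Suc k) \<ominus> Y (n + k)" "Y (n + k) \<ominus> Y n"] Yc by simp
      also have "\<dots> \<le> r ^ (n + k) + (\<Sum>i<k. r ^ (n + i))"
        using Suc step[of "n + k"] by simp
      finally show ?case by simp
    qed
    also have "\<dots> = r ^ n * (\<Sum>i<k. r ^ i)"
      by (simp add: power_add sum_distrib_left)
    also have "\<dots> \<le> r ^ n * (1 / (1 - r))"
    proof (rule mult_left_mono)
      show "(\<Sum>i<k. r ^ i) \<le> 1 / (1 - r)"
        using r(2) r0 by (simp add: sum_gp_strict divide_right_mono)
    qed (use r0 in simp)
    finally show ?thesis by simp
  qed
  have "\<exists>M. \<forall>m\<ge>M. \<forall>n\<ge>M. nrm A (Y m \<ominus> Y n) < e" if "e > 0" for e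
  proof -
    have "(\<lambda>n. r ^ n / (1 - r)) \<longlonglongrightarrow> 0 / (1 - r)"
      using r(2) r0 by (intro tendsto_divide LIMSEQ_realpow_zero tendsto_const) auto
    from order_tendstoD(2)[OF this, of "e / 2"] that
    have "eventually (\<lambda>n. r ^ n / (1 - r) < e / 2) sequentially"
      by simp
    then obtain M where M: "r ^ M / (1 - r) < e / 2" by (auto simp: eventually_sequentially)
    have "nrm A (Y m \<ominus> Y n) < e" if mn: "m \<ge> M" "n \<ge> M" for m n
    proof -
      have "Y m \<ominus> Y n = (Y m \<ominus> Y M) \<ominus> (Y n \<ominus> Y M)"
        using Yc[of m] Yc[of n] Yc[of M] by algebra
      then have "nrm A (Y m \<ominus> Y n) \<le> nrm A (Y m \<ominus> Y M) + nrm A (Y n \<ominus> Y M)"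
        using nrm_minus[of "Y m \<ominus> Y M" "Y n \<ominus> Y M"] Yc by simp
      moreover have "nrm A (Y m \<ominus> Y M) < e / 2" "nrm A (Y n \<ominus> Y M) < e / 2"
        using le_less_trans[OF far[of M "m - M"] M] le_less_trans[OF far[of M "n - M"] M] mn by simp_all
      ultimately show ?thesis by simp
    qed
    then show ?thesis by blast
  qed
  then obtain y where y: "y \<in> carrier A" and lim: "(\<lambda>n. nrm A (Y n \<ominus> y)) \<longlonglongrightarrow> 0"
    using complete[of Y] Yc by blast
  have yr: "nrm A y \<le> r"
  proof (rule LIMSEQ_le_const)
    show "(\<lambda>n. nrm A (Y n \<ominus> y) + r) \<longlonglongrightarrow> r"
      using tendsto_add[OF lim tendsto_const[of r]] by simp
    have "nrm A y \<le> nrm A (Y n \<ominus> y) + r" for n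
    proof -
      have "y = Y n \<ominus> (Y n \<ominus> y)" using Yc[of n] y by algebra
      then show ?thesis
        using nrm_minus[of "Y n" "Y n \<ominus> y"] Yc[of n] y Yr[of n] by simp
    qed
    then show "\<exists>N. \<forall>n\<ge>N. nrm A y \<le> nrm A (Y n \<ominus> y) + r" by blast
  qed
  have zeroI: "z = \<zero>" if z: "z \<in> carrier A" "\<And>n. nrm A z \<le> B n" "B \<longlonglongrightarrow> 0" for z B
  proof -
    have "nrm A z \<le> 0" using that by (intro LIMSEQ_le_const[OF z(3)]) auto
    then show ?thesis using nrm_nonneg[OF z(1)] nrm_eq_zero_iff[OF z(1)] by simp
  qed
  have fix_pt: "y \<ominus> F y = \<zero>"
  proof (rule zeroI)
    show "y \<ominus> F y \<in> carrier A" using y Fc by simp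
    show "nrm A (y \<ominus> F y) \<le> nrm A (Y (Suc n) \<ominus> y) + r * nrm A (Y n \<ominus> y)" for n
    proof -
      have "y \<ominus> F y = (F (Y n) \<ominus> F y) \<ominus> (Y (Suc n) \<ominus> y)"
        unfolding YS using y Fc[OF y] Fc[OF Yc[of n]] by algebra
      then have "nrm A (y \<ominus> F y) \<le> nrm A (F (Y n) \<ominus> F y) + nrm A (Y (Suc n) \<ominus> y)"
        using nrm_minus[of "F (Y n) \<ominus> F y" "Y (Suc n) \<ominus> y"] y Fc Yc by simp
      then show ?thesis using contr[OF Yc[of n] y Yr yr] by simp
    qed
    show "(\<lambda>n. nrm A (Y (Suc n) \<ominus> y) + r * nrm A (Y n \<ominus> y)) \<longlonglongrightarrow> 0"
      using tendsto_add[OF LIMSEQ_Suc[OF lim] tendsto_mult[OF tendsto_const[of r] lim]] by simp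
  qed
  have ya: "y \<ominus> adj A y = \<zero>"
  proof (rule zeroI)
    show "y \<ominus> adj A y \<in> carrier A" using y adj_closed by simp
    show "nrm A (y \<ominus> adj A y) \<le> nrm A (Y n \<ominus> y) + nrm A (Y n \<ominus> y)" for n
    proof -
      have "adj A (Y n \<ominus> y) = Y n \<ominus> adj A y"
        using Yc[of n] y by (simp add: minus_eq_scale adj_add adj_scale scale_closed adj_closed Ya)
      moreover have "y \<ominus> adj A y = (Y n \<ominus> adj A y) \<ominus> (Y n \<ominus> y)"
        using Yc[of n] y adj_closed[OF y] by algebra
      ultimately show ?thesis
        using nrm_minus[of "Y n \<ominus> adj A y" "Y n \<ominus> y"] nrm_adj[of "Y n \<ominus> y"] Yc[of n] y adj_closed[OF y] by simp
    qed
    show "(\<lambda>n. nrm A (Y n \<ominus> y) + nrm A (Y n \<ominus> y)) \<longlonglongrightarrow> 0"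
      using tendsto_add[OF lim lim] by simp
  qed
  have eqI: "u = v" if "u \<in> carrier A" "v \<in> carrier A" "u \<ominus> v = \<zero>" for u v
  proof -
    have "u = (u \<ominus> v) \<oplus> v" using that(1,2) by algebra
    then show ?thesis using that by simp
  qed
  have ya': "adj A y = y" using eqI[OF y adj_closed[OF y] ya] by simp
  have "y = F y" using eqI[OF y Fc[OF y] fix_pt] .
  then have yy: "y \<oplus> y = h \<oplus> y \<otimes> y"
    using y h scale_left_distrib[of "h \<oplus> y \<otimes> y" "1/2" "1/2"] by (simp add: F_def scale_one)
  have "(\<one> \<ominus> y) \<otimes> (\<one> \<ominus> y) = \<one> \<oplus> y \<otimes> y \<ominus> (y \<oplus> y)"
    using y by (simp add: minus_eq l_distr r_distr l_minus r_minus minus_add a_ac)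
  also have "\<dots> = \<one> \<ominus> h" unfolding yy using y h by algebra
  finally have "(\<one> \<ominus> y) \<otimes> (\<one> \<ominus> y) = \<one> \<ominus> h" .
  moreover have "adj A (\<one> \<ominus> y) = \<one> \<ominus> y"
    using y ya' by (simp add: minus_eq_scale adj_add adj_scale scale_closed adj_one)
  ultimately show ?thesis using y by (intro bexI[of _ "\<one> \<ominus> y"]) auto
qed

end

context cstar_prob_space
begin

text \<open>For \<open>k > \<parallel>h\<parallel>\<close> the element \<open>k - h\<close> is a positive multiple of a square, so its state is
  nonnegative.\<close>

lemma state_le_nrm_self_adjoint:
  assumes h: "h \<in> carrier A" "adj A h = h"
  shows "Re (\<phi> h) \<le> nrm A h"
proof (rule field_le_epsilon)
  fix e :: real assume e: "e > 0"
  define k where "k = nrm A h + e"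
  have n0: "nrm A h \<ge> 0" using h by (simp add: nrm_nonneg)
  have k: "k > 0" using e n0 by (simp add: k_def)
  let ?h = "complex_of_real (1 / k) \<odot> h"
  have hc: "?h \<in> carrier A" "adj A ?h = ?h" using h by (auto simp: scale_closed adj_scale)
  have "nrm A ?h = nrm A h / k" using h k by (simp add: nrm_scale norm_divide)
  moreover have "nrm A h / k < 1" using k e by (simp add: k_def)
  ultimately obtain y where y: "y \<in> carrier A" "adj A y = y" "y \<otimes> y = \<one> \<ominus> ?h"
    using sqrt_one_minus[OF hc, of "nrm A h / k"] by auto
  have "0 \<le> Re (\<phi> (\<one> \<ominus> ?h))" using state_positive_Re[OF y(1)] y by simp
  then have "Re (\<phi> h) / k \<le> 1" using h hc by (simp add: state_minus state_one state_scale)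
  then show "Re (\<phi> h) \<le> nrm A h + e" using k by (simp add: k_def)
qed

lemma state_le_nrm:
  assumes x: "x \<in> carrier A"
  shows "cmod (\<phi> x) \<le> nrm A x"
proof (rule power2_le_imp_le)
  have "(cmod (\<phi> x))\<^sup>2 \<le> Re (\<phi> (adj A x \<otimes> x))" by (rule state_kadison[OF x])
  also have "\<dots> \<le> nrm A (adj A x \<otimes> x)"
    using x by (intro state_le_nrm_self_adjoint) (auto simp: adj_mult adj_adj adj_closed)
  finally show "(cmod (\<phi> x))\<^sup>2 \<le> (nrm A x)\<^sup>2" using cstar_identity[OF x] by simp
qed (use x nrm_nonneg in auto)

lemma state_lprod_le:
  assumes "set xs \<subseteq> carrier A"
  shows "cmod (\<phi> (lprod A xs)) \<le> prod_list (map (nrm A) xs)"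
  using state_le_nrm[of "lprod A xs"] nrm_lprod[OF assms nrm_one] assms by simp

section \<open>States of products of projections\<close>

text \<open>The difference of the two elements is \<open>w\<^sup>* w\<close> with \<open>w = (1 - p) z\<close>.\<close>

lemma state_projection_compress:
  assumes p: "projection A p" and z: "z \<in> carrier A"
  shows "Re (\<phi> (adj A (p \<otimes> z) \<otimes> (p \<otimes> z))) \<le> Re (\<phi> (adj A z \<otimes> z))"
proof -
  have pc: "p \<in> carrier A" "adj A p = p" "p \<otimes> p = p"
    using p by (auto simp: projection_def self_adjoint_def)
  let ?w = "z \<ominus> p \<otimes> z"
  have zc: "adj A z \<in> carrier A" using z adj_closed by simp
  have "adj A ?w = adj A z \<ominus> adj A z \<otimes> p"
    using pc z by (simp add: minus_eq_scale adj_add adj_scale adj_mult scale_closed adj_closed)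
  then have "adj A ?w \<otimes> ?w = adj A z \<otimes> z \<ominus> adj A z \<otimes> p \<otimes> z \<ominus> adj A z \<otimes> p \<otimes> z \<oplus> adj A z \<otimes> (p \<otimes> p) \<otimes> z"
    using pc(1) z zc by simp algebra
  also have "\<dots> = adj A z \<otimes> z \<ominus> adj A z \<otimes> p \<otimes> z"
    unfolding pc(3) using pc(1) z zc by algebra
  finally have 1: "adj A ?w \<otimes> ?w = adj A z \<otimes> z \<ominus> adj A z \<otimes> p \<otimes> z" .
  have "adj A (p \<otimes> z) \<otimes> (p \<otimes> z) = adj A z \<otimes> (p \<otimes> p) \<otimes> z"
    using pc(1,2) z zc by (simp add: adj_mult m_assoc)
  then have 2: "adj A (p \<otimes> z) \<otimes> (p \<otimes> z) = adj A z \<otimes> p \<otimes> z" using pc by simp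
  have "0 \<le> Re (\<phi> (adj A ?w \<otimes> ?w))" using pc z by (intro state_positive_Re) auto
  then show ?thesis unfolding 1 2 using pc z zc by (simp add: state_minus)
qed

text \<open>Cauchy-Schwarz splits off the first projection \<open>q\<close> and leaves \<open>\<phi>(x\<^sup>* x)\<close> for the whole product \<open>x\<close>.
  Compression then removes the projections from the inside of \<open>x\<^sup>* x\<close> one after the other, until
  only the state of the last one is left. Each of the two factors contributes \<open>\<surd>c\<close>.\<close>

lemma state_projections_bound:
  assumes p: "\<And>p. p \<in> set ps \<Longrightarrow> projection A p" and le: "\<And>p. p \<in> set ps \<Longrightarrow> Re (\<phi> p) \<le> c"
    and ne: "ps \<noteq> []"
  shows "cmod (\<phi> (lprod A ps)) \<le> c"
proof -
  have pos: "0 \<le> Re (\<phi> p)" if "projection A p" for p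
    using that state_positive_Re[of p] by (simp add: projection_def self_adjoint_def)
  have *: "Re (\<phi> (adj A (lprod A ps) \<otimes> lprod A ps)) \<le> c"
    if "ps \<noteq> []" "\<And>p. p \<in> set ps \<Longrightarrow> projection A p" "\<And>p. p \<in> set ps \<Longrightarrow> Re (\<phi> p) \<le> c" for ps
    using that
  proof (induction ps rule: list_nonempty_induct)
    case (single p)
    then show ?case by (simp add: projection_def self_adjoint_def)
  next
    case (cons p ps)
    have "set ps \<subseteq> carrier A" using cons.prems by (auto simp: projection_def self_adjoint_def)
    then show ?case using state_projection_compress[of p "lprod A ps"] cons by force
  qed
  obtain q qs where ps: "ps = q # qs" using ne by (cases ps) auto
  have q: "projection A q" "q \<in> carrier A" "adj A q = q" "q \<otimes> q = q" "Re (\<phi> q) \<le> c"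
    using p[of q] le[of q] by (auto simp: ps projection_def self_adjoint_def)
  have c: "0 \<le> c" using pos[OF q(1)] q(5) by simp
  have qs: "lprod A qs \<in> carrier A"
    using p by (intro lprod_closed) (auto simp: ps projection_def self_adjoint_def)
  have pp: "q \<otimes> lprod A ps = lprod A ps"
    using q qs by (simp add: ps flip: m_assoc)
  have pc: "lprod A ps \<in> carrier A" using q qs by (simp add: ps)
  have "(cmod (\<phi> (lprod A ps)))\<^sup>2 \<le> Re (\<phi> q) * Re (\<phi> (adj A (lprod A ps) \<otimes> lprod A ps))"
    using state_cauchy_schwarz_facts(2)[OF q(2) pc] unfolding q(3,4) pp .
  also have "\<dots> \<le> c * c"
    by (rule mult_mono[OF q(5) *[OF ne p le] c state_positive_Re[OF pc]])
  finally have "(cmod (\<phi> (lprod A ps)))\<^sup>2 \<le> c\<^sup>2" by (simp only: power2_eq_square)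
  then show ?thesis by (rule power2_le_imp_le[OF _ c])
qed

end

section \<open>Non-crossing partitions of finite sets of positions\<close>

definition noncrossing :: "nat set set \<Rightarrow> bool" where
  "noncrossing P \<longleftrightarrow> (\<forall>V\<in>P. \<forall>W\<in>P. \<forall>a b c d.
     a < b \<and> b < c \<and> c < d \<and> a \<in> V \<and> c \<in> V \<and> b \<in> W \<and> d \<in> W \<longrightarrow> V = W)"

text \<open>Blocks of a partition are themselves partitioned below, so positions range over arbitrary finite
  sets.\<close>

definition NC_on :: "nat set \<Rightarrow> nat set set set" where
  "NC_on S = {P. partition_on S P \<and> noncrossing P}"

lemma noncrossingD:
  "\<lbrakk>noncrossing P; V \<in> P; W \<in> P; a < b; b < c; c < d; a \<in> V; c \<in> V; b \<in> W; d \<in> W\<rbrakk> \<Longrightarrow> V = W"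
  unfolding noncrossing_def by blast

lemma NC_eq_NC_on: "NC n = NC_on {1..n}"
  by (simp add: NC_def NC_on_def noncrossing_def)

lemma finite_NC_on: "finite S \<Longrightarrow> finite (NC_on S)"
  using finitely_many_partition_on[of S] by (auto simp: NC_on_def elim: finite_subset[rotated])

lemma partition_on_unique_block:
  "\<lbrakk>partition_on S P; V \<in> P; W \<in> P; x \<in> V; x \<in> W\<rbrakk> \<Longrightarrow> V = W"
  by (auto simp: partition_on_def dest: disjointD)

lemma NC_on_block:
  assumes "S \<noteq> {}"
  shows "{S} \<in> NC_on S"
  using assms by (auto simp: NC_on_def noncrossing_def partition_on_def)

subsection \<open>The number of non-crossing partitions grows at most exponentially\<close>

definition block_of :: "nat set set \<Rightarrow> nat \<Rightarrow> nat set" where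
  "block_of P k = (THE V. V \<in> P \<and> k \<in> V)"

lemma block_of:
  assumes "partition_on S P" "k \<in> S"
  shows "block_of P k \<in> P" "k \<in> block_of P k"
proof -
  have "\<exists>!V. V \<in> P \<and> k \<in> V"
    using assms partition_on_unique_block by (metis UnionE partition_onD1)
  from theI'[OF this] show "block_of P k \<in> P" "k \<in> block_of P k"
    by (auto simp: block_of_def)
qed

lemma block_of_eq: "\<lbrakk>partition_on S P; V \<in> P; k \<in> V\<rbrakk> \<Longrightarrow> block_of P k = V"
  unfolding block_of_def by (rule the_equality) (auto dest: partition_on_unique_block)

lemma partition_on_eq_blocks:
  assumes "partition_on S P"
  shows "block_of P ` S = P"
proof
  show "block_of P ` S \<subseteq> P" using block_of(1)[OF assms] by auto
  show "P \<subseteq> block_of P ` S"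
  proof
    fix V assume V: "V \<in> P"
    obtain k where k: "k \<in> V" using V assms by (metis ex_in_conv partition_onD3)
    then have "k \<in> S" using partition_onD1[OF assms] V by auto
    then show "V \<in> block_of P ` S" using block_of_eq[OF assms V k] by auto
  qed
qed

text \<open>Read the positions from left to right. An element that is not the minimum of its block continues
  a block that has already been opened and not yet closed, and to avoid a crossing it must be the
  one used most recently. So the minima and the maxima determine the partition.\<close>

lemma NC_on_determined_by_Min_Max:
  assumes S: "finite S" and P: "P \<in> NC_on S" and Q: "Q \<in> NC_on S"
    and Min: "Min ` P = Min ` Q" and Max: "Max ` P = Max ` Q"
  shows "P = Q"
proof (rule ccontr)
  assume "P \<noteq> Q"
  have part: "partition_on S P" "partition_on S Q" and nc: "noncrossing P" "noncrossing Q"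
    using P Q by (auto simp: NC_on_def)
  define agree where "agree k \<longleftrightarrow>
    (\<forall>x\<in>S. \<forall>y\<in>S. x \<le> k \<longrightarrow> y \<le> k \<longrightarrow> (y \<in> block_of P x \<longleftrightarrow> y \<in> block_of Q x))" for k
  have fin: "finite V" "V \<noteq> {}" "V \<subseteq> S" if "partition_on S R" "V \<in> R" for V R
  proof -
    show "V \<subseteq> S" using partition_onD1[OF that(1)] that(2) by auto
    then show "finite V" using S finite_subset by auto
    show "V \<noteq> {}" using partition_onD3[OF that(1)] that(2) by auto
  qed
  have MinI: "k \<in> Min ` R \<longleftrightarrow> Min (block_of R k) = k" if "partition_on S R" "k \<in> S" for R k
  proof
    assume "k \<in> Min ` R"
    then obtain V where V: "V \<in> R" "k = Min V" by auto
    then have "k \<in> V" using fin[OF that(1) V(1)] by simp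
    then show "Min (block_of R k) = k" using block_of_eq[OF that(1) V(1)] V by simp
  qed (use block_of[OF that] in \<open>metis imageI\<close>)
  have MaxI: "k \<in> Max ` R \<longleftrightarrow> Max (block_of R k) = k" if "partition_on S R" "k \<in> S" for R k
  proof
    assume "k \<in> Max ` R"
    then obtain V where V: "V \<in> R" "k = Max V" by auto
    then have "k \<in> V" using fin[OF that(1) V(1)] by simp
    then show "Max (block_of R k) = k" using block_of_eq[OF that(1) V(1)] V by simp
  qed (use block_of[OF that] in \<open>metis imageI\<close>)
  have sym: "y \<in> block_of R x \<longleftrightarrow> block_of R x = block_of R y"
    if "partition_on S R" "x \<in> S" "y \<in> S" for R x y
    using block_of[OF that(1)] block_of_eq[OF that(1)] that by metis
  \<comment> \<open>The previous element of the block of \<open>k\<close> is the same in both partitions: if it were \<open>p\<close> in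
     one and \<open>q > p\<close> in the other, the block of \<open>q\<close> in the first would have to continue
     beyond \<open>k\<close> and cross the block of \<open>k\<close>.\<close>
  have key: "\<not> p < q"
    if R: "partition_on S R" "noncrossing R" and R': "partition_on S R'"
      and M: "Max ` R = Max ` R'"
      and k: "k \<in> S" and ag: "\<forall>x\<in>S. \<forall>y\<in>S. x < k \<longrightarrow> y < k \<longrightarrow> (y \<in> block_of R x \<longleftrightarrow> y \<in> block_of R' x)"
      and p: "p \<in> block_of R k" "p < k" "\<And>x. x \<in> block_of R k \<Longrightarrow> x < k \<Longrightarrow> x \<le> p"
      and q: "q \<in> block_of R' k" "q < k" "\<And>x. x \<in> block_of R' k \<Longrightarrow> x < k \<Longrightarrow> x \<le> q"
    for R R' k p q
  proof
    assume pq: "p < q"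
    have qS: "q \<in> S" using q(1) block_of(1)[OF R' k] fin(3)[OF R'] by auto
    have pS: "p \<in> S" using p(1) block_of(1)[OF R(1) k] fin(3)[OF R(1)] by auto
    have bq: "block_of R' q = block_of R' k" using sym[OF R' k qS] q(1) by simp
    have "k \<le> Max (block_of R' k)"
      using fin[OF R' block_of(1)[OF R' k]] block_of(2)[OF R' k] by (intro Max_ge)
    then have "Max (block_of R' q) \<noteq> q" using q(2) bq by simp
    then have "Max (block_of R q) \<noteq> q" using MaxI[OF R(1) qS] MaxI[OF R' qS] M by simp
    then obtain t where t: "t \<in> block_of R q" "q < t"
      using fin[OF R(1) block_of(1)[OF R(1) qS]] block_of(2)[OF R(1) qS]
      by (metis Max_eqI not_le)
    have tS: "t \<in> S" using t(1) block_of(1)[OF R(1) qS] fin(3)[OF R(1)] by auto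
    have "block_of R q \<noteq> block_of R k"
      using p(3)[of q] q(2) pq block_of(2)[OF R(1) qS] by auto
    then have "t \<noteq> k" using t(1) sym[OF R(1) qS k] by auto
    have "\<not> t < k"
    proof
      assume "t < k"
      then have "t \<in> block_of R' q" using ag qS tS q(2) t by blast
      then show False using q(3)[of t] bq t(2) \<open>t < k\<close> by simp
    qed
    then have "k < t" using \<open>t \<noteq> k\<close> by simp
    then have "block_of R k = block_of R q"
      using noncrossingD[OF R(2) block_of(1)[OF R(1) k] block_of(1)[OF R(1) qS] pq q(2) \<open>k < t\<close>]
        p(1) block_of(2)[OF R(1) k] block_of(2)[OF R(1) qS] t(1) by simp
    then show False using \<open>block_of R q \<noteq> block_of R k\<close> by simp
  qed
  have agree: "agree k" for k
  proof (induction k rule: less_induct)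
    case (less k)
    have IH: "\<forall>x\<in>S. \<forall>y\<in>S. x < k \<longrightarrow> y < k \<longrightarrow> (y \<in> block_of P x \<longleftrightarrow> y \<in> block_of Q x)"
    proof (intro ballI impI)
      fix x y assume "x \<in> S" "y \<in> S" "x < k" "y < k"
      then show "y \<in> block_of P x \<longleftrightarrow> y \<in> block_of Q x"
        using less.IH[of "max x y"] by (auto simp: agree_def)
    qed
    have new: "x \<in> block_of P k \<longleftrightarrow> x \<in> block_of Q k" if k: "k \<in> S" and x: "x \<in> S" "x < k" for x
    proof -
      define pr where "pr R = Max {x \<in> block_of R k. x < k}" for R
      have pr: "pr R \<in> block_of R k" "pr R < k" "\<And>x. x \<in> block_of R k \<Longrightarrow> x < k \<Longrightarrow> x \<le> pr R"
        if "partition_on S R" "Min (block_of R k) \<noteq> k" for R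
      proof -
        note f = fin[OF that(1) block_of(1)[OF that(1) k]]
        have "Min (block_of R k) \<le> k" "Min (block_of R k) \<in> block_of R k"
          using f block_of(2)[OF that(1) k] by auto
        then have ne: "{x \<in> block_of R k. x < k} \<noteq> {}" using that(2) by force
        have fi: "finite {x \<in> block_of R k. x < k}" using f by simp
        from Max_in[OF fi ne] show "pr R \<in> block_of R k" "pr R < k" by (auto simp: pr_def)
        show "x \<le> pr R" if "x \<in> block_of R k" "x < k" for x
          unfolding pr_def using fi that by (intro Max_ge) auto
      qed
      have minblock: "x \<notin> block_of R k" if "partition_on S R" "Min (block_of R k) = k" for R
        using Min_le[of "block_of R k" x] fin[OF that(1) block_of(1)[OF that(1) k]] that(2) x(2) by auto
      show ?thesis
      proof (cases "Min (block_of P k) = k")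
        case True
        then have "Min (block_of Q k) = k" using MinI[OF part(1) k] MinI[OF part(2) k] Min by simp
        then show ?thesis using minblock part True by blast
      next
        case False
        then have False': "Min (block_of Q k) \<noteq> k"
          using MinI[OF part(1) k] MinI[OF part(2) k] Min by simp
        note a = pr[OF part(1) False] and b = pr[OF part(2) False']
        have IH': "\<forall>x\<in>S. \<forall>y\<in>S. x < k \<longrightarrow> y < k \<longrightarrow> (y \<in> block_of Q x \<longleftrightarrow> y \<in> block_of P x)"
          using IH by blast
        have eq: "pr P = pr Q"
          using key[OF part(1) nc(1) part(2) Max k IH a b]
            key[OF part(2) nc(2) part(1) Max[symmetric] k IH' b a] by simp
        have pS: "pr P \<in> S" using a(1) fin(3)[OF part(1) block_of(1)[OF part(1) k]] by auto
        have "block_of P k = block_of P (pr P)" "block_of Q k = block_of Q (pr P)"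
          using sym[OF part(1) k pS] sym[OF part(2) k pS] a(1) b(1) eq by auto
        then show ?thesis using IH pS x a(2) by blast
      qed
    qed
    show ?case unfolding agree_def
    proof (intro ballI impI)
      fix x y assume xy: "x \<in> S" "y \<in> S" "x \<le> k" "y \<le> k"
      consider "x < k" "y < k" | "x = k" "y < k" | "x < k" "y = k" | "x = k" "y = k"
        using xy by linarith
      then show "y \<in> block_of P x \<longleftrightarrow> y \<in> block_of Q x"
      proof cases
        case 1
        then show ?thesis using IH xy by blast
      next
        case 2
        then show ?thesis using new[of y] xy by simp
      next
        case 3
        have swap: "y \<in> block_of R x \<longleftrightarrow> x \<in> block_of R y" if "partition_on S R" for R
          unfolding sym[OF that xy(1,2)] sym[OF that xy(2,1)] by (rule eq_commute)
        show ?thesis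
          unfolding swap[OF part(1)] swap[OF part(2)] using new[of x] xy(1,2) 3 by simp
      next
        case 4
        then show ?thesis using block_of(2)[OF part(1) xy(1)] block_of(2)[OF part(2) xy(1)] by simp
      qed
    qed
  qed
  have "block_of P k = block_of Q k" if "k \<in> S" for k
  proof -
    have "y \<in> block_of P k \<longleftrightarrow> y \<in> block_of Q k" if "y \<in> S" for y
      using agree[of "max k y", unfolded agree_def, rule_format, OF \<open>k \<in> S\<close> that] by simp
    then show ?thesis
      using fin(3)[OF part(1) block_of(1)[OF part(1) that]] fin(3)[OF part(2) block_of(1)[OF part(2) that]]
      by blast
  qed
  then have "block_of P ` S = block_of Q ` S" by (rule image_cong[OF refl])
  then show False using \<open>P \<noteq> Q\<close> by (simp add: partition_on_eq_blocks[OF part(1)] partition_on_eq_blocks[OF part(2)])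
qed

lemma card_NC_on_le:
  assumes S: "finite S"
  shows "card (NC_on S) \<le> 4 ^ card S"
proof -
  have "inj_on (\<lambda>P. (Min ` P, Max ` P)) (NC_on S)"
    using NC_on_determined_by_Min_Max[OF S] by (auto intro!: inj_onI)
  moreover have "(\<lambda>P. (Min ` P, Max ` P)) ` NC_on S \<subseteq> Pow S \<times> Pow S"
  proof (clarsimp, intro conjI subsetI; elim imageE)
    fix P x V assume P: "P \<in> NC_on S" and V: "V \<in> P"
    then have "V \<subseteq> S" "V \<noteq> {}" by (auto simp: NC_on_def partition_on_def)
    then have "Min V \<in> S" "Max V \<in> S"
      using finite_subset[OF \<open>V \<subseteq> S\<close> S] Min_in Max_in by blast+
    then show "x = Min V \<Longrightarrow> x \<in> S" "x = Max V \<Longrightarrow> x \<in> S" by simp_all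
  qed
  ultimately have "card (NC_on S) \<le> card (Pow S \<times> Pow S)"
    using S by (intro card_inj_on_le) auto
  also have "\<dots> = 4 ^ card S"
    using S by (simp add: card_cartesian_product card_Pow power_mult_distrib[symmetric])
  finally show ?thesis .
qed

subsection \<open>Moebius inversion\<close>

text \<open>The defining recursion makes the Moebius function a left inverse of the zeta function of
  the incidence algebra; a left inverse is also a right inverse.\<close>

lemma mobius_sum_right:
  assumes "P \<in> NC n" "Q \<in> NC n" "refines {1..n} P Q"
  shows "(\<Sum>R\<in>{R \<in> NC n. refines {1..n} P R \<and> refines {1..n} R Q}. mobius_NC n P R) = (if P = Q then 1 else 0)"
proof -
  have refl: "refines {1..n} R R" if "R \<in> NC n" for R
    using that by (intro refines_refl) (simp add: NC_def)
  let ?I = "{R \<in> NC n. refines {1..n} P R \<and> refines {1..n} R Q \<and> R \<noteq> Q}"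
  have I: "{R \<in> NC n. refines {1..n} P R \<and> refines {1..n} R Q} = insert Q ?I"
    using assms refl by auto
  have fin: "finite ?I" using finite_NC[of n] by simp
  have "(\<Sum>R\<in>insert Q ?I. mobius_NC n P R) = mobius_NC n P Q + (\<Sum>R\<in>?I. mobius_NC n P R)"
    using fin by (subst sum.insert) auto
  also have "\<dots> = (if P = Q then 1 else 0)"
  proof (cases "P = Q")
    case True
    then have I0: "?I = {}" by (auto dest: refines_asym)
    have "mobius_NC n P Q = 1" unfolding True by (subst mobius_NC.simps) simp
    then show ?thesis unfolding I0 using True by simp
  next
    case False
    then show ?thesis by (subst mobius_NC.simps[of n P Q]) simp
  qed
  finally show ?thesis unfolding I .
qed

lemma mobius_sum_left:
  assumes P: "P \<in> NC n" and Q: "Q \<in> NC n" and PQ: "refines {1..n} P Q"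
  shows "(\<Sum>R\<in>{R \<in> NC n. refines {1..n} P R \<and> refines {1..n} R Q}. mobius_NC n R Q) = (if P = Q then 1 else 0)"
  using P PQ
proof (induction "card {R \<in> NC n. refines {1..n} P R \<and> refines {1..n} R Q}" arbitrary: P rule: less_induct)
  case less
  define le where "le = refines {1..n}"
  define \<mu> where "\<mu> = mobius_NC n"
  have refl: "le R R" if "R \<in> NC n" for R
    unfolding le_def using that by (intro refines_refl) (simp add: NC_def)
  have trans: "le R S \<Longrightarrow> le S U \<Longrightarrow> le R U" for R S U unfolding le_def by (rule refines_trans)
  have asym: "le R S \<Longrightarrow> le S R \<Longrightarrow> R = S" for R S unfolding le_def by (rule refines_asym)
  have fin: "finite {R \<in> NC n. X R}" for X using finite_NC[of n] by simp
  let ?S = "\<lambda>R. \<Sum>U\<in>{U \<in> NC n. le R U \<and> le U Q}. \<mu> U Q"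
  have IH: "?S R = (if R = Q then 1 else 0)" if R: "R \<in> NC n" "le P R" "le R Q" "R \<noteq> P" for R
  proof -
    have "{U \<in> NC n. le R U \<and> le U Q} \<subseteq> {U \<in> NC n. le P U \<and> le U Q}"
      using R(2) trans by blast
    moreover have "P \<in> {U \<in> NC n. le P U \<and> le U Q}"
      using less.prems refl by (simp add: le_def)
    moreover have "P \<notin> {U \<in> NC n. le R U \<and> le U Q}"
      using asym[OF R(2)] R(4) by blast
    ultimately have "{U \<in> NC n. le R U \<and> le U Q} \<subset> {U \<in> NC n. le P U \<and> le U Q}"
      by blast
    then have "card {U \<in> NC n. le R U \<and> le U Q} < card {U \<in> NC n. le P U \<and> le U Q}"
      by (intro psubset_card_mono fin)
    then show ?thesis using less.hyps[of R] R by (simp add: le_def \<mu>_def)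
  qed
  \<comment> \<open>Evaluate the sum of \<open>\<mu> P R * \<mu> U Q\<close> over \<open>P \<le> R \<le> U \<le> Q\<close> in both orders.\<close>
  have "(\<Sum>R\<in>{R \<in> NC n. le P R \<and> le R Q}. \<mu> P R * ?S R) =
      (\<Sum>R\<in>{R \<in> NC n. le P R \<and> le R Q}. \<Sum>U\<in>{U \<in> NC n. (le P U \<and> le U Q) \<and> le R U}. \<mu> P R * \<mu> U Q)"
  proof (rule sum.cong[OF HOL.refl])
    fix R assume R: "R \<in> {R \<in> NC n. le P R \<and> le R Q}"
    have "{U \<in> NC n. le R U \<and> le U Q} = {U \<in> NC n. (le P U \<and> le U Q) \<and> le R U}"
      using R trans by blast
    then show "\<mu> P R * ?S R = (\<Sum>U\<in>{U \<in> NC n. (le P U \<and> le U Q) \<and> le R U}. \<mu> P R * \<mu> U Q)"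
      by (simp add: sum_distrib_left)
  qed
  also have "\<dots> = (\<Sum>R\<in>{R \<in> NC n. le P R \<and> le R Q}. \<Sum>U\<in>{U \<in> {U \<in> NC n. le P U \<and> le U Q}. le R U}. \<mu> P R * \<mu> U Q)"
    by (intro sum.cong) auto
  also have "\<dots> = (\<Sum>U\<in>{U \<in> NC n. le P U \<and> le U Q}. \<Sum>R\<in>{R \<in> {R \<in> NC n. le P R \<and> le R Q}. le R U}. \<mu> P R * \<mu> U Q)"
    by (rule sum.swap_restrict[OF fin fin])
  also have "\<dots> = (\<Sum>U\<in>{U \<in> NC n. le P U \<and> le U Q}. (if P = U then 1 else 0) * \<mu> U Q)"
  proof (rule sum.cong[OF HOL.refl])
    fix U assume U: "U \<in> {U \<in> NC n. le P U \<and> le U Q}"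
    have "{R \<in> {R \<in> NC n. le P R \<and> le R Q}. le R U} = {R \<in> NC n. le P R \<and> le R U}"
      using U trans by blast
    then have "(\<Sum>R\<in>{R \<in> {R \<in> NC n. le P R \<and> le R Q}. le R U}. \<mu> P R * \<mu> U Q)
        = (\<Sum>R\<in>{R \<in> NC n. le P R \<and> le R U}. \<mu> P R) * \<mu> U Q"
      by (simp add: sum_distrib_right)
    also have "(\<Sum>R\<in>{R \<in> NC n. le P R \<and> le R U}. \<mu> P R) = (if P = U then 1 else 0)"
      unfolding \<mu>_def le_def using U less.prems by (intro mobius_sum_right) (auto simp: le_def)
    finally show "(\<Sum>R\<in>{R \<in> {R \<in> NC n. le P R \<and> le R Q}. le R U}. \<mu> P R * \<mu> U Q)
        = (if P = U then 1 else 0) * \<mu> U Q" .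
  qed
  also have "\<dots> = \<mu> P Q"
  proof -
    have "(\<Sum>U\<in>{U \<in> NC n. le P U \<and> le U Q}. (if P = U then 1 else 0) * \<mu> U Q)
        = (\<Sum>U\<in>{U \<in> NC n. le P U \<and> le U Q}. if P = U then \<mu> U Q else 0)"
      by (intro sum.cong) auto
    then show ?thesis using less.prems refl fin by (simp add: sum.delta le_def)
  qed
  finally have double: "(\<Sum>R\<in>{R \<in> NC n. le P R \<and> le R Q}. \<mu> P R * ?S R) = \<mu> P Q" .
  have PI: "P \<in> {R \<in> NC n. le P R \<and> le R Q}" using less.prems refl by (simp add: le_def)
  have "(\<Sum>R\<in>{R \<in> NC n. le P R \<and> le R Q}. \<mu> P R * ?S R)
      = \<mu> P P * ?S P + (\<Sum>R\<in>{R \<in> NC n. le P R \<and> le R Q} - {P}. \<mu> P R * ?S R)"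
    by (rule sum.remove[OF fin PI])
  also have "(\<Sum>R\<in>{R \<in> NC n. le P R \<and> le R Q} - {P}. \<mu> P R * ?S R)
      = (\<Sum>R\<in>{R \<in> NC n. le P R \<and> le R Q} - {P}. if R = Q then \<mu> P R else 0)"
    using IH by (intro sum.cong) auto
  also have "\<dots> = (if Q \<noteq> P then \<mu> P Q else 0)"
    using less.prems Q refl fin by (subst sum.delta) (auto simp: le_def)
  finally have expand: "\<mu> P Q = \<mu> P P * ?S P + (if Q \<noteq> P then \<mu> P Q else 0)"
    unfolding double .
  have "\<mu> P P = 1" unfolding \<mu>_def by (subst mobius_NC.simps) simp
  with expand have "?S P = (if P = Q then 1 else 0)" by (cases "P = Q") auto
  then show ?case by (simp add: le_def \<mu>_def)
qed

subsection \<open>Refinements of a non-crossing partition\<close>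

text \<open>The non-crossing refinements of \<open>Q\<close> arise from an independent choice of a non-crossing partition
  of every block: pieces of two different blocks can only cross if the blocks do.\<close>

lemma NC_on_UN_blocks:
  assumes Q: "Q \<in> NC_on S" and g: "\<And>V. V \<in> Q \<Longrightarrow> g V \<in> NC_on V"
  shows "(\<Union>V\<in>Q. g V) \<in> NC_on S" and "refines S (\<Union>V\<in>Q. g V) Q"
    and "\<And>V. V \<in> Q \<Longrightarrow> {W \<in> (\<Union>V\<in>Q. g V). W \<subseteq> V} = g V"
proof -
  let ?R = "\<Union>V\<in>Q. g V"
  have pQ: "partition_on S Q" "noncrossing Q" using Q by (auto simp: NC_on_def)
  have pg: "partition_on V (g V)" "noncrossing (g V)" if "V \<in> Q" for V
    using g[OF that] by (auto simp: NC_on_def)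
  have sub: "W \<subseteq> V" "W \<noteq> {}" if "V \<in> Q" "W \<in> g V" for V W
    using pg[OF that(1)] that(2) by (auto simp: partition_on_def)
  have R: "partition_on S ?R"
  proof (rule partition_onI)
    have "\<Union>?R = (\<Union>V\<in>Q. \<Union>(g V))" by auto
    also have "\<dots> = \<Union>Q" using pg by (auto simp: partition_on_def)
    finally show "\<Union>?R = S" using pQ(1) by (simp add: partition_on_def)
    show "{} \<notin> ?R" using sub by blast
    fix p q assume pq: "p \<in> ?R" "q \<in> ?R" "p \<noteq> q"
    then obtain V W where VW: "V \<in> Q" "p \<in> g V" "W \<in> Q" "q \<in> g W" by auto
    show "disjnt p q"
    proof (cases "V = W")
      case True
      then show ?thesis using VW pg[OF VW(1)] pq(3)
        by (auto simp: partition_on_def disjnt_def dest: disjointD)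
    next
      case False
      then have "V \<inter> W = {}" using pQ(1) VW by (auto simp: partition_on_def dest: disjointD)
      then show ?thesis using sub(1)[OF VW(1,2)] sub(1)[OF VW(3,4)] by (auto simp: disjnt_def)
    qed
  qed
  have "noncrossing ?R"
    unfolding noncrossing_def
  proof (intro ballI allI impI, elim conjE)
    fix U U' a b c d
    assume U: "U \<in> ?R" "U' \<in> ?R" and o: "a < b" "b < c" "c < d" "a \<in> U" "c \<in> U" "b \<in> U'" "d \<in> U'"
    then obtain V V' where V: "V \<in> Q" "U \<in> g V" "V' \<in> Q" "U' \<in> g V'" by auto
    then have "V = V'" using noncrossingD[OF pQ(2) V(1,3) o(1-3)] sub o by blast
    then show "U = U'" using noncrossingD[OF pg(2)[OF V(1)] V(2) _ o(1-3)] V(4) o by simp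
  qed
  then show "?R \<in> NC_on S" using R by (simp add: NC_on_def)
  show "refines S ?R Q" using R pQ sub by (auto simp: refines_def)
  show "{W \<in> ?R. W \<subseteq> V} = g V" if V: "V \<in> Q" for V
  proof (intro equalityI subsetI)
    fix W assume "W \<in> {W \<in> ?R. W \<subseteq> V}"
    then obtain V' where V': "V' \<in> Q" "W \<in> g V'" "W \<subseteq> V" by auto
    then obtain x where "x \<in> W" using sub(2) by blast
    then have "V = V'" using partition_on_unique_block[OF pQ(1) V V'(1)] sub(1)[OF V'(1,2)] V'(3) by blast
    then show "W \<in> g V" using V' by simp
  qed (use V sub in blast)
qed

lemma sum_refinements_eq_prod:
  fixes k :: "nat set \<Rightarrow> complex"
  assumes S: "finite S" and Q: "Q \<in> NC_on S"
  shows "(\<Sum>R\<in>{R \<in> NC_on S. refines S R Q}. \<Prod>W\<in>R. k W) = (\<Prod>V\<in>Q. \<Sum>R\<in>NC_on V. \<Prod>W\<in>R. k W)"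
proof -
  have pQ: "partition_on S Q" "noncrossing Q" using Q by (auto simp: NC_on_def)
  have finQ: "finite Q" using finite_elements[OF S pQ(1)] .
  have finV: "finite V" if "V \<in> Q" for V
    using that pQ(1) S by (auto simp: partition_on_def intro: finite_subset)
  have "(\<Prod>V\<in>Q. \<Sum>R\<in>NC_on V. \<Prod>W\<in>R. k W) = (\<Sum>g\<in>Pi\<^sub>E Q NC_on. \<Prod>V\<in>Q. \<Prod>W\<in>g V. k W)"
    using finQ finV by (intro prod_sum_PiE finite_NC_on)
  also have "\<dots> = (\<Sum>R\<in>{R \<in> NC_on S. refines S R Q}. \<Prod>W\<in>R. k W)"
  proof (rule sum.reindex_bij_witness[where j = "\<lambda>g. \<Union>V\<in>Q. g V" and i = "\<lambda>R. \<lambda>V\<in>Q. {W \<in> R. W \<subseteq> V}"])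
    fix g assume g: "g \<in> Pi\<^sub>E Q NC_on"
    have gV: "g V \<in> NC_on V" if "V \<in> Q" for V using g that by auto
    show "(\<lambda>V\<in>Q. {W \<in> \<Union>V\<in>Q. g V. W \<subseteq> V}) = g"
      using NC_on_UN_blocks(3)[OF Q gV] PiE_arb[OF g] by (auto simp: fun_eq_iff restrict_def)
    show "(\<Union>V\<in>Q. g V) \<in> {R \<in> NC_on S. refines S R Q}"
      using NC_on_UN_blocks(1,2)[OF Q gV] by auto
    have pg: "partition_on V (g V)" if "V \<in> Q" for V using gV[OF that] by (auto simp: NC_on_def)
    show "(\<Prod>W\<in>(\<Union>V\<in>Q. g V). k W) = (\<Prod>V\<in>Q. \<Prod>W\<in>g V. k W)"
    proof (rule prod.UNION_disjoint[OF finQ])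
      show "\<forall>V\<in>Q. finite (g V)" using finite_elements[OF finV pg] by blast
      show "\<forall>V\<in>Q. \<forall>V'\<in>Q. V \<noteq> V' \<longrightarrow> g V \<inter> g V' = {}"
      proof (intro ballI impI, rule ccontr)
        fix V V' assume V: "V \<in> Q" "V' \<in> Q" "V \<noteq> V'" "g V \<inter> g V' \<noteq> {}"
        then obtain W where "W \<in> g V" "W \<in> g V'" by auto
        then have "W \<subseteq> V" "W \<subseteq> V'" "W \<noteq> {}" using pg[OF V(1)] pg[OF V(2)] by (auto simp: partition_on_def)
        then show False using partition_on_unique_block[OF pQ(1) V(1,2)] V(3) by blast
      qed
    qed
  next
    fix R assume "R \<in> {R \<in> NC_on S. refines S R Q}"
    then have R: "R \<in> NC_on S" "refines S R Q" "noncrossing R" by (auto simp: NC_on_def)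
    have "R = {W \<in> R. \<exists>V\<in>Q. W \<subseteq> V}" using R(2) by (auto simp: refines_def)
    then show "(\<Union>V\<in>Q. (\<lambda>V\<in>Q. {W \<in> R. W \<subseteq> V}) V) = R" by auto
    show "(\<lambda>V\<in>Q. {W \<in> R. W \<subseteq> V}) \<in> Pi\<^sub>E Q NC_on"
      using refines_obtains_subset[OF R(2)] R(3) unfolding NC_on_def noncrossing_def by auto
  qed
  finally show ?thesis by simp
qed

text \<open>The moment of a block is a sum over its non-crossing partitions, hence the moment of \<open>P\<close> is the
  sum of the weights of all \<open>R \<le> P\<close>. Exchanging the sums leaves the coefficients
  \<open>\<Sum>\<mu>(P, 1)\<close> over \<open>R \<le> P \<le> 1\<close>, which vanish unless \<open>R\<close> has one block.\<close>

lemma mobius_inversion_of_moments: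
  fixes k :: "nat set \<Rightarrow> complex"
  assumes n: "n \<ge> 1"
  shows "(\<Sum>P\<in>NC n. (\<Prod>V\<in>P. \<Sum>R\<in>NC_on V. \<Prod>W\<in>R. k W) * of_int (mobius_NC n P {{1..n}})) = k {1..n}"
proof -
  let ?K = "\<lambda>R. \<Prod>W\<in>R. k W" and ?le = "refines {1..n}" and ?top = "{{1..n}}"
  have top: "?top \<in> NC n" using n by (simp add: NC_eq_NC_on NC_on_block)
  have le_top: "?le R ?top" if "R \<in> NC n" for R
    using that top by (auto simp: NC_def refines_def partition_on_def)
  have "(\<Sum>P\<in>NC n. (\<Prod>V\<in>P. \<Sum>R\<in>NC_on V. ?K R) * of_int (mobius_NC n P ?top))
      = (\<Sum>P\<in>NC n. \<Sum>R\<in>{R \<in> NC n. ?le R P}. ?K R * of_int (mobius_NC n P ?top))"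
  proof (rule sum.cong[OF refl])
    fix P assume "P \<in> NC n"
    then have "(\<Sum>R\<in>{R \<in> NC n. ?le R P}. ?K R) = (\<Prod>V\<in>P. \<Sum>R\<in>NC_on V. ?K R)"
      unfolding NC_eq_NC_on by (intro sum_refinements_eq_prod) auto
    then show "(\<Prod>V\<in>P. \<Sum>R\<in>NC_on V. ?K R) * of_int (mobius_NC n P ?top)
        = (\<Sum>R\<in>{R \<in> NC n. ?le R P}. ?K R * of_int (mobius_NC n P ?top))"
      by (simp only: sum_distrib_right[symmetric])
  qed
  also have "\<dots> = (\<Sum>R\<in>NC n. \<Sum>P\<in>{P \<in> NC n. ?le R P}. ?K R * of_int (mobius_NC n P ?top))"
    by (rule sum.swap_restrict[OF finite_NC finite_NC])
  also have "\<dots> = (\<Sum>R\<in>NC n. ?K R * of_int (if R = ?top then 1 else 0))"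
  proof (rule sum.cong[OF refl])
    fix R assume R: "R \<in> NC n"
    have "{P \<in> NC n. ?le R P} = {P \<in> NC n. ?le R P \<and> ?le P ?top}" using le_top by auto
    then show "(\<Sum>P\<in>{P \<in> NC n. ?le R P}. ?K R * of_int (mobius_NC n P ?top)) = ?K R * of_int (if R = ?top then 1 else 0)"
      using mobius_sum_left[OF R top le_top[OF R]] by (simp add: sum_distrib_left[symmetric] flip: of_int_sum)
  qed
  also have "\<dots> = (\<Sum>R\<in>NC n. if R = ?top then ?K R else 0)" by (intro sum.cong) auto
  also have "\<dots> = k {1..n}" using top finite_NC[of n] by (simp add: sum.delta)
  finally show ?thesis .
qed

section \<open>Moments of free identically distributed families\<close>

subsection \<open>Crossings in a sequence of colours\<close>

text \<open>For a sequence of colours this says that its kernel, the partition of the positions by colour, is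
  non-crossing.\<close>

definition noncrossing_list :: "'a list \<Rightarrow> bool" where
  "noncrossing_list js \<longleftrightarrow> (\<forall>a b. subseq [a, b, a, b] js \<longrightarrow> a = b)"

lemma subseq_Cons_split: "subseq as vs \<Longrightarrow> subseq (a # as) (us @ a # vs)"
  by (simp add: subseq_drop_many)

text \<open>A pattern without equal neighbours never uses both copies of a doubled letter.\<close>

lemma subseq_merge:
  assumes "successively (\<noteq>) p"
  shows "subseq p (xs @ c # c # ys) \<longleftrightarrow> subseq p (xs @ c # ys)"
proof
  assume "subseq p (xs @ c # c # ys)"
  then show "subseq p (xs @ c # ys)"
    using assms
  proof (induction xs arbitrary: p)
    case Nil
    show ?case
    proof (cases p)
      case (Cons p1 p')
      show ?thesis
      proof (cases "p1 = c")
        case True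
        then have "subseq p' (c # ys)" using Nil.prems(1) Cons by simp
        moreover have "p' = [] \<or> hd p' \<noteq> c" using Nil.prems(2) Cons True by (cases p') auto
        ultimately have "subseq p' ys" by (cases p') (auto dest: subseq_Cons2_neq)
        then show ?thesis using Cons True by simp
      next
        case False
        then show ?thesis using Nil.prems(1) Cons by (auto dest: subseq_Cons2_neq)
      qed
    qed simp
  next
    case (Cons x xs)
    show ?case
    proof (cases "p = []")
      case False
      then obtain p1 p' where p: "p = p1 # p'" by (cases p) auto
      have s: "successively (\<noteq>) p'" using Cons.prems(2) p by (cases p') auto
      show ?thesis
      proof (cases "p1 = x")
        case True
        then have "subseq p' (xs @ c # c # ys)" using Cons.prems(1) p by simp
        then have "subseq p' (xs @ c # ys)" using s by (rule Cons.IH)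
        then show ?thesis using True p by simp
      next
        case False
        then have "subseq p (xs @ c # c # ys)" using Cons.prems(1) p by (auto dest: subseq_Cons2_neq)
        then have "subseq p (xs @ c # ys)" using Cons.prems(2) by (rule Cons.IH)
        then show ?thesis by auto
      qed
    qed simp
  qed
next
  assume "subseq p (xs @ c # ys)"
  moreover have "subseq (xs @ c # ys) (xs @ c # c # ys)" by (simp add: subseq_append' list_emb_Cons)
  ultimately show "subseq p (xs @ c # c # ys)" by (rule subseq_order.trans)
qed

lemma noncrossing_list_merge:
  "noncrossing_list (xs @ c # c # ys) \<longleftrightarrow> noncrossing_list (xs @ c # ys)"
proof -
  have "subseq [a, b, a, b] (xs @ c # c # ys) \<longleftrightarrow> subseq [a, b, a, b] (xs @ c # ys)" if "a \<noteq> b" for a b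
    using that by (intro subseq_merge) auto
  then show ?thesis unfolding noncrossing_list_def by blast
qed

lemma noncrossing_list_subseq: "\<lbrakk>noncrossing_list js; subseq ks js\<rbrakk> \<Longrightarrow> noncrossing_list ks"
  unfolding noncrossing_list_def by (blast intro: subseq_order.trans)

lemma count_list_ge_2:
  assumes "count_list js c \<ge> 2"
  obtains xs ys zs where "js = xs @ c # ys @ c # zs"
proof -
  have "c \<in> set js" using assms by (metis count_list_0_iff not_numeral_le_zero)
  then obtain xs rest where js: "js = xs @ c # rest" "c \<notin> set xs" by (metis split_list_first)
  then have "count_list rest c \<ge> 1" using assms by (simp add: count_list_0_iff)
  then have "c \<in> set rest" by (metis count_list_0_iff not_one_le_zero)
  then obtain ys zs where "rest = ys @ c # zs" by (metis split_list)
  then show ?thesis using that js by blast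
qed

text \<open>A non-crossing partition has a block that is an interval, and if neighbours have different
  colours such a block is a single position. The proof takes two equal colours at minimal distance:
  the colour \<open>d\<close> just after the first of them cannot recur in between, and recurring outside would
  give a crossing.\<close>

lemma alternating_noncrossing_has_singleton:
  assumes ne: "js \<noteq> []" and alt: "successively (\<noteq>) js" and nc: "noncrossing_list js"
  shows "\<exists>c\<in>set js. count_list js c = 1"
proof (rule ccontr)
  assume no: "\<not> ?thesis"
  have two: "count_list js c \<ge> 2" if "c \<in> set js" for c
  proof -
    have "count_list js c \<noteq> 0" "count_list js c \<noteq> 1"
      using that no by (auto simp: count_list_0_iff)
    then show ?thesis by linarith
  qed
  \<comment> \<open>\<open>Q n\<close>: some colour occurs at two places that enclose exactly \<open>n\<close> entries.\<close>
  define Q where "Q n \<longleftrightarrow> (\<exists>xs c ys zs. js = xs @ c # ys @ c # zs \<and> length ys = n)" for n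
  have "\<exists>n. Q n" using count_list_ge_2[OF two[OF hd_in_set[OF ne]]] unfolding Q_def by metis
  \<comment> \<open>Two occurrences of a colour at minimal distance.\<close>
  then obtain n where n: "Q n" "\<And>m. m < n \<Longrightarrow> \<not> Q m" by (metis exists_least_iff)
  then obtain xs c ys zs where js: "js = xs @ c # ys @ c # zs" "length ys = n" by (auto simp: Q_def)
  have "ys \<noteq> []" using alt js by (auto simp: successively_append_iff)
  then obtain d ys' where ys: "ys = d # ys'" by (cases ys) auto
  have dc: "d \<noteq> c" using alt js ys by (auto simp: successively_append_iff)
  have "d \<notin> set ys'"
  proof
    assume "d \<in> set ys'"
    then obtain y1 y2 where "ys' = y1 @ d # y2" by (metis split_list)
    then have "js = (xs @ [c]) @ d # y1 @ d # (y2 @ c # zs)" "length y1 < n" using js ys by auto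
    then have "Q (length y1)" unfolding Q_def by blast
    then show False using n(2) \<open>length y1 < n\<close> by blast
  qed
  moreover have "count_list js d \<ge> 2" by (rule two) (simp add: js ys)
  ultimately have "d \<in> set xs \<or> d \<in> set zs"
    using dc by (auto simp: js ys count_list_0_iff intro: ccontr)
  then show False
  proof
    assume "d \<in> set xs"
    then obtain x1 x2 where "xs = x1 @ d # x2" by (metis split_list)
    then have "js = x1 @ d # x2 @ c # [] @ d # ys' @ c # zs" using js ys by simp
    then have "subseq [d, c, d, c] js" by (simp only:) (intro subseq_Cons_split, simp)
    then show False using nc dc unfolding noncrossing_list_def by blast
  next
    assume "d \<in> set zs"
    then obtain z1 z2 where "zs = z1 @ d # z2" by (metis split_list)
    then have "js = xs @ c # [] @ d # ys' @ c # z1 @ d # z2" using js ys by simp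
    then have "subseq [c, d, c, d] js" by (simp only:) (intro subseq_Cons_split, simp)
    then show False using nc dc unfolding noncrossing_list_def by blast
  qed
qed

subsection \<open>Splitting a list into removed and kept entries\<close>

text \<open>These are the terms in the expansion of \<open>\<Prod>(x - f x)\<close> over a list: from the removed entries the
  scalar is taken, from the kept ones the element. The first split removes nothing.\<close>

fun splits :: "'a list \<Rightarrow> ('a list \<times> 'a list) list" where
  "splits [] = [([], [])]"
| "splits (x # xs) = map (\<lambda>(r, k). (r, x # k)) (splits xs) @ map (\<lambda>(r, k). (x # r, k)) (splits xs)"

lemma splits_length: "(r, k) \<in> set (splits ps) \<Longrightarrow> length r + length k = length ps"
  by (induction ps arbitrary: r k) auto

lemma splits_set: "(r, k) \<in> set (splits ps) \<Longrightarrow> set ps = set r \<union> set k"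
  by (induction ps arbitrary: r k) fastforce+

lemma splits_head:
  "\<exists>R. splits ps = ([], ps) # R \<and> (\<forall>(r, k)\<in>set R. length k < length ps)"
proof (induction ps)
  case (Cons x xs)
  then obtain R where R: "splits xs = ([], xs) # R" "\<forall>(r, k)\<in>set R. length k < length xs" by blast
  have "length k \<le> length xs" if "(r, k) \<in> set (splits xs)" for r k
    using splits_length[OF that] by simp
  then show ?case using R by auto
qed simp

lemma splits_map: "splits (map g ps) = map (map_prod (map g) (map g)) (splits ps)"
  by (induction ps) (auto simp: case_prod_unfold)

lemma splits_filter:
  "\<lbrakk>(r, k) \<in> set (splits ps); \<forall>x\<in>set r. P x; \<forall>x\<in>set k. \<not> P x\<rbrakk> \<Longrightarrow>
    filter P ps = r \<and> filter (\<lambda>x. \<not> P x) ps = k"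
  by (induction ps arbitrary: r k) fastforce+

lemma splits_subseq: "(r, k) \<in> set (splits ps) \<Longrightarrow> subseq k ps"
  by (induction ps arbitrary: r k) auto

lemma splits_count:
  "(r, k) \<in> set (splits ps) \<Longrightarrow>
    length (filter P ps) = length (filter P r) + length (filter P k)"
  by (induction ps arbitrary: r k) (auto split: if_splits)

text \<open>An inclusion-exclusion count: the signed number of subsets of the entries with property \<open>P\<close> is
  zero as soon as there is such an entry.\<close>

lemma splits_alternating_sum:
  "(\<Sum>(r, k)\<leftarrow>splits ps. (- 1) ^ length r * (if \<forall>x\<in>set r. P x then 1 else (0 :: complex)))
    = (\<Prod>x\<leftarrow>ps. if P x then 0 else 1)"
proof (induction ps)
  case (Cons x xs)
  let ?f = "\<lambda>(r, k). (- 1) ^ length r * (if \<forall>x\<in>set r. P x then 1 else (0 :: complex))"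
  have "(\<Sum>y\<leftarrow>splits xs. ?f (case y of (r, k) \<Rightarrow> (x # r, k))) =
      (\<Sum>y\<leftarrow>splits xs. (if P x then - 1 else 0) * ?f y)"
    by (intro arg_cong[of _ _ sum_list] map_cong) auto
  then show ?case using Cons
    by (simp add: comp_def sum_list_const_mult case_prod_unfold)
qed simp

lemma not_successively_split:
  "\<not> successively (\<lambda>x y. fst x \<noteq> fst y) ps \<Longrightarrow> \<exists>xs c u v ys. ps = xs @ (c, u) # (c, v) # ys"
proof (induction ps rule: induct_list012)
  case (3 x y zs)
  show ?case
  proof (cases "fst x = fst y")
    case True
    then have "x # y # zs = [] @ (fst x, snd x) # (fst x, snd y) # zs" by (simp add: prod_eq_iff)
    then show ?thesis by blast
  next
    case False
    then obtain xs c u v ys where "y # zs = xs @ (c, u) # (c, v) # ys" using 3 by auto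
    then have "x # y # zs = (x # xs) @ (c, u) # (c, v) # ys" by simp
    then show ?thesis by blast
  qed
qed auto

subsection \<open>The recursion for free moments\<close>

text \<open>A list entry \<open>(c, u)\<close> stands for the product of the letters of the word \<open>u\<close> in colour \<open>c\<close>, and \<open>F u\<close>
  for its state, which is the same for all colours. Two rules determine the states of all products
  from \<open>F\<close>: neighbours of equal colour may be merged, and if neighbours always differ then the
  state of the product of the centred entries is zero; the second rule is written in expanded form.\<close>

definition free_iid_moments ::
  "nat \<Rightarrow> ((nat \<times> 'i list) list \<Rightarrow> complex) \<Rightarrow> ('i list \<Rightarrow> complex) \<Rightarrow> bool" where
  "free_iid_moments N val F \<longleftrightarrow> val [] = 1 \<and>
    (\<forall>xs c u v ys. fst ` set (xs @ (c, u) # (c, v) # ys) \<subseteq> {1..N} \<longrightarrow>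
       val (xs @ (c, u) # (c, v) # ys) = val (xs @ (c, u @ v) # ys)) \<and>
    (\<forall>ps. ps \<noteq> [] \<longrightarrow> successively (\<lambda>x y. fst x \<noteq> fst y) ps \<longrightarrow> fst ` set ps \<subseteq> {1..N} \<longrightarrow>
       (\<Sum>(r, k)\<leftarrow>splits ps. (- 1) ^ length r * (\<Prod>x\<leftarrow>r. F (snd x)) * val k) = 0)"

text \<open>Both rules only see which colours are equal, so the recursion does not notice an injective
  renaming.\<close>

lemma free_iid_moments_rename:
  assumes val: "free_iid_moments N val F"
    and "inj_on f (fst ` set ps)" "fst ` set ps \<subseteq> {1..N}" "f ` fst ` set ps \<subseteq> {1..N}"
  shows "val (map (apfst f) ps) = val ps"
  using assms(2-)
proof (induction "length ps" arbitrary: ps rule: less_induct)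
  case less
  have sub: "fst ` set (map (apfst f) ps) \<subseteq> {1..N}"
    using less.prems(3) by (simp add: image_image)
  show ?case
  proof (cases "successively (\<lambda>x y. fst x \<noteq> fst y) ps")
    case False
    then obtain xs c u v ys where ps: "ps = xs @ (c, u) # (c, v) # ys"
      using not_successively_split by blast
    let ?ps = "xs @ (c, u @ v) # ys"
    have set: "fst ` set ?ps = fst ` set ps" by (auto simp: ps)
    have "val ps = val ?ps"
      using val less.prems(2) unfolding free_iid_moments_def ps by blast
    moreover have "val (map (apfst f) ps) = val (map (apfst f) ?ps)"
      using val sub unfolding free_iid_moments_def ps by simp
    moreover have "val (map (apfst f) ?ps) = val ?ps"
      using less.prems by (intro less.hyps) (simp_all only: set, simp add: ps)
    ultimately show ?thesis by simp
  next
    case True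
    show ?thesis
    proof (cases "ps = []")
      case False
      let ?g = "apfst f"
      let ?t = "\<lambda>(r, k). (- 1) ^ length r * (\<Prod>x\<leftarrow>r. F (snd x)) * val k"
      obtain R where R: "splits ps = ([], ps) # R" "\<And>r k. (r, k) \<in> set R \<Longrightarrow> length k < length ps"
        using splits_head[of ps] by blast
      have alt: "successively (\<lambda>x y. fst x \<noteq> fst y) (map ?g ps)"
        unfolding successively_map
        by (rule successively_mono[OF True]) (use less.prems(1) in \<open>auto simp: inj_on_def\<close>)
      have "sum_list (map ?t (splits ps)) = 0"
        using val False True less.prems(2) unfolding free_iid_moments_def by blast
      moreover have "sum_list (map ?t (splits (map ?g ps))) = 0"
        using val False alt sub unfolding free_iid_moments_def by blast
      moreover have "sum_list (map ?t (map (map_prod (map ?g) (map ?g)) R)) = sum_list (map ?t R)"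
        unfolding map_map
      proof (intro arg_cong[of _ _ sum_list] map_cong[OF refl])
        fix x assume x: "x \<in> set R"
        obtain r k where xrk: "x = (r, k)" by (cases x)
        have rk: "(r, k) \<in> set R" using x xrk by simp
        have "set k \<subseteq> set ps" using splits_set[of r k ps] rk R(1) by auto
        then have k: "fst ` set k \<subseteq> fst ` set ps" by auto
        then have fk: "f ` fst ` set k \<subseteq> f ` fst ` set ps" by (rule image_mono)
        have "val (map ?g k) = val k"
          by (rule less.hyps[OF R(2)[OF rk] inj_on_subset[OF less.prems(1) k]
                subset_trans[OF k less.prems(2)] subset_trans[OF fk less.prems(3)]])
        then show "(?t \<circ> map_prod (map ?g) (map ?g)) x = ?t x" by (simp add: comp_def xrk)
      qed
      ultimately show ?thesis by (simp add: splits_map R(1) add_eq_0_iff2)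
    qed simp
  qed
qed

subsection \<open>The leading term of a free moment\<close>

definition colour_word :: "(nat \<times> 'i list) list \<Rightarrow> nat \<Rightarrow> 'i list" where
  "colour_word ps c = concat (map snd (filter (\<lambda>x. fst x = c) ps))"

text \<open>This is the product of weights over the blocks of the kernel if the kernel is non-crossing.\<close>

definition leading_moment :: "('i list \<Rightarrow> complex) \<Rightarrow> (nat \<times> 'i list) list \<Rightarrow> complex" where
  "leading_moment \<kappa> ps = (if noncrossing_list (map fst ps)
     then \<Prod>c\<in>fst ` set ps. \<kappa> (colour_word ps c) else 0)"

lemma filter_fst_distinct:
  "\<lbrakk>distinct (map fst r); x \<in> set r\<rbrakk> \<Longrightarrow> filter (\<lambda>y. fst y = fst x) r = [x]"
proof (induction r)
  case (Cons a r)
  show ?case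
  proof (cases "x = a")
    case True
    have "fst a \<notin> fst ` set r" using Cons.prems(1) by simp
    then have "\<forall>y\<in>set r. fst y \<noteq> fst x" using True by (metis image_eqI)
    then have "filter (\<lambda>y. fst y = fst x) r = []" by (simp add: filter_empty_conv)
    then show ?thesis using True by simp
  next
    case False
    then show ?thesis using Cons by auto
  qed
qed simp

text \<open>Every removed entry costs a factor of order \<open>1/N\<close>, and the kept list a factor \<open>1/N\<close> for each of
  its colours. The total order is that of the
  original list exactly if each removed entry is the only one of its colour (good). Removing such
  entries changes neither the other colour words nor the crossings.\<close>

lemma splits_colours:
  assumes rk: "(r, k) \<in> set (splits ps)"
  defines "good \<equiv> \<forall>x\<in>set r. length (filter (\<lambda>y. fst y = fst x) ps) = 1"
  shows "card (fst ` set ps) \<le> length r + card (fst ` set k)"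
    and "card (fst ` set ps) = length r + card (fst ` set k) \<longleftrightarrow> good"
    and "good \<Longrightarrow> (\<Prod>x\<leftarrow>r. \<kappa> (snd x)) * leading_moment \<kappa> k = leading_moment \<kappa> ps"
proof -
  let ?Cr = "fst ` set r" and ?Ck = "fst ` set k"
  have C: "fst ` set ps = ?Cr \<union> ?Ck" using splits_set[OF rk] by auto
  have r: "card ?Cr \<le> length r" by (metis card_length image_set length_map)
  have un: "card (?Cr \<union> ?Ck) + card (?Cr \<inter> ?Ck) = card ?Cr + card ?Ck"
    by (rule card_Un_Int[symmetric]) simp_all
  show "card (fst ` set ps) \<le> length r + card ?Ck" unfolding C using r un by linarith
  have len: "length (filter (\<lambda>y. fst y = c) ps) = length (filter (\<lambda>y. fst y = c) r) + length (filter (\<lambda>y. fst y = c) k)" for c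
    by (rule splits_count[OF rk])
  have good: "good \<longleftrightarrow> distinct (map fst r) \<and> ?Cr \<inter> ?Ck = {}"
  proof
    assume g: good
    have pos: "length (filter (\<lambda>y. fst y = fst x) r) \<ge> 1" if "x \<in> set r" for x
      using that by (metis (mono_tags, lifting) One_nat_def Suc_leI filter_empty_conv length_greater_0_conv)
    have one: "length (filter (\<lambda>y. fst y = fst x) r) = 1" "filter (\<lambda>y. fst y = fst x) k = []" if "x \<in> set r" for x
      using g pos[OF that] len[of "fst x"] that unfolding good_def by auto
    have "distinct (map fst r)"
    proof (rule ccontr)
      assume "\<not> distinct (map fst r)"
      then obtain xs ys zs y where "map fst r = xs @ [y] @ ys @ [y] @ zs" using not_distinct_decomp by blast
      then have c: "count_list (map fst r) y \<ge> 2" "y \<in> set (map fst r)" by simp_all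
      then obtain x where x: "x \<in> set r" "fst x = y" by auto
      have "count_list (map fst r) y = length (filter (\<lambda>x. fst x = y) r)"
        by (induction r) auto
      then show False using c one(1)[OF x(1)] x(2) by simp
    qed
    moreover have "?Cr \<inter> ?Ck = {}" using one(2) by (fastforce simp: filter_empty_conv)
    ultimately show "distinct (map fst r) \<and> ?Cr \<inter> ?Ck = {}" by simp
  next
    assume d: "distinct (map fst r) \<and> ?Cr \<inter> ?Ck = {}"
    show good unfolding good_def
    proof
      fix x assume x: "x \<in> set r"
      then have "filter (\<lambda>y. fst y = fst x) k = []" using d by (auto simp: filter_empty_conv)
      then show "length (filter (\<lambda>y. fst y = fst x) ps) = 1"
        using len[of "fst x"] filter_fst_distinct[of r x] d x by simp
    qed
  qed
  have "card (fst ` set ps) = length r + card ?Ck \<longleftrightarrow> card ?Cr = length r \<and> card (?Cr \<inter> ?Ck) = 0"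
    unfolding C using r un by linarith
  also have "\<dots> \<longleftrightarrow> good"
    unfolding good using card_distinct[of "map fst r"] distinct_card[of "map fst r"] by auto
  finally show "card (fst ` set ps) = length r + card ?Ck \<longleftrightarrow> good" .
  show "(\<Prod>x\<leftarrow>r. \<kappa> (snd x)) * leading_moment \<kappa> k = leading_moment \<kappa> ps" if good
  proof -
    have d: "distinct (map fst r)" "?Cr \<inter> ?Ck = {}" using that good by auto
    have f: "filter (\<lambda>x. fst x \<in> ?Cr) ps = r" "filter (\<lambda>x. fst x \<notin> ?Cr) ps = k"
      using splits_filter[OF rk, of "\<lambda>x. fst x \<in> ?Cr"] d(2) by auto
    have wk: "colour_word ps c = colour_word k c" if "c \<in> ?Ck" for c
    proof -
      have "filter (\<lambda>x. fst x = c) ps = filter (\<lambda>x. fst x = c) (filter (\<lambda>x. fst x \<notin> ?Cr) ps)"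
        using that d(2) unfolding filter_filter by (intro filter_cong) auto
      then show ?thesis unfolding f(2) by (simp add: colour_word_def)
    qed
    have wr: "colour_word ps (fst x) = snd x" if "x \<in> set r" for x
    proof -
      have "filter (\<lambda>y. fst y = fst x) ps = filter (\<lambda>y. fst y = fst x) (filter (\<lambda>x. fst x \<in> ?Cr) ps)"
        using that unfolding filter_filter by (intro filter_cong) auto
      also have "\<dots> = [x]" unfolding f(1) by (rule filter_fst_distinct[OF d(1) that])
      finally show ?thesis by (simp add: colour_word_def)
    qed
    have "(\<Prod>c\<in>fst ` set ps. \<kappa> (colour_word ps c)) =
        (\<Prod>c\<in>?Cr. \<kappa> (colour_word ps c)) * (\<Prod>c\<in>?Ck. \<kappa> (colour_word ps c))"
      unfolding C using d(2) by (intro prod.union_disjoint) auto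
    also have "(\<Prod>c\<in>?Ck. \<kappa> (colour_word ps c)) = (\<Prod>c\<in>?Ck. \<kappa> (colour_word k c))"
      by (intro prod.cong) (auto simp: wk)
    also have "(\<Prod>c\<in>?Cr. \<kappa> (colour_word ps c)) = (\<Prod>c\<leftarrow>map fst r. \<kappa> (colour_word ps c))"
      using prod.distinct_set_conv_list[OF d(1), of "\<lambda>c. \<kappa> (colour_word ps c)"] by simp
    also have "\<dots> = (\<Prod>x\<leftarrow>r. \<kappa> (snd x))"
      unfolding map_map by (intro arg_cong[of _ _ prod_list] map_cong) (auto simp: wr)
    finally have prod: "(\<Prod>c\<in>fst ` set ps. \<kappa> (colour_word ps c)) =
        (\<Prod>x\<leftarrow>r. \<kappa> (snd x)) * (\<Prod>c\<in>?Ck. \<kappa> (colour_word k c))" .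
    have "noncrossing_list (map fst ps) \<longleftrightarrow> noncrossing_list (map fst k)"
    proof
      assume "noncrossing_list (map fst ps)"
      then show "noncrossing_list (map fst k)"
        by (rule noncrossing_list_subseq) (intro subseq_map splits_subseq[OF rk])
    next
      assume nck: "noncrossing_list (map fst k)"
      show "noncrossing_list (map fst ps)"
        unfolding noncrossing_list_def
      proof (intro allI impI, rule ccontr)
        fix a b assume s: "subseq [a, b, a, b] (map fst ps)" and ab: "a \<noteq> b"
        \<comment> \<open>A colour of a removed entry occurs only once.\<close>
        have single: "c \<notin> ?Cr" if c: "subseq [c, c] (filter (\<lambda>x. x = c) (map fst ps))" for c
        proof
          assume "c \<in> ?Cr"
          then obtain x where x: "x \<in> set r" "c = fst x" by auto
          then have "length (filter (\<lambda>y. fst y = c) ps) = 1"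
            using \<open>good\<close> by (simp add: good_def)
          then have "length (filter (\<lambda>x. x = c) (map fst ps)) = 1"
            by (simp add: filter_map comp_def)
          then show False using not_subseq_length c by fastforce
        qed
        have "a \<notin> ?Cr" "b \<notin> ?Cr"
          using subseq_filter[OF s, of "\<lambda>x. x = a"] subseq_filter[OF s, of "\<lambda>x. x = b"] ab single by auto
        then have "subseq [a, b, a, b] (filter (\<lambda>c. c \<notin> ?Cr) (map fst ps))"
          using subseq_filter[OF s, of "\<lambda>c. c \<notin> ?Cr"] by simp
        also have "filter (\<lambda>c. c \<notin> ?Cr) (map fst ps) = map fst k"
          using f(2) by (simp add: filter_map comp_def)
        finally show False using nck ab by (auto simp: noncrossing_list_def)
      qed
    qed
    then show ?thesis using prod by (simp add: leading_moment_def)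
  qed
qed

subsection \<open>Asymptotics of free moments\<close>

lemma tendsto_sum_list:
  fixes f :: "'a \<Rightarrow> 'b \<Rightarrow> complex"
  assumes "\<And>x. x \<in> set xs \<Longrightarrow> (f x \<longlongrightarrow> l x) \<omega>"
  shows "((\<lambda>N. \<Sum>x\<leftarrow>xs. f x N) \<longlongrightarrow> (\<Sum>x\<leftarrow>xs. l x)) \<omega>"
  using assms by (induction xs) (auto intro!: tendsto_add)

lemma tendsto_prod_list:
  fixes f :: "'a \<Rightarrow> 'b \<Rightarrow> complex"
  assumes "\<And>x. x \<in> set xs \<Longrightarrow> (f x \<longlongrightarrow> l x) \<omega>"
  shows "((\<lambda>N. \<Prod>x\<leftarrow>xs. f x N) \<longlongrightarrow> (\<Prod>x\<leftarrow>xs. l x)) \<omega>"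
  using assms by (induction xs) (auto intro!: tendsto_mult)

lemma prod_list_scale: "(\<Prod>x\<leftarrow>r. c * f x) = c ^ length r * (\<Prod>x\<leftarrow>r. (f x :: complex))"
  by (induction r) (auto simp: algebra_simps)

text \<open>By induction on the length of the list. Merging reduces to lists with alternating colours. There,
  of all the terms in the expansion only those survive in which just singletons are removed, and
  each of them has the same limit up to sign. If there are singletons, the signs add up to give the
  leading moment. If there are none, nothing survives, and the leading moment is zero too, because
  the colours then cross.\<close>

lemma free_iid_moments_limit:
  fixes \<omega> :: "nat filter" and val :: "nat \<Rightarrow> (nat \<times> 'i list) list \<Rightarrow> complex"
  assumes \<omega>: "\<omega> \<le> sequentially"
    and free: "eventually (\<lambda>N. free_iid_moments N (val N) (F N)) \<omega>"
    and \<kappa>: "\<And>u. u \<noteq> [] \<Longrightarrow> ((\<lambda>N. of_nat N * F N u) \<longlongrightarrow> \<kappa> u) \<omega>"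
    and "0 \<notin> fst ` set ps" "[] \<notin> snd ` set ps"
  shows "((\<lambda>N. of_nat N ^ card (fst ` set ps) * val N ps) \<longlongrightarrow> leading_moment \<kappa> ps) \<omega>"
  using assms(4-)
proof (induction "length ps" arbitrary: ps rule: less_induct)
  case less
  have large: "eventually (\<lambda>N. m \<le> N) \<omega>" for m
    using \<omega> eventually_ge_at_top[of m] by (rule filter_leD)
  have cols: "eventually (\<lambda>N. fst ` set ps \<subseteq> {1..N}) \<omega>"
  proof (rule eventually_mono[OF large[of "Max (fst ` set ps)"]])
    fix N assume N: "Max (fst ` set ps) \<le> N"
    have "c \<le> N" if "c \<in> fst ` set ps" for c
      using order_trans[OF Max_ge[OF _ that] N] by simp
    moreover have "1 \<le> c" if "c \<in> fst ` set ps" for c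
      using that less.prems(1) by (metis One_nat_def Suc_leI gr0I)
    ultimately show "fst ` set ps \<subseteq> {1..N}" by (meson atLeastAtMost_iff subsetI)
  qed
  show ?case
  proof (cases "successively (\<lambda>x y. fst x \<noteq> fst y) ps")
    case False
    then obtain xs c u v ys where ps: "ps = xs @ (c, u) # (c, v) # ys"
      using not_successively_split by blast
    let ?ps = "xs @ (c, u @ v) # ys"
    have set: "fst ` set ?ps = fst ` set ps" by (auto simp: ps)
    have val: "eventually (\<lambda>N. val N ?ps = val N ps) \<omega>"
      using free cols by eventually_elim (auto simp: ps free_iid_moments_def)
    have "colour_word ?ps = colour_word ps" by (auto simp: colour_word_def ps)
    moreover have "noncrossing_list (map fst ?ps) \<longleftrightarrow> noncrossing_list (map fst ps)"
      using noncrossing_list_merge[of "map fst xs" c "map fst ys"] by (simp add: ps)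
    ultimately have lead: "leading_moment \<kappa> ?ps = leading_moment \<kappa> ps"
      unfolding leading_moment_def set by simp
    have "((\<lambda>N. of_nat N ^ card (fst ` set ?ps) * val N ?ps) \<longlongrightarrow> leading_moment \<kappa> ?ps) \<omega>"
      using less.prems by (intro less.hyps) (auto simp: ps)
    then show ?thesis unfolding set lead
      by (rule Lim_transform_eventually) (use val in \<open>eventually_elim, simp\<close>)
  next
    case alt: True
    show ?thesis
    proof (cases "ps = []")
      case True
      have "eventually (\<lambda>N. val N [] = 1) \<omega>"
        using free by eventually_elim (simp add: free_iid_moments_def)
      then show ?thesis
        by (intro tendsto_eventually) (simp add: True leading_moment_def noncrossing_list_def)
    next
      case ne: False
      define n where "n = card (fst ` set ps)"
      define good :: "nat \<times> 'i list \<Rightarrow> bool" where "good x \<longleftrightarrow> length (filter (\<lambda>y. fst y = fst x) ps) = 1" for x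
      obtain R where R: "splits ps = ([], ps) # R" "\<And>r k. (r, k) \<in> set R \<Longrightarrow> length k < length ps"
        using splits_head[of ps] by blast
      define t :: "(nat \<times> 'i list) list \<times> (nat \<times> 'i list) list \<Rightarrow> nat \<Rightarrow> complex"
        where "t = (\<lambda>(r, k) N. - ((- 1) ^ length r) * (of_nat N ^ n * ((\<Prod>x\<leftarrow>r. F N (snd x)) * val N k)))"
      define l :: "(nat \<times> 'i list) list \<times> (nat \<times> 'i list) list \<Rightarrow> complex"
        where "l = (\<lambda>(r, k). - ((- 1) ^ length r * (if \<forall>x\<in>set r. good x then 1 else 0)) * leading_moment \<kappa> ps)"
      have rec: "eventually (\<lambda>N. (\<Sum>x\<leftarrow>R. t x N) = of_nat N ^ n * val N ps) \<omega>"
        using free cols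
      proof eventually_elim
        case (elim N)
        then have "(\<Sum>(r, k)\<leftarrow>splits ps. (- 1) ^ length r * (\<Prod>x\<leftarrow>r. F N (snd x)) * val N k) = 0"
          using alt ne by (auto simp: free_iid_moments_def)
        then have "val N ps = - (\<Sum>(r, k)\<leftarrow>R. (- 1) ^ length r * (\<Prod>x\<leftarrow>r. F N (snd x)) * val N k)"
          by (simp add: R(1) add_eq_0_iff2)
        also have "\<dots> = (\<Sum>(r, k)\<leftarrow>R. - ((- 1) ^ length r * (\<Prod>x\<leftarrow>r. F N (snd x)) * val N k))"
          by (simp add: uminus_sum_list_map comp_def case_prod_unfold)
        finally show ?case
          by (simp add: t_def case_prod_unfold sum_list_const_mult[symmetric] algebra_simps)
      qed
      have lim: "(t x \<longlongrightarrow> l x) \<omega>" if "x \<in> set R" for x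
      proof -
        obtain r k where x: "x = (r, k)" by (cases x)
        have rk: "(r, k) \<in> set (splits ps)" using that x R(1) by simp
        note col = splits_colours[OF rk]
        \<comment> \<open>The term is smaller by the factor \<open>N\<close> to the power \<open>d\<close> than those of leading order.\<close>
        define d where "d = length r + card (fst ` set k) - n"
        have kps: "set r \<subseteq> set ps" "set k \<subseteq> set ps" using splits_set[OF rk] by auto
        have "((\<lambda>N. of_nat N ^ card (fst ` set k) * val N k) \<longlongrightarrow> leading_moment \<kappa> k) \<omega>"
          using less.prems R(2)[of r k] that x kps by (intro less.hyps) auto
        moreover have "((\<lambda>N. \<Prod>x\<leftarrow>r. of_nat N * F N (snd x)) \<longlongrightarrow> (\<Prod>x\<leftarrow>r. \<kappa> (snd x))) \<omega>"
        proof (intro tendsto_prod_list \<kappa>)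
          fix x assume "x \<in> set r"
          then have "snd x \<in> snd ` set ps" using kps by auto
          then show "snd x \<noteq> []" using less.prems(2) by metis
        qed
        moreover have "((\<lambda>N. inverse (of_nat N) ^ d :: complex) \<longlongrightarrow> 0 ^ d) \<omega>"
          by (intro tendsto_power filterlim_mono[OF lim_inverse_n order.refl \<omega>])
        ultimately have prod: "((\<lambda>N. inverse (of_nat N) ^ d * ((\<Prod>x\<leftarrow>r. of_nat N * F N (snd x)) * (of_nat N ^ card (fst ` set k) * val N k)))
            \<longlongrightarrow> 0 ^ d * ((\<Prod>x\<leftarrow>r. \<kappa> (snd x)) * leading_moment \<kappa> k)) \<omega>"
          by (intro tendsto_mult)
        have "0 ^ d * ((\<Prod>x\<leftarrow>r. \<kappa> (snd x)) * leading_moment \<kappa> k) = (if \<forall>x\<in>set r. good x then 1 else 0) * leading_moment \<kappa> ps"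
        proof (cases "\<forall>x\<in>set r. good x")
          case True
          then have "d = 0" using col(2) unfolding d_def n_def good_def by simp
          then show ?thesis using True col(3)[of \<kappa>] unfolding good_def by simp
        next
          case False
          then have "d > 0" using col(1,2) unfolding d_def n_def good_def by fastforce
          then show ?thesis unfolding if_not_P[OF False] by simp
        qed
        moreover have "eventually (\<lambda>N. inverse (of_nat N) ^ d * ((\<Prod>x\<leftarrow>r. of_nat N * F N (snd x)) * (of_nat N ^ card (fst ` set k) * val N k))
            = of_nat N ^ n * ((\<Prod>x\<leftarrow>r. F N (snd x)) * val N k)) \<omega>"
          using large[of 1]
        proof eventually_elim
          case (elim N)
          have "(of_nat N :: complex) ^ length r * of_nat N ^ card (fst ` set k) = of_nat N ^ d * of_nat N ^ n"
            using col(1) by (simp add: d_def n_def flip: power_add)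
          moreover have "inverse (of_nat N :: complex) ^ d * of_nat N ^ d = 1"
            using elim by (simp flip: power_mult_distrib)
          ultimately have h: "inverse (of_nat N :: complex) ^ d * (of_nat N ^ length r * of_nat N ^ card (fst ` set k)) = of_nat N ^ n"
            by (simp flip: mult.assoc)
          have "inverse (of_nat N) ^ d * ((\<Prod>x\<leftarrow>r. of_nat N * F N (snd x)) * (of_nat N ^ card (fst ` set k) * val N k))
              = inverse (of_nat N) ^ d * (of_nat N ^ length r * of_nat N ^ card (fst ` set k)) * ((\<Prod>x\<leftarrow>r. F N (snd x)) * val N k)"
            unfolding prod_list_scale by (simp only: ac_simps)
          then show ?case unfolding h .
        qed
        ultimately have "((\<lambda>N. of_nat N ^ n * ((\<Prod>x\<leftarrow>r. F N (snd x)) * val N k)) \<longlongrightarrow> (if \<forall>x\<in>set r. good x then 1 else 0) * leading_moment \<kappa> ps) \<omega>"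
          using Lim_transform_eventually[OF prod] by simp
        from tendsto_mult[OF tendsto_const[of "- ((- 1) ^ length r)"] this]
        show ?thesis by (simp add: x t_def l_def mult.assoc)
      qed
      have "(\<Sum>x\<leftarrow>R. l x) = leading_moment \<kappa> ps"
      proof -
        have "(\<Sum>(r, k)\<leftarrow>R. (- 1) ^ length r * (if \<forall>x\<in>set r. good x then 1 else (0 :: complex))) = (\<Prod>x\<leftarrow>ps. if good x then 0 else 1) - 1"
          using splits_alternating_sum[of good ps] by (simp add: R(1) algebra_simps)
        moreover have "(\<Sum>x\<leftarrow>R. l x) = - (\<Sum>(r, k)\<leftarrow>R. (- 1) ^ length r * (if \<forall>x\<in>set r. good x then 1 else (0 :: complex))) * leading_moment \<kappa> ps"
          unfolding l_def by (simp add: uminus_sum_list_map comp_def case_prod_unfold flip: sum_list_mult_const)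
        ultimately have l: "(\<Sum>x\<leftarrow>R. l x) = (1 - (\<Prod>x\<leftarrow>ps. if good x then 0 else 1)) * leading_moment \<kappa> ps"
          by simp
        show ?thesis
        proof (cases "\<exists>x\<in>set ps. good x")
          case True
          then have "(\<Prod>x\<leftarrow>ps. if good x then 0 else (1 :: complex)) = 0" by (auto simp: prod_list_zero_iff)
          then show ?thesis unfolding l by simp
        next
          case False
          have "\<not> noncrossing_list (map fst ps)"
          proof
            assume "noncrossing_list (map fst ps)"
            moreover have "successively (\<noteq>) (map fst ps)" using alt by (simp add: successively_map)
            ultimately obtain c where c: "c \<in> set (map fst ps)" "count_list (map fst ps) c = 1"
              using alternating_noncrossing_has_singleton[of "map fst ps"] ne by auto
            have "count_list (map fst ps) c = length (filter (\<lambda>x. fst x = c) ps)"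
              by (induction ps) auto
            then show False using c False by (auto simp: good_def)
          qed
          then show ?thesis unfolding l by (simp add: leading_moment_def)
        qed
      qed
      then have "((\<lambda>N. \<Sum>x\<leftarrow>R. t x N) \<longlongrightarrow> leading_moment \<kappa> ps) \<omega>"
        using tendsto_sum_list[of R t l \<omega>] lim by simp
      then show ?thesis unfolding n_def[symmetric]
        by (rule Lim_transform_eventually) (rule rec)
    qed
  qed
qed

subsection \<open>Summing over all colourings\<close>

text \<open>A colouring is the same as its kernel together with an injective colouring of the blocks.\<close>

lemma sum_colourings_by_kernel:
  fixes G :: "(nat \<Rightarrow> 'c) \<Rightarrow> complex"
  assumes V: "finite V" and J: "finite J"
  shows "(\<Sum>j\<in>V \<rightarrow>\<^sub>E J. G j) =
    (\<Sum>P\<in>{P. partition_on V P}. \<Sum>h\<in>{h \<in> P \<rightarrow>\<^sub>E J. inj_on h P}. G (\<lambda>v\<in>V. h (block_of P v)))"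
proof -
  let ?H = "\<lambda>P. {h \<in> P \<rightarrow>\<^sub>E J. inj_on h P}"
  define kern where "kern j = (\<lambda>v. {u \<in> V. j u = j v}) ` V" for j :: "nat \<Rightarrow> 'c"
  have fin: "finite (?H P)" if "partition_on V P" for P
    using finite_elements[OF V that] J by (auto intro!: finite_PiE)
  have part: "partition_on V (kern j)" for j
    by (rule partition_onI) (auto simp: kern_def disjnt_iff)
  have blk: "block_of (kern j) v = {u \<in> V. j u = j v}" if "v \<in> V" for j v
    using that by (intro block_of_eq[OF part]) (auto simp: kern_def)
  have "(\<Sum>P\<in>{P. partition_on V P}. \<Sum>h\<in>?H P. G (\<lambda>v\<in>V. h (block_of P v)))
      = (\<Sum>(P, h)\<in>Sigma {P. partition_on V P} ?H. G (\<lambda>v\<in>V. h (block_of P v)))"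
    using finitely_many_partition_on[OF V] fin by (intro sum.Sigma) auto
  also have "\<dots> = (\<Sum>j\<in>V \<rightarrow>\<^sub>E J. G j)"
  proof (rule sum.reindex_bij_witness[where
        i = "\<lambda>j. (kern j, \<lambda>W\<in>kern j. j (SOME v. v \<in> W))" and
        j = "\<lambda>(P, h). \<lambda>v\<in>V. h (block_of P v)"])
    fix x assume "x \<in> Sigma {P. partition_on V P} ?H"
    then obtain P h where x: "x = (P, h)" and P: "partition_on V P" and h: "h \<in> P \<rightarrow>\<^sub>E J" "inj_on h P"
      by auto
    let ?j = "\<lambda>v\<in>V. h (block_of P v)"
    have same: "?j u = ?j v \<longleftrightarrow> block_of P u = block_of P v" if "u \<in> V" "v \<in> V" for u v
      using that block_of(1)[OF P] h(2) by (auto simp: inj_on_eq_iff)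
    have "{u \<in> V. ?j u = ?j v} = block_of P v" if v: "v \<in> V" for v
    proof (intro equalityI subsetI)
      fix u assume "u \<in> {u \<in> V. ?j u = ?j v}"
      then show "u \<in> block_of P v" using same v block_of(2)[OF P, of u] by auto
    next
      fix u assume u: "u \<in> block_of P v"
      then have "u \<in> V" using block_of(1)[OF P v] partition_onD1[OF P] by auto
      then show "u \<in> {u \<in> V. ?j u = ?j v}"
        using same v block_of_eq[OF P block_of(1)[OF P v] u] by simp
    qed
    then have "kern ?j = block_of P ` V" unfolding kern_def by (intro image_cong) auto
    then have k: "kern ?j = P" using partition_on_eq_blocks[OF P] by simp
    have "(\<lambda>W\<in>P. ?j (SOME v. v \<in> W)) = h"
    proof
      fix W
      show "(\<lambda>W\<in>P. ?j (SOME v. v \<in> W)) W = h W"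
      proof (cases "W \<in> P")
        case True
        then have "W \<noteq> {}" using partition_onD3[OF P] by auto
        then have s: "(SOME v. v \<in> W) \<in> W" by (simp add: some_in_eq)
        then have "(SOME v. v \<in> W) \<in> V" using True partition_onD1[OF P] by auto
        then show ?thesis using True block_of_eq[OF P True s] by simp
      next
        case False
        then show ?thesis using PiE_arb[OF h(1)] by simp
      qed
    qed
    then show "(kern (case x of (P, h) \<Rightarrow> \<lambda>v\<in>V. h (block_of P v)),
        \<lambda>W\<in>kern (case x of (P, h) \<Rightarrow> \<lambda>v\<in>V. h (block_of P v)).
          (case x of (P, h) \<Rightarrow> \<lambda>v\<in>V. h (block_of P v)) (SOME v. v \<in> W)) = x"
      by (simp add: x k)
    show "(case x of (P, h) \<Rightarrow> \<lambda>v\<in>V. h (block_of P v)) \<in> V \<rightarrow>\<^sub>E J"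
      using h(1) block_of(1)[OF P] by (auto simp: x)
    show "G (case x of (P, h) \<Rightarrow> \<lambda>v\<in>V. h (block_of P v)) = (case x of (P, h) \<Rightarrow> G (\<lambda>v\<in>V. h (block_of P v)))"
      by (simp add: x)
  next
    fix j assume j: "j \<in> V \<rightarrow>\<^sub>E J"
    have some: "(SOME v. v \<in> W) \<in> W" "W \<subseteq> V" if "W \<in> kern j" for W
      using that partition_onD3[OF part[of j]] partition_onD1[OF part[of j]] some_in_eq by blast+
    show "(case (kern j, \<lambda>W\<in>kern j. j (SOME v. v \<in> W)) of (P, h) \<Rightarrow> \<lambda>v\<in>V. h (block_of P v)) = j"
    proof
      fix v
      show "(case (kern j, \<lambda>W\<in>kern j. j (SOME v. v \<in> W)) of (P, h) \<Rightarrow> \<lambda>v\<in>V. h (block_of P v)) v = j v"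
      proof (cases "v \<in> V")
        case True
        then have "{u \<in> V. j u = j v} \<in> kern j" by (auto simp: kern_def)
        then show ?thesis using some(1)[of "{u \<in> V. j u = j v}"] True by (simp add: blk)
      next
        case False
        then show ?thesis using PiE_arb[OF j] by simp
      qed
    qed
    have "inj_on (\<lambda>W\<in>kern j. j (SOME v. v \<in> W)) (kern j)"
    proof (rule inj_onI)
      fix W W' assume W: "W \<in> kern j" "W' \<in> kern j"
        and eq: "(\<lambda>W\<in>kern j. j (SOME v. v \<in> W)) W = (\<lambda>W\<in>kern j. j (SOME v. v \<in> W)) W'"
      then obtain v v' where v: "v \<in> V" "W = {u \<in> V. j u = j v}" "v' \<in> V" "W' = {u \<in> V. j u = j v'}"
        by (auto simp: kern_def)
      have "j (SOME v. v \<in> W) = j v" "j (SOME v. v \<in> W') = j v'"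
        using some(1)[OF W(1)] some(1)[OF W(2)] v by auto
      then show "W = W'" using eq W v by simp
    qed
    moreover have "(\<lambda>W\<in>kern j. j (SOME v. v \<in> W)) \<in> kern j \<rightarrow>\<^sub>E J"
    proof (rule restrict_PiE_iff[THEN iffD2], intro ballI)
      fix W assume "W \<in> kern j"
      then have "(SOME v. v \<in> W) \<in> V" using some by blast
      then show "j (SOME v. v \<in> W) \<in> J" using j by auto
    qed
    ultimately show "(kern j, \<lambda>W\<in>kern j. j (SOME v. v \<in> W)) \<in> Sigma {P. partition_on V P} ?H"
      using part by simp
  qed
  finally show ?thesis by simp
qed

lemma falling_factorial_ratio_limit:
  fixes \<omega> :: "nat filter"
  assumes \<omega>: "\<omega> \<le> sequentially"
  shows "((\<lambda>N. of_nat (prod ((-) N) {0..<m}) / of_nat N ^ m :: complex) \<longlongrightarrow> 1) \<omega>"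
proof (induction m)
  case (Suc m)
  have "eventually (\<lambda>N. Suc m \<le> N) \<omega>"
    using \<omega> eventually_ge_at_top by (rule filter_leD)
  then have ev: "eventually (\<lambda>N. 1 - of_nat m * inverse (of_nat N) = (of_nat (N - m) / of_nat N :: complex)) \<omega>"
    by eventually_elim (simp add: of_nat_diff field_simps)
  have "((\<lambda>N. inverse (of_nat N) :: complex) \<longlongrightarrow> 0) \<omega>"
    by (rule filterlim_mono[OF lim_inverse_n order.refl \<omega>])
  then have "((\<lambda>N. 1 - of_nat m * inverse (of_nat N) :: complex) \<longlongrightarrow> 1 - of_nat m * 0) \<omega>"
    by (intro tendsto_diff tendsto_mult tendsto_const)
  then have "((\<lambda>N. of_nat (N - m) / of_nat N :: complex) \<longlongrightarrow> 1) \<omega>"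
    using Lim_transform_eventually[OF _ ev] by simp
  from tendsto_mult[OF Suc this] show ?case by (simp add: field_simps)
qed simp

lemma filter_sorted_list_of_set:
  "finite V \<Longrightarrow> filter P (sorted_list_of_set V) = sorted_list_of_set {v \<in> V. P v}"
  by (intro sorted_distinct_set_unique) (auto simp: sorted_wrt_filter distinct_filter)

lemma noncrossing_list_iff_partition:
  assumes V: "finite V" and P: "partition_on V P" and g: "inj_on g P"
  shows "noncrossing_list (map (\<lambda>v. g (block_of P v)) (sorted_list_of_set V)) \<longleftrightarrow> noncrossing P"
    (is "noncrossing_list (map ?f ?vs) \<longleftrightarrow> _")
proof
  assume nc: "noncrossing_list (map ?f ?vs)"
  show "noncrossing P"
    unfolding noncrossing_def
  proof (intro ballI allI impI, elim conjE)
    fix U W a b c d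
    assume U: "U \<in> P" "W \<in> P" and o: "a < b" "b < c" "c < d" "a \<in> U" "c \<in> U" "b \<in> W" "d \<in> W"
    have inV: "a \<in> V" "b \<in> V" "c \<in> V" "d \<in> V" using U o partition_onD1[OF P] by auto
    have "subseq [a, b, c, d] ?vs"
      using inV o V by (intro sorted_subset_imp_subseq) auto
    then have "subseq (map ?f [a, b, c, d]) (map ?f ?vs)" by (rule subseq_map)
    then have "subseq [g U, g W, g U, g W] (map ?f ?vs)"
      using block_of_eq[OF P U(1)] block_of_eq[OF P U(2)] o by simp
    then have "g U = g W" using nc by (auto simp: noncrossing_list_def)
    then show "U = W" using g U by (simp add: inj_on_eq_iff)
  qed
next
  assume nc: "noncrossing P"
  show "noncrossing_list (map ?f ?vs)"
    unfolding noncrossing_list_def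
  proof (intro allI impI)
    fix x y assume "subseq [x, y, x, y] (map ?f ?vs)"
    then obtain M where "[x, y, x, y] = nths (map ?f ?vs) M" by (auto simp: subseq_conv_nths)
    then have "[x, y, x, y] = map ?f (nths ?vs M)" by (simp add: nths_map)
    then obtain a b c d where us: "nths ?vs M = [a, b, c, d]"
      and f: "x = ?f a" "y = ?f b" "x = ?f c" "y = ?f d"
      by (auto simp: Cons_eq_map_conv)
    have sub: "subseq [a, b, c, d] ?vs" using us subseq_conv_nths by metis
    have inV: "a \<in> V" "b \<in> V" "c \<in> V" "d \<in> V"
      using set_nths_subset[of ?vs M] us V by auto
    have "sorted (nths ?vs M)" "distinct (nths ?vs M)" by (auto intro: sorted_nths distinct_nthsI)
    then have o: "a < b" "b < c" "c < d" by (auto simp: us)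
    note B = block_of[OF P]
    have "block_of P a = block_of P c" "block_of P b = block_of P d"
      using f g B(1) inV by (metis inj_on_eq_iff)+
    then have "block_of P a = block_of P b"
      using noncrossingD[OF nc B(1)[OF inV(1)] B(1)[OF inV(2)] o] B(2) inV by metis
    then show "x = y" using f by simp
  qed
qed

text \<open>All colourings with kernel \<open>P\<close> contribute equally, and there are \<open>N (N - 1) \<cdots> (N - |P| + 1)\<close> of
  them. This number is asymptotic to \<open>N\<close> to the power \<open>|P|\<close>, which is the normalisation under which the contribution
  converges.\<close>

theorem sum_colourings_limit:
  fixes \<omega> :: "nat filter" and val :: "nat \<Rightarrow> (nat \<times> 'i list) list \<Rightarrow> complex"
  assumes \<omega>: "\<omega> \<le> sequentially"
    and free: "eventually (\<lambda>N. free_iid_moments N (val N) (F N)) \<omega>"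
    and \<kappa>: "\<And>u. u \<noteq> [] \<Longrightarrow> ((\<lambda>N. of_nat N * F N u) \<longlongrightarrow> \<kappa> u) \<omega>"
    and V: "finite V"
  shows "((\<lambda>N. \<Sum>j\<in>V \<rightarrow>\<^sub>E {1..N}. val N (map (\<lambda>v. (j v, [i v])) (sorted_list_of_set V)))
    \<longlongrightarrow> (\<Sum>P\<in>NC_on V. \<Prod>W\<in>P. \<kappa> (map i (sorted_list_of_set W)))) \<omega>"
proof -
  let ?vs = "sorted_list_of_set V" and ?H = "\<lambda>N P. {h \<in> P \<rightarrow>\<^sub>E {1..N}. inj_on h P}"
  let ?w = "\<lambda>P. \<Prod>W\<in>P. \<kappa> (map i (sorted_list_of_set W))"
  have part_lim: "((\<lambda>N. \<Sum>h\<in>?H N P. val N (map (\<lambda>v. ((\<lambda>v\<in>V. h (block_of P v)) v, [i v])) ?vs))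
      \<longlongrightarrow> (if noncrossing P then ?w P else 0)) \<omega>" if P: "partition_on V P" for P
  proof -
    define m where "m = card P"
    have finP: "finite P" using finite_elements[OF V P] .
    \<comment> \<open>A colouring with kernel \<open>P\<close> by the colours up to \<open>card P\<close>, so that it exists for all large \<open>N\<close>.\<close>
    obtain g where g: "bij_betw g P {1..m}"
      using ex_bij_betw_nat_finite_1[OF finP] bij_betw_inv_into unfolding m_def by blast
    have gi: "inj_on g P" and gr: "g ` P = {1..m}" using g by (auto simp: bij_betw_def)
    define ps where "ps = map (\<lambda>v. (g (block_of P v), [i v])) ?vs"
    have "fst ` set ps = g ` block_of P ` V" using V by (auto simp: ps_def image_image)
    then have cols: "fst ` set ps = g ` P" using partition_on_eq_blocks[OF P] by simp
    have ncols: "card (fst ` set ps) = m" unfolding cols gr by simp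
    have "((\<lambda>N. of_nat N ^ card (fst ` set ps) * val N ps) \<longlongrightarrow> leading_moment \<kappa> ps) \<omega>"
      by (rule free_iid_moments_limit[OF \<omega> free \<kappa>]) (auto simp: cols gr, auto simp: ps_def)
    from tendsto_mult[OF falling_factorial_ratio_limit[OF \<omega>, of m] this]
    have lim: "((\<lambda>N. of_nat (prod ((-) N) {0..<m}) / of_nat N ^ m * (of_nat N ^ m * val N ps)) \<longlongrightarrow> leading_moment \<kappa> ps) \<omega>"
      unfolding ncols by simp
    have ev: "eventually (\<lambda>N. m \<le> N \<and> 1 \<le> N) \<omega>"
      using \<omega> eventually_ge_at_top[of "max m 1"] by (auto dest: filter_leD)
    have "eventually (\<lambda>N. of_nat (prod ((-) N) {0..<m}) / of_nat N ^ m * (of_nat N ^ m * val N ps) =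
        (\<Sum>h\<in>?H N P. val N (map (\<lambda>v. ((\<lambda>v\<in>V. h (block_of P v)) v, [i v])) ?vs))) \<omega>"
      using free ev
    proof eventually_elim
      case (elim N)
      have "val N (map (\<lambda>v. ((\<lambda>v\<in>V. h (block_of P v)) v, [i v])) ?vs) = val N ps" if h: "h \<in> ?H N P" for h
      proof -
        let ?f = "h \<circ> inv_into P g"
        have "map (\<lambda>v. ((\<lambda>v\<in>V. h (block_of P v)) v, [i v])) ?vs = map (apfst ?f) ps"
          unfolding ps_def map_map
          using V block_of(1)[OF P] gi by (intro map_cong) (auto simp: inv_into_f_f)
        moreover have "val N (map (apfst ?f) ps) = val N ps"
        proof (rule free_iid_moments_rename[OF elim(1)])
          have img: "inv_into P g ` g ` P = P" by (rule inv_into_image_cancel[OF gi subset_refl])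
          show "inj_on ?f (fst ` set ps)" unfolding cols
            using h img by (intro comp_inj_on inj_on_inv_into) auto
          show "fst ` set ps \<subseteq> {1..N}" unfolding cols gr using elim by auto
          show "?f ` fst ` set ps \<subseteq> {1..N}" unfolding cols image_comp[symmetric] img using h by auto
        qed
        ultimately show ?thesis by simp
      qed
      then have "(\<Sum>h\<in>?H N P. val N (map (\<lambda>v. ((\<lambda>v\<in>V. h (block_of P v)) v, [i v])) ?vs)) = of_nat (card (?H N P)) * val N ps"
        by simp
      also have "card (?H N P) = prod ((-) N) {0..<m}"
        using card_inj_on_subset_funcset[OF finP _ subset_refl, of "{1..N}"] by (simp add: m_def)
      finally show ?case using elim by simp
    qed
    from Lim_transform_eventually[OF lim this]
    have "((\<lambda>N. \<Sum>h\<in>?H N P. val N (map (\<lambda>v. ((\<lambda>v\<in>V. h (block_of P v)) v, [i v])) ?vs)) \<longlongrightarrow> leading_moment \<kappa> ps) \<omega>" .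
    moreover have "leading_moment \<kappa> ps = (if noncrossing P then ?w P else 0)"
    proof -
      have "map fst ps = map (\<lambda>v. g (block_of P v)) ?vs" by (simp add: ps_def)
      then have nc: "noncrossing_list (map fst ps) \<longleftrightarrow> noncrossing P"
        using noncrossing_list_iff_partition[OF V P gi] by simp
      have "colour_word ps (g W) = map i (sorted_list_of_set W)" if W: "W \<in> P" for W
      proof -
        have eq: "g (block_of P v) = g W \<longleftrightarrow> v \<in> W" if "v \<in> V" for v
          using gi W block_of[OF P that] block_of_eq[OF P W] by (auto simp: inj_on_eq_iff)
        have "W \<subseteq> V" using W partition_onD1[OF P] by auto
        then have "{v \<in> V. g (block_of P v) = g W} = W" using eq by auto
        then have "filter (\<lambda>v. g (block_of P v) = g W) ?vs = sorted_list_of_set W"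
          using filter_sorted_list_of_set[OF V] by simp
        then show ?thesis by (simp add: colour_word_def ps_def filter_map comp_def)
      qed
      then have "(\<Prod>c\<in>fst ` set ps. \<kappa> (colour_word ps c)) = ?w P"
        unfolding cols by (simp add: prod.reindex[OF gi])
      then show ?thesis unfolding leading_moment_def nc by simp
    qed
    ultimately show ?thesis by simp
  qed
  have "((\<lambda>N. \<Sum>P\<in>{P. partition_on V P}. \<Sum>h\<in>?H N P. val N (map (\<lambda>v. ((\<lambda>v\<in>V. h (block_of P v)) v, [i v])) ?vs))
      \<longlongrightarrow> (\<Sum>P\<in>{P. partition_on V P}. if noncrossing P then ?w P else 0)) \<omega>"
    using part_lim by (intro tendsto_sum) simp
  also have "(\<Sum>P\<in>{P. partition_on V P}. if noncrossing P then ?w P else 0) = (\<Sum>P\<in>NC_on V. ?w P)"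
    using finitely_many_partition_on[OF V] by (simp add: NC_on_def sum.inter_filter[symmetric])
  finally show ?thesis
    by (simp add: sum_colourings_by_kernel[OF V finite_atLeastAtMost])
qed

section \<open>Moments of free sequences in a C*-probability space\<close>

lemma sum_PiE_insert:
  assumes "v \<notin> S"
  shows "(\<Sum>j\<in>insert v S \<rightarrow>\<^sub>E J. G j) = (\<Sum>c\<in>J. \<Sum>j\<in>S \<rightarrow>\<^sub>E J. G (j(v := c)) :: complex)"
proof -
  have "(\<Sum>j\<in>insert v S \<rightarrow>\<^sub>E J. G j) = (\<Sum>(c, j)\<in>J \<times> (S \<rightarrow>\<^sub>E J). G (j(v := c)))"
    unfolding PiE_insert_eq using inj_combinator[OF assms, of "\<lambda>_. J"]
    by (subst sum.reindex) (simp_all add: case_prod_unfold comp_def)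
  then show ?thesis by (simp add: sum.cartesian_product)
qed

context cstar_prob_space
begin

lemma state_prod_of_sums:
  assumes x: "\<And>j i. j \<in> J \<Longrightarrow> x j i \<in> carrier A" and J: "finite J" and "distinct vs"
  shows "\<phi> (lprod A (map (\<lambda>v. \<Oplus>j\<in>J. x j (i v)) vs))
    = (\<Sum>j\<in>set vs \<rightarrow>\<^sub>E J. \<phi> (lprod A (map (\<lambda>v. x (j v) (i v)) vs)))"
proof -
  have "\<phi> (w \<otimes> lprod A (map (\<lambda>v. \<Oplus>j\<in>J. x j (i v)) vs))
    = (\<Sum>j\<in>set vs \<rightarrow>\<^sub>E J. \<phi> (w \<otimes> lprod A (map (\<lambda>v. x (j v) (i v)) vs)))" if "w \<in> carrier A" for w
    using that \<open>distinct vs\<close>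
  proof (induction vs arbitrary: w)
    case (Cons v vs)
    let ?R = "lprod A (map (\<lambda>v. \<Oplus>j\<in>J. x j (i v)) vs)"
    have R: "?R \<in> carrier A" using x by (intro lprod_closed) (auto intro!: finsum_closed)
    have f: "(\<lambda>j. x j (i v)) \<in> J \<rightarrow> carrier A" using x by auto
    have "w \<otimes> ((\<Oplus>j\<in>J. x j (i v)) \<otimes> ?R) = (w \<otimes> (\<Oplus>j\<in>J. x j (i v))) \<otimes> ?R"
      using Cons.prems(1) R f by (simp add: m_assoc)
    also have "w \<otimes> (\<Oplus>j\<in>J. x j (i v)) = (\<Oplus>j\<in>J. w \<otimes> x j (i v))"
      by (rule finsum_rdistr[OF J Cons.prems(1) f])
    also have "\<dots> \<otimes> ?R = (\<Oplus>j\<in>J. w \<otimes> x j (i v) \<otimes> ?R)"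
      using f Cons.prems(1) by (intro finsum_ldistr[OF J R]) auto
    finally have "\<phi> (w \<otimes> ((\<Oplus>j\<in>J. x j (i v)) \<otimes> ?R)) = (\<Sum>c\<in>J. \<phi> (w \<otimes> x c (i v) \<otimes> ?R))"
      using Cons.prems(1) R x by (simp add: state_finsum[OF J])
    also have "\<dots> = (\<Sum>c\<in>J. \<Sum>j\<in>set vs \<rightarrow>\<^sub>E J. \<phi> (w \<otimes> x c (i v) \<otimes> lprod A (map (\<lambda>v. x (j v) (i v)) vs)))"
      using Cons.prems x by (intro sum.cong refl Cons.IH) auto
    also have "\<dots> = (\<Sum>c\<in>J. \<Sum>j\<in>set vs \<rightarrow>\<^sub>E J. \<phi> (w \<otimes> lprod A (map (\<lambda>u. x ((j(v := c)) u) (i u)) (v # vs))))"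
    proof (intro sum.cong refl)
      fix c j assume c: "c \<in> J" and j: "j \<in> set vs \<rightarrow>\<^sub>E J"
      have eq: "map (\<lambda>u. x ((j(v := c)) u) (i u)) vs = map (\<lambda>u. x (j u) (i u)) vs"
        using Cons.prems(2) by auto
      have "lprod A (map (\<lambda>u. x (j u) (i u)) vs) \<in> carrier A"
        using x j by (intro lprod_closed) (auto dest: PiE_mem)
      then show "\<phi> (w \<otimes> x c (i v) \<otimes> lprod A (map (\<lambda>v. x (j v) (i v)) vs))
          = \<phi> (w \<otimes> lprod A (map (\<lambda>u. x ((j(v := c)) u) (i u)) (v # vs)))"
        using Cons.prems(1) x c by (simp add: m_assoc eq fun_upd_same del: fun_upd_apply)
    qed
    also have "\<dots> = (\<Sum>j\<in>set (v # vs) \<rightarrow>\<^sub>E J. \<phi> (w \<otimes> lprod A (map (\<lambda>u. x (j u) (i u)) (v # vs))))"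
      unfolding list.set by (rule sum_PiE_insert[symmetric]) (use Cons.prems(2) in simp)
    finally show ?case by simp
  qed simp
  from this[of \<one>] have "\<phi> (\<one> \<otimes> lprod A (map (\<lambda>v. \<Oplus>j\<in>J. x j (i v)) vs))
    = (\<Sum>j\<in>set vs \<rightarrow>\<^sub>E J. \<phi> (\<one> \<otimes> lprod A (map (\<lambda>v. x (j v) (i v)) vs)))" by simp
  also have "\<dots> = (\<Sum>j\<in>set vs \<rightarrow>\<^sub>E J. \<phi> (lprod A (map (\<lambda>v. x (j v) (i v)) vs)))"
  proof (rule sum.cong[OF refl])
    fix j assume "j \<in> set vs \<rightarrow>\<^sub>E J"
    then have "lprod A (map (\<lambda>v. x (j v) (i v)) vs) \<in> carrier A"
      using x by (intro lprod_closed) (auto dest: PiE_mem)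
    then show "\<phi> (\<one> \<otimes> lprod A (map (\<lambda>v. x (j v) (i v)) vs)) = \<phi> (lprod A (map (\<lambda>v. x (j v) (i v)) vs))"
      by simp
  qed
  also have "\<one> \<otimes> lprod A (map (\<lambda>v. \<Oplus>j\<in>J. x j (i v)) vs) = lprod A (map (\<lambda>v. \<Oplus>j\<in>J. x j (i v)) vs)"
    using x by (intro l_one lprod_closed) (auto intro!: finsum_closed)
  finally show ?thesis .
qed

text \<open>The free factor \<open>w\<close> on the left makes the induction on the list work.\<close>

lemma state_prod_centred:
  assumes "w \<in> carrier A" "\<And>p. p \<in> set ps \<Longrightarrow> y p \<in> carrier A"
  shows "\<phi> (w \<otimes> lprod A (map (\<lambda>p. y p \<oplus> (- f p) \<odot> \<one>) ps)) =
    (\<Sum>(r, k)\<leftarrow>splits ps. (- 1) ^ length r * (\<Prod>p\<leftarrow>r. f p) * \<phi> (w \<otimes> lprod A (map y k)))"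
  using assms
proof (induction ps arbitrary: w)
  case (Cons p ps)
  let ?R = "lprod A (map (\<lambda>p. y p \<oplus> (- f p) \<odot> \<one>) ps)"
  have y: "y p \<in> carrier A" "\<And>q. q \<in> set ps \<Longrightarrow> y q \<in> carrier A" using Cons.prems by auto
  have R: "?R \<in> carrier A" using y by (intro lprod_closed) (auto simp: scale_closed)
  have "w \<otimes> ((y p \<oplus> (- f p) \<odot> \<one>) \<otimes> ?R) = (w \<otimes> y p) \<otimes> ?R \<oplus> (- f p) \<odot> (w \<otimes> ?R)"
    using Cons.prems(1) y R
    by (simp add: l_distr r_distr m_assoc scale_closed mult_scale_left mult_scale_right)
  then have "\<phi> (w \<otimes> ((y p \<oplus> (- f p) \<odot> \<one>) \<otimes> ?R)) = \<phi> ((w \<otimes> y p) \<otimes> ?R) + (- f p) * \<phi> (w \<otimes> ?R)"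
    using Cons.prems(1) y R by (simp add: state_add state_scale scale_closed)
  also have "\<phi> ((w \<otimes> y p) \<otimes> ?R) =
      (\<Sum>(r, k)\<leftarrow>splits ps. (- 1) ^ length r * (\<Prod>p\<leftarrow>r. f p) * \<phi> ((w \<otimes> y p) \<otimes> lprod A (map y k)))"
    using Cons.prems(1) y by (intro Cons.IH) auto
  also have "\<dots> = (\<Sum>(r, k)\<leftarrow>splits ps. (- 1) ^ length r * (\<Prod>p\<leftarrow>r. f p) * \<phi> (w \<otimes> lprod A (map y (p # k))))"
  proof (intro arg_cong[of _ _ sum_list] map_cong[OF refl])
    fix x assume "x \<in> set (splits ps)"
    moreover obtain r k where x: "x = (r, k)" by (cases x)
    ultimately have "lprod A (map y k) \<in> carrier A" using splits_set[of r k ps] y by (intro lprod_closed) auto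
    then show "(case x of (r, k) \<Rightarrow> (- 1) ^ length r * (\<Prod>p\<leftarrow>r. f p) * \<phi> ((w \<otimes> y p) \<otimes> lprod A (map y k)))
        = (case x of (r, k) \<Rightarrow> (- 1) ^ length r * (\<Prod>p\<leftarrow>r. f p) * \<phi> (w \<otimes> lprod A (map y (p # k))))"
      using Cons.prems(1) y x by (simp add: m_assoc)
  qed
  also have "(- f p) * \<phi> (w \<otimes> ?R) =
      (\<Sum>(r, k)\<leftarrow>splits ps. (- 1) ^ length (p # r) * (\<Prod>p\<leftarrow>p # r. f p) * \<phi> (w \<otimes> lprod A (map y k)))"
  proof -
    have "\<phi> (w \<otimes> ?R) = (\<Sum>(r, k)\<leftarrow>splits ps. (- 1) ^ length r * (\<Prod>p\<leftarrow>r. f p) * \<phi> (w \<otimes> lprod A (map y k)))"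
      using Cons.prems(1) y by (intro Cons.IH) auto
    then have "(- f p) * \<phi> (w \<otimes> ?R) =
        (\<Sum>x\<leftarrow>splits ps. (- f p) * (case x of (r, k) \<Rightarrow> (- 1) ^ length r * (\<Prod>p\<leftarrow>r. f p) * \<phi> (w \<otimes> lprod A (map y k))))"
      by (simp only: sum_list_const_mult)
    also have "\<dots> = (\<Sum>(r, k)\<leftarrow>splits ps. (- 1) ^ length (p # r) * (\<Prod>p\<leftarrow>p # r. f p) * \<phi> (w \<otimes> lprod A (map y k)))"
      by (intro arg_cong[of _ _ sum_list] map_cong) auto
    finally show ?thesis .
  qed
  finally show ?case by (simp add: comp_def case_prod_unfold)
qed simp

definition coloured_moment :: "('j \<Rightarrow> 'i \<Rightarrow> 'a) \<Rightarrow> ('j \<times> 'i list) list \<Rightarrow> complex" where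
  "coloured_moment x ps = \<phi> (lprod A (map (\<lambda>(c, u). lprod A (map (x c) u)) ps))"

text \<open>Products of letters of one colour, centred by a multiple of the unit, lie in the subalgebra of
  that colour, so freeness applies to them. The limit theorem for sums uses freeness only through
  these rules.\<close>

lemma free_sequences_moments:
  assumes free: "free_sequences A \<phi> {1..N} x"
    and F: "\<And>j u. j \<in> {1..N} \<Longrightarrow> \<phi> (lprod A (map (x j) u)) = F u"
  shows "free_iid_moments N (coloured_moment x) F"
proof -
  let ?S = "\<lambda>j. unital_subalgebra A hull range (x j)"
  have sub: "unital_subalgebra A (?S j)" if "j \<in> {1..N}" for j
    using free that by (simp add: free_sequences_def free_subalgebras_def)
  have xS: "x j i \<in> ?S j" for j i by (rule hull_inc) simp
  have wordS: "lprod A (map (x j) u) \<in> ?S j" if "j \<in> {1..N}" for j u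
    using sub[OF that] xS by (induction u) (auto simp: unital_subalgebra_def)
  have word: "lprod A (map (x j) u) \<in> carrier A" if "j \<in> {1..N}" for j u
    using wordS[OF that] sub[OF that] by (auto simp: unital_subalgebra_def)
  let ?y = "\<lambda>(c, u). lprod A (map (x c) u)"
  have y: "?y p \<in> carrier A" if "fst ` set ps \<subseteq> {1..N}" "p \<in> set ps" for ps p
    using that word by (cases p) auto
  have xc: "x j i \<in> carrier A" if "j \<in> {1..N}" for j i
    using xS sub[OF that] by (auto simp: unital_subalgebra_def)
  show ?thesis
    unfolding free_iid_moments_def
  proof (intro conjI allI impI)
    show "coloured_moment x [] = 1" by (simp add: coloured_moment_def state_one)
  next
    fix xs ys :: "(nat \<times> 'b list) list" and c u v
    assume c: "fst ` set (xs @ (c, u) # (c, v) # ys) \<subseteq> {1..N}"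
    have cs: "c \<in> {1..N}" "fst ` set xs \<subseteq> {1..N}" "fst ` set ys \<subseteq> {1..N}"
      using c by auto
    have 2: "set (map ?y xs) \<subseteq> carrier A" "set (map ?y ys) \<subseteq> carrier A"
      unfolding set_map using y[OF cs(2)] y[OF cs(3)] by (blast intro: image_subsetI)+
    note 1 = lprod_closed[OF 2(1)] lprod_closed[OF 2(2)]
    have 3: "lprod A (map (x c) (u @ v)) = lprod A (map (x c) u) \<otimes> lprod A (map (x c) v)"
      unfolding map_append using xc[OF cs(1)] by (intro lprod_append) auto
    show "coloured_moment x (xs @ (c, u) # (c, v) # ys) = coloured_moment x (xs @ (c, u @ v) # ys)"
      using 1 2 3 word[OF cs(1)] by (simp add: coloured_moment_def lprod_append m_assoc)
  next
    fix ps :: "(nat \<times> 'b list) list"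
    assume ne: "ps \<noteq> []" and alt: "successively (\<lambda>x y. fst x \<noteq> fst y) ps" and c: "fst ` set ps \<subseteq> {1..N}"
    define z where "z p = ?y p \<oplus> (- F (snd p)) \<odot> \<one>" for p
    have z: "z p \<in> ?S (fst p) \<and> \<phi> (z p) = 0 \<and> fst p \<in> {1..N}" if "p \<in> set ps" for p
    proof -
      obtain c u where p: "p = (c, u)" by (cases p)
      have cN: "c \<in> {1..N}" using c that p by force
      have "z p \<in> ?S (fst p)" unfolding z_def p
        using sub[OF cN] wordS[OF cN, of u] by (simp add: unital_subalgebra_def)
      moreover have "\<phi> (z p) = 0" unfolding z_def p
        using word[OF cN] F[OF cN] by (simp add: state_add state_scale state_one scale_closed)
      ultimately show ?thesis using cN p by simp
    qed
    \<comment> \<open>Positions start at \<open>1\<close> in ordered products and at \<open>0\<close> in lists.\<close>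
    let ?n = "length ps"
    have fr: "\<phi> (ordered_prod A X {1..n}) = 0"
      if "n \<ge> 1" "\<forall>k\<in>{1..n}. l k \<in> {1..N} \<and> X k \<in> ?S (l k) \<and> \<phi> (X k) = 0"
        "\<forall>k\<in>{1..<n}. l k \<noteq> l (k + 1)" for n X l
      using free that unfolding free_sequences_def free_subalgebras_def by blast
    have "\<phi> (ordered_prod A (\<lambda>k. z (ps ! (k - 1))) {1..?n}) = 0"
    proof (rule fr[of ?n "\<lambda>k. fst (ps ! (k - 1))"])
      show "?n \<ge> 1" using ne by (cases ps) auto
      show "\<forall>k\<in>{1..?n}. fst (ps ! (k - 1)) \<in> {1..N} \<and> z (ps ! (k - 1)) \<in> ?S (fst (ps ! (k - 1))) \<and> \<phi> (z (ps ! (k - 1))) = 0"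
      proof
        fix k assume "k \<in> {1..?n}"
        then have "ps ! (k - 1) \<in> set ps" by (intro nth_mem) auto
        from z[OF this] show "fst (ps ! (k - 1)) \<in> {1..N} \<and> z (ps ! (k - 1)) \<in> ?S (fst (ps ! (k - 1))) \<and> \<phi> (z (ps ! (k - 1))) = 0"
          by blast
      qed
      show "\<forall>k\<in>{1..<?n}. fst (ps ! (k - 1)) \<noteq> fst (ps ! (k + 1 - 1))"
      proof
        fix k assume k: "k \<in> {1..<?n}"
        then obtain m where "k = Suc m" by (cases k) auto
        then show "fst (ps ! (k - 1)) \<noteq> fst (ps ! (k + 1 - 1))"
          using alt k by (auto simp: successively_conv_nth)
      qed
    qed
    also have "ordered_prod A (\<lambda>k. z (ps ! (k - 1))) {1..?n} = lprod A (map z ps)"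
    proof -
      have "map (\<lambda>k. z (ps ! (k - 1))) [1..<Suc ?n] = map z ps"
        by (rule nth_equalityI) (auto simp del: upt_Suc)
      then show ?thesis by (simp only: ordered_prod_eq_lprod sorted_list_of_set_Icc)
    qed
    finally have "\<phi> (\<one> \<otimes> lprod A (map z ps)) = 0"
    proof (subst l_one)
      have "z p \<in> carrier A" if "p \<in> set ps" for p
        using z[OF that] sub[of "fst p"] unfolding unital_subalgebra_def by blast
      then show "lprod A (map z ps) \<in> carrier A" by (intro lprod_closed) auto
    qed
    moreover have "\<phi> (\<one> \<otimes> lprod A (map z ps)) =
        (\<Sum>(r, k)\<leftarrow>splits ps. (- 1) ^ length r * (\<Prod>p\<leftarrow>r. F (snd p)) * \<phi> (\<one> \<otimes> lprod A (map ?y k)))"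
      unfolding z_def using y[OF c] by (intro state_prod_centred) auto
    moreover have "\<dots> = (\<Sum>(r, k)\<leftarrow>splits ps. (- 1) ^ length r * (\<Prod>p\<leftarrow>r. F (snd p)) * coloured_moment x k)"
    proof (intro arg_cong[of _ _ sum_list] map_cong[OF refl])
      fix q assume "q \<in> set (splits ps)"
      moreover obtain r k where q: "q = (r, k)" by (cases q)
      ultimately have "set k \<subseteq> set ps" using splits_set[of r k ps] by auto
      then have "lprod A (map ?y k) \<in> carrier A" using y[OF c] by (intro lprod_closed) auto
      then show "(case q of (r, k) \<Rightarrow> (- 1) ^ length r * (\<Prod>p\<leftarrow>r. F (snd p)) * \<phi> (\<one> \<otimes> lprod A (map ?y k)))
          = (case q of (r, k) \<Rightarrow> (- 1) ^ length r * (\<Prod>p\<leftarrow>r. F (snd p)) * coloured_moment x k)"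
        by (simp add: q coloured_moment_def)
    qed
    ultimately show "(\<Sum>(r, k)\<leftarrow>splits ps. (- 1) ^ length r * (\<Prod>p\<leftarrow>r. F (snd p)) * coloured_moment x k) = 0"
      by simp
  qed
qed

end

lemma tensor_state_lprod:
  assumes T: "spatial_tensor_product A C T \<tau>" "tensor_state A \<phi> C \<psi> T \<tau> \<eta>"
    and AC: "cstar_prob_space A \<phi>" "cstar_prob_space C \<psi>"
    and a: "\<And>i. a i \<in> carrier A" and p: "\<And>i. p i \<in> carrier C"
  shows "\<eta> (lprod T (map (\<lambda>i. \<tau> (a i) (p i)) u)) = \<phi> (lprod A (map a u)) * \<psi> (lprod C (map p u))"
proof -
  interpret A: cstar_prob_space A \<phi> by fact
  interpret C: cstar_prob_space C \<psi> by fact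
  have A: "lprod A (map a u) \<in> carrier A" for u
    using a by (intro A.lprod_closed) auto
  have C: "lprod C (map p u) \<in> carrier C" for u
    using p by (intro C.lprod_closed) auto
  have "lprod T (map (\<lambda>i. \<tau> (a i) (p i)) u) = \<tau> (lprod A (map a u)) (lprod C (map p u))"
  proof (induction u)
    case Nil
    then show ?case using T(1) by (simp add: spatial_tensor_product_def)
  next
    case (Cons i u)
    then show ?case using T(1) a p A[of u] C[of u] by (simp add: spatial_tensor_product_def)
  qed
  then show ?thesis using T(2) A C by (simp add: tensor_state_def)
qed

section \<open>Free ultrafilters\<close>

text \<open>A proper filter that is minimal below the filter of the cofinite sets, found by Zorn's lemma, is
  an ultrafilter, since it cannot be refined by any set.\<close>

lemma free_ultrafilter_exists: "\<exists>\<omega>. free_ultrafilter \<omega> \<and> \<omega> \<le> sequentially"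
proof -
  let ?A = "{F :: nat filter. F \<noteq> bot \<and> F \<le> sequentially}"
  have "\<exists>m\<in>?A. \<forall>F\<in>?A. F \<le> m \<longrightarrow> F = m"
  proof (rule predicate_Zorn[of ?A "\<lambda>F G. G \<le> F"])
    show "partial_order_on ?A (relation_of (\<lambda>F G. G \<le> F) ?A)"
      by (rule partial_order_on_relation_ofI) auto
  next
    fix C assume C: "C \<in> Chains (relation_of (\<lambda>F G. G \<le> F) ?A)"
    then have CA: "C \<subseteq> ?A" by (auto simp: Chains_def relation_of_def)
    have lin: "F \<le> G \<or> G \<le> F" if "F \<in> C" "G \<in> C" for F G
      using C that by (auto simp: Chains_def relation_of_def)
    show "\<exists>u\<in>?A. \<forall>F\<in>C. u \<le> F"
    proof (cases "C = {}")
      case True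
      then show ?thesis by (intro bexI[of _ sequentially]) auto
    next
      case False
      have base: "\<exists>H\<in>C. H \<le> inf F G" if "F \<in> C" "G \<in> C" for F G
        using lin[OF that] that by (metis inf.absorb1 inf.absorb2 order_refl)
      have "\<not> eventually (\<lambda>_. False) (Inf C)"
        using CA eventually_Inf_base[OF False base] by (auto simp: trivial_limit_def)
      then have "Inf C \<noteq> bot" by (simp add: trivial_limit_def)
      moreover obtain F where "F \<in> C" using False by blast
      then have "Inf C \<le> sequentially" using CA Inf_lower[of F C] by auto
      ultimately show ?thesis by (intro bexI[of _ "Inf C"]) (auto intro: Inf_lower)
    qed
  qed
  then obtain \<omega> where \<omega>: "\<omega> \<noteq> bot" "\<omega> \<le> sequentially" and max: "\<And>F. F \<noteq> bot \<Longrightarrow> F \<le> \<omega> \<Longrightarrow> F = \<omega>"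
    by (auto intro: order_trans)
  have "eventually P \<omega> \<or> eventually (\<lambda>N. \<not> P N) \<omega>" for P
  proof (rule disjCI)
    assume neg: "\<not> eventually (\<lambda>N. \<not> P N) \<omega>"
    let ?F = "inf \<omega> (principal {N. P N})"
    have "?F \<noteq> bot" using neg by (simp add: trivial_limit_def eventually_inf_principal)
    then have "?F = \<omega>" by (rule max) simp
    moreover have "eventually P ?F" by (simp add: eventually_inf_principal)
    ultimately show "eventually P \<omega>" by simp
  qed
  moreover have "\<not> eventually (\<lambda>N. N \<in> S) \<omega>" if "finite S" for S
  proof
    assume "eventually (\<lambda>N. N \<in> S) \<omega>"
    moreover have "eventually (\<lambda>N. N \<notin> S) \<omega>"
    proof (rule filter_leD[OF \<omega>(2)])
      show "eventually (\<lambda>N. N \<notin> S) sequentially"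
        using that by (simp flip: cofinite_eq_sequentially add: eventually_cofinite)
    qed
    ultimately have "eventually (\<lambda>_. False) \<omega>" by eventually_elim simp
    then show False using \<omega>(1) by (simp add: trivial_limit_def)
  qed
  ultimately show ?thesis using \<omega> unfolding free_ultrafilter_def by blast
qed

text \<open>By compactness of the disc the image filter has a cluster point, and an ultrafilter converges to
  each of its cluster points.\<close>

lemma bounded_converges_ultrafilter:
  fixes x :: "nat \<Rightarrow> complex"
  assumes \<omega>: "free_ultrafilter \<omega>" and bd: "eventually (\<lambda>N. cmod (x N) \<le> c) \<omega>"
  shows "\<exists>L. (x \<longlongrightarrow> L) \<omega> \<and> cmod L \<le> c"
proof -
  have "filtermap x \<omega> \<noteq> bot" using \<omega> by (simp add: free_ultrafilter_def filtermap_bot_iff)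
  moreover have "eventually (\<lambda>z. z \<in> cball 0 c) (filtermap x \<omega>)"
    using bd by (simp add: eventually_filtermap)
  ultimately obtain L where L: "L \<in> cball 0 c" "inf (nhds L) (filtermap x \<omega>) \<noteq> bot"
    using compact_cball[of "0 :: complex" c] unfolding compact_filter by blast
  have "(x \<longlongrightarrow> L) \<omega>"
    unfolding filterlim_def
  proof (rule filter_leI)
    fix P assume P: "eventually P (nhds L)"
    show "eventually P (filtermap x \<omega>)"
    proof (rule ccontr)
      assume "\<not> eventually P (filtermap x \<omega>)"
      then have "eventually (\<lambda>N. \<not> P (x N)) \<omega>"
        using \<omega> by (auto simp: free_ultrafilter_def eventually_filtermap)
      then have "eventually (\<lambda>z. \<not> P z) (filtermap x \<omega>)" by (simp add: eventually_filtermap)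
      with P have "eventually (\<lambda>_. False) (inf (nhds L) (filtermap x \<omega>))"
        unfolding eventually_inf by blast
      then show False using L(2) by (simp add: trivial_limit_def)
    qed
  qed
  then show ?thesis using L(1) by auto
qed

section \<open>Operators on a complex Hilbert space as a C*-algebra\<close>

text \<open>A complex Hilbert space as a real one with a skew-adjoint multiplication \<open>J\<close> by the imaginary unit.
  For operators that commute with \<open>J\<close>, adjoints with respect to the real and to the complex inner
  product agree, so the norm and the completeness of the real bounded operators can be used as they
  stand.\<close>

locale complex_hilbert =
  fixes J :: "'h::{real_inner, banach} \<Rightarrow>\<^sub>L 'h"
  assumes J_J: "blinfun_apply J (blinfun_apply J x) = - x"
    and J_skew: "inner (blinfun_apply J x) y = - inner x (blinfun_apply J y)"
begin

definition adjoint_pair :: "('h \<Rightarrow>\<^sub>L 'h) \<Rightarrow> ('h \<Rightarrow>\<^sub>L 'h) \<Rightarrow> bool" where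
  "adjoint_pair S T \<longleftrightarrow> (\<forall>x y. inner (S x) y = inner x (T y))"

definition clinear_op :: "('h \<Rightarrow>\<^sub>L 'h) \<Rightarrow> bool" where
  "clinear_op T \<longleftrightarrow> (\<forall>x. T (J x) = J (T x))"

text \<open>Possession of an adjoint is part of membership. It is preserved under norm limits, because
  taking adjoints is isometric.\<close>

definition operators :: "('h \<Rightarrow>\<^sub>L 'h) cstar_algebra" where
  "operators = \<lparr>carrier = {T. clinear_op T \<and> (\<exists>S. adjoint_pair S T)},
     mult = (\<lambda>S T. S o\<^sub>L T), one = id_blinfun, zero = 0, add = (+),
     scale = (\<lambda>c T. Re c *\<^sub>R T + Im c *\<^sub>R (J o\<^sub>L T)),
     adj = (\<lambda>T. THE S. adjoint_pair S T), nrm = norm\<rparr>"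

lemma adjoint_pair_unique:
  assumes "adjoint_pair S T" "adjoint_pair S' T"
  shows "S = S'"
proof (rule blinfun_eqI)
  fix x
  have "inner (S x - S' x) y = 0" for y
    using assms by (simp add: adjoint_pair_def inner_diff_left)
  from this[of "S x - S' x"] show "S x = S' x" by simp
qed

lemma adjoint_pair_sym: "adjoint_pair S T \<Longrightarrow> adjoint_pair T S"
  unfolding adjoint_pair_def by (metis inner_commute)

lemma adj_eq: "adjoint_pair S T \<Longrightarrow> adj operators T = S"
  unfolding operators_def by simp (metis adjoint_pair_unique the_equality)

lemma clinear_adjoint:
  assumes "clinear_op T" "adjoint_pair S T"
  shows "clinear_op S"
  unfolding clinear_op_def
proof
  fix x
  have "inner (S (J x) - J (S x)) y = 0" for y
    using assms J_skew by (simp add: adjoint_pair_def clinear_op_def inner_diff_left)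
  from this[of "S (J x) - J (S x)"] show "S (J x) = J (S x)" by simp
qed

lemma carrierE:
  assumes "T \<in> carrier operators"
  obtains S where "clinear_op T" "clinear_op S" "adjoint_pair S T" "adj operators T = S" "adjoint_pair T S"
proof -
  from assms obtain S where S: "clinear_op T" "adjoint_pair S T" by (auto simp: operators_def)
  show ?thesis
    by (rule that[OF S(1) clinear_adjoint[OF S] S(2) adj_eq[OF S(2)] adjoint_pair_sym[OF S(2)]])
qed

lemma carrierI: "\<lbrakk>clinear_op T; adjoint_pair S T\<rbrakk> \<Longrightarrow> T \<in> carrier operators"
  by (auto simp: operators_def)

lemma adjoint_pair_add: "\<lbrakk>adjoint_pair S T; adjoint_pair S' T'\<rbrakk> \<Longrightarrow> adjoint_pair (S + S') (T + T')"
  by (simp add: adjoint_pair_def blinfun.add_left inner_add_left inner_add_right)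

lemma adjoint_pair_compose: "\<lbrakk>adjoint_pair S T; adjoint_pair S' T'\<rbrakk> \<Longrightarrow> adjoint_pair (S' o\<^sub>L S) (T o\<^sub>L T')"
  by (simp add: adjoint_pair_def)

lemma adjoint_pair_scale:
  assumes "adjoint_pair S T" "clinear_op T"
  shows "adjoint_pair (Re c *\<^sub>R S + (- Im c) *\<^sub>R (J o\<^sub>L S)) (Re c *\<^sub>R T + Im c *\<^sub>R (J o\<^sub>L T))"
  using assms clinear_adjoint[OF assms(2,1)]
  by (simp add: adjoint_pair_def clinear_op_def blinfun.add_left blinfun.scaleR_left blinfun.minus_left
      inner_add_left inner_add_right inner_diff_left J_skew blinfun.bilinear_simps)

lemma norm_J: "norm (J x) = norm x"
proof -
  have "inner (J x) (J x) = inner x x" by (simp add: J_skew J_J)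
  then show ?thesis by (simp add: norm_eq_sqrt_inner)
qed

lemma norm_sq_le_compose:
  assumes "adjoint_pair S T"
  shows "norm T * norm T \<le> norm (S o\<^sub>L T)"
proof -
  have "norm (T x) \<le> sqrt (norm (S o\<^sub>L T)) * norm x" for x
  proof -
    have "(norm (T x))\<^sup>2 = inner (S (T x)) x"
      using assms by (metis adjoint_pair_def adjoint_pair_sym inner_commute power2_norm_eq_inner)
    also have "\<dots> \<le> norm ((S o\<^sub>L T) x) * norm x" using norm_cauchy_schwarz[of "S (T x)" x] by simp
    also have "\<dots> \<le> (norm (S o\<^sub>L T) * norm x) * norm x"
      by (intro mult_right_mono norm_blinfun) simp
    also have "\<dots> = (sqrt (norm (S o\<^sub>L T)) * norm x)\<^sup>2"
      by (simp add: power_mult_distrib) (simp add: power2_eq_square)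
    finally show ?thesis by (rule power2_le_imp_le) simp
  qed
  then have "norm T \<le> sqrt (norm (S o\<^sub>L T))" by (intro norm_blinfun_bound) auto
  then have "(norm T)\<^sup>2 \<le> norm (S o\<^sub>L T)" by (metis norm_ge_zero real_sqrt_pow2 power_mono)
  then show ?thesis by (simp add: power2_eq_square)
qed

lemma norm_adjoint:
  assumes "adjoint_pair S T"
  shows "norm S = norm T"
proof -
  have *: "norm T \<le> norm S" if "adjoint_pair S T" for S T
  proof (cases "norm T = 0")
    case False
    have "norm T * norm T \<le> norm S * norm T"
      using norm_sq_le_compose[OF that] norm_blinfun_compose[of S T] by linarith
    then show ?thesis using False by (simp add: mult_le_cancel_right)
  qed auto
  show ?thesis using *[OF assms] *[OF adjoint_pair_sym[OF assms]] by simp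
qed

lemma norm_scale: "norm (Re c *\<^sub>R T + Im c *\<^sub>R (J o\<^sub>L T)) = cmod c * norm T"
proof -
  have pt: "norm ((Re c *\<^sub>R T + Im c *\<^sub>R (J o\<^sub>L T)) x) = cmod c * norm (T x)" for x
  proof -
    have o: "inner y (J y) = 0" for y using J_skew[of y y] inner_commute[of y "J y"] by simp
    have "(norm (Re c *\<^sub>R y + Im c *\<^sub>R J y))\<^sup>2 = (cmod c * norm y)\<^sup>2" for y
    proof -
      have "(norm (Re c *\<^sub>R y + Im c *\<^sub>R J y))\<^sup>2 = (Re c)\<^sup>2 * (norm y)\<^sup>2 + (Im c)\<^sup>2 * (norm (J y))\<^sup>2"
        using o[of y] inner_commute[of y "J y"]
        by (simp add: power2_norm_eq_inner inner_add_left inner_add_right) (simp add: power2_eq_square)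
      then show ?thesis by (simp add: norm_J power_mult_distrib cmod_power2 algebra_simps)
    qed
    then have "norm (Re c *\<^sub>R T x + Im c *\<^sub>R J (T x)) = cmod c * norm (T x)"
      by (simp add: power2_eq_iff_nonneg)
    then show ?thesis by (simp add: blinfun.bilinear_simps)
  qed
  show ?thesis
  proof (rule antisym)
    show "norm (Re c *\<^sub>R T + Im c *\<^sub>R (J o\<^sub>L T)) \<le> cmod c * norm T"
      unfolding pt[abs_def]
      by (rule norm_blinfun_bound) (auto simp only: pt mult.assoc intro!: mult_left_mono norm_blinfun mult_nonneg_nonneg norm_ge_zero)
    show "cmod c * norm T \<le> norm (Re c *\<^sub>R T + Im c *\<^sub>R (J o\<^sub>L T))"
    proof (cases "c = 0")
      case False
      let ?M = "norm (Re c *\<^sub>R T + Im c *\<^sub>R (J o\<^sub>L T))"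
      have "norm (T x) \<le> (?M / cmod c) * norm x" for x
        using norm_blinfun[of "Re c *\<^sub>R T + Im c *\<^sub>R (J o\<^sub>L T)" x] False
        unfolding pt by (simp add: field_simps)
      then have "norm T \<le> ?M / cmod c" by (intro norm_blinfun_bound) auto
      then show ?thesis using False by (simp add: field_simps)
    qed simp
  qed
qed

lemma operators_simps [simp]:
  "mult operators S T = S o\<^sub>L T" "one operators = id_blinfun" "zero operators = 0"
  "add operators S T = S + T" "scale operators c T = Re c *\<^sub>R T + Im c *\<^sub>R (J o\<^sub>L T)"
  "nrm operators T = norm T"
  by (simp_all add: operators_def)

lemma clinear_op_simps:
  "\<lbrakk>clinear_op S; clinear_op T\<rbrakk> \<Longrightarrow> clinear_op (S + T)"
  "\<lbrakk>clinear_op S; clinear_op T\<rbrakk> \<Longrightarrow> clinear_op (S o\<^sub>L T)"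
  "clinear_op T \<Longrightarrow> clinear_op (r *\<^sub>R T)"
  "clinear_op J"
  by (auto simp: clinear_op_def blinfun.bilinear_simps)

lemma add_closed: "\<lbrakk>S \<in> carrier operators; T \<in> carrier operators\<rbrakk> \<Longrightarrow> S + T \<in> carrier operators"
  by (elim carrierE) (rule carrierI[OF clinear_op_simps(1) adjoint_pair_add])

lemma compose_closed: "\<lbrakk>S \<in> carrier operators; T \<in> carrier operators\<rbrakk> \<Longrightarrow> S o\<^sub>L T \<in> carrier operators"
  by (elim carrierE) (rule carrierI[OF clinear_op_simps(2) adjoint_pair_compose])

lemma scale_closed: "T \<in> carrier operators \<Longrightarrow> Re c *\<^sub>R T + Im c *\<^sub>R (J o\<^sub>L T) \<in> carrier operators"
  by (elim carrierE) (auto intro!: carrierI[OF _ adjoint_pair_scale] clinear_op_simps)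

lemma ring_operators: "ring operators"
proof -
  have id: "id_blinfun \<in> carrier operators"
    by (rule carrierI[of _ id_blinfun]) (auto simp: clinear_op_def adjoint_pair_def)
  have zero: "0 \<in> carrier operators"
    by (rule carrierI[of _ 0]) (auto simp: clinear_op_def adjoint_pair_def blinfun.bilinear_simps)
  have uminus: "- T \<in> carrier operators" if "T \<in> carrier operators" for T
    using scale_closed[OF that, of "-1"] by simp
  show ?thesis
  proof (rule ringI)
    show "abelian_group operators"
      by (rule abelian_groupI) (auto simp: add_closed zero intro: bexI[OF _ uminus])
    show "monoid operators"
      by (rule monoidI) (auto simp: compose_closed id blinfun_eqI intro!: blinfun_eqI)
  qed (auto intro!: blinfun_eqI simp: blinfun.bilinear_simps)
qed

theorem unital_cstar_algebra_operators: "unital_cstar_algebra operators"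
proof -
  interpret ring operators by (rule ring_operators)
  have minus: "S \<ominus>\<^bsub>operators\<^esub> T = S - T" if "T \<in> carrier operators" "S \<in> carrier operators" for S T
  proof -
    have m: "- T \<in> carrier operators" using scale_closed[OF that(1), of "-1"] by simp
    then have "\<ominus>\<^bsub>operators\<^esub> T = - T"
      using that minus_equality[of "- T" T] by simp
    then show ?thesis by (simp add: a_minus_def)
  qed
  show ?thesis
  proof (unfold_locales, goal_cases)
    case (1 x c)
    then show ?case using scale_closed by simp
  next
    case (2 x y c)
    show ?case by (auto intro!: blinfun_eqI simp: blinfun.bilinear_simps algebra_simps)
  next
    case (3 x c d)
    show ?case by (auto intro!: blinfun_eqI simp: blinfun.bilinear_simps algebra_simps)
  next
    case (4 x c d)
    show ?case by (auto intro!: blinfun_eqI simp: blinfun.bilinear_simps J_J algebra_simps)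
  next
    case (5 x)
    show ?case by simp
  next
    case (6 x y c)
    show ?case by (auto intro!: blinfun_eqI simp: blinfun.bilinear_simps)
  next
    case (7 x y c)
    then show ?case
      by (auto intro!: blinfun_eqI elim!: carrierE simp: blinfun.bilinear_simps clinear_op_def)
  next
    case (8 x)
    then show ?case by (elim carrierE) (auto intro: carrierI)
  next
    case (9 x y)
    then show ?case by (elim carrierE) (simp add: adj_eq adjoint_pair_add)
  next
    case (10 x c)
    then show ?case
      by (elim carrierE) (use adj_eq[OF adjoint_pair_scale] in \<open>auto simp: \<close>)
  next
    case (11 x y)
    then show ?case by (elim carrierE) (simp add: adj_eq adjoint_pair_compose)
  next
    case (12 x)
    then show ?case by (elim carrierE) (simp add: adj_eq)
  next
    case (13 x)
    show ?case by simp
  next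
    case (14 x y)
    show ?case by (simp add: norm_triangle_ineq)
  next
    case (15 x c)
    show ?case by (simp add: norm_scale)
  next
    case (16 x y)
    show ?case by (simp add: norm_blinfun_compose)
  next
    case (17 x)
    then show ?case
    proof (elim carrierE)
      fix S assume S: "adjoint_pair S x" "adj operators x = S"
      have "norm (S o\<^sub>L x) \<le> norm x * norm x"
        using norm_blinfun_compose[of S x] norm_adjoint[OF S(1)] by simp
      then show ?thesis using norm_sq_le_compose[OF S(1)] S(2) by (simp add: power2_eq_square)
    qed
  next
    case (18 X)
    have "Cauchy X"
      unfolding Cauchy_def dist_norm using 18 minus by simp
    then obtain T where T: "X \<longlonglongrightarrow> T" by (auto simp: Cauchy_convergent_iff convergent_def)
    define Y where "Y n = adj operators (X n)" for n
    have Y: "adjoint_pair (Y n) (X n)" "clinear_op (X n)" for n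
      using 18(1)[of n] unfolding Y_def by (auto elim!: carrierE)
    have "adjoint_pair (Y m - Y n) (X m - X n)" for m n
      using Y unfolding adjoint_pair_def by (simp add: blinfun.bilinear_simps inner_diff_left inner_diff_right)
    then have "norm (Y m - Y n) = norm (X m - X n)" for m n by (rule norm_adjoint)
    then have "Cauchy Y" using \<open>Cauchy X\<close> unfolding Cauchy_def dist_norm by simp
    then obtain S where S: "Y \<longlonglongrightarrow> S" by (auto simp: Cauchy_convergent_iff convergent_def)
    have apply_lim: "(\<lambda>n. blinfun_apply (Z n) x) \<longlonglongrightarrow> blinfun_apply U x" if "Z \<longlonglongrightarrow> U" for Z :: "nat \<Rightarrow> 'h \<Rightarrow>\<^sub>L 'h" and U x
      using that by (intro tendsto_intros)
    have "adjoint_pair S T"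
      unfolding adjoint_pair_def
    proof (intro allI)
      fix x y
      have "(\<lambda>n. inner (Y n x) y) \<longlonglongrightarrow> inner (S x) y" "(\<lambda>n. inner x (X n y)) \<longlonglongrightarrow> inner x (T y)"
        by (intro tendsto_inner tendsto_const apply_lim S T)+
      then show "inner (S x) y = inner x (T y)"
        using Y(1) unfolding adjoint_pair_def by (auto intro: LIMSEQ_unique)
    qed
    moreover have "clinear_op T"
      unfolding clinear_op_def
    proof
      fix x
      have "(\<lambda>n. X n (J x)) \<longlonglongrightarrow> T (J x)" by (rule apply_lim[OF T])
      moreover have "(\<lambda>n. J (X n x)) \<longlonglongrightarrow> J (T x)"
        by (intro blinfun.tendsto tendsto_const apply_lim T)
      ultimately show "T (J x) = J (T x)"
        using Y(2) unfolding clinear_op_def by (auto intro: LIMSEQ_unique)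
    qed
    ultimately have TC: "T \<in> carrier operators" by (intro carrierI)
    have "(\<lambda>n. norm (X n - T)) \<longlonglongrightarrow> 0" using T by (simp add: LIM_zero tendsto_norm_zero)
    then show ?case using TC 18(1) minus[OF TC] by (intro bexI[of _ T]) simp_all
  qed
qed

text \<open>The two entries are the real and the imaginary part of the complex inner product of \<open>v\<close> and \<open>T v\<close>.\<close>

definition vector_state :: "'h \<Rightarrow> ('h \<Rightarrow>\<^sub>L 'h) \<Rightarrow> complex" where
  "vector_state v T = Complex (inner v (T v)) (inner (J v) (T v))"

theorem cstar_prob_space_vector_state:
  assumes v: "norm v = 1"
  shows "cstar_prob_space operators (vector_state v)"
proof -
  interpret unital_cstar_algebra operators by (rule unital_cstar_algebra_operators)
  have o: "inner (J y) y = 0" for y using J_skew[of y y] inner_commute[of y "J y"] by simp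
  show ?thesis
  proof (unfold_locales, goal_cases)
    case (1 x y)
    show ?case by (simp add: vector_state_def blinfun.bilinear_simps inner_add_right complex_eq_iff)
  next
    case (2 x c)
    show ?case
      by (simp add: vector_state_def blinfun.bilinear_simps inner_add_right complex_eq_iff J_skew J_J)
  next
    case (3 x)
    then show ?case
    proof (elim carrierE)
      fix S assume S: "clinear_op x" "adj operators x = S" "adjoint_pair x S"
      have "inner v (S (x v)) = inner (x v) (x v)" "inner (J v) (S (x v)) = inner (J (x v)) (x v)"
      proof -
        have "inner a (S b) = inner (x a) b" for a b using S(3) by (simp add: adjoint_pair_def)
        moreover have "x (J v) = J (x v)" using S(1) by (simp add: clinear_op_def)
        ultimately show "inner v (S (x v)) = inner (x v) (x v)" "inner (J v) (S (x v)) = inner (J (x v)) (x v)"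
          by simp_all
      qed
      then show ?thesis using S(2) o by (simp add: vector_state_def complex_nonneg_Reals_iff)
    qed
  next
    case 4
    show ?case using v o by (simp add: vector_state_def complex_eq_iff norm_eq_sqrt_inner)
  qed
qed

end

subsection \<open>Transport of structure\<close>

text \<open>Moves the structure from operators to the type that the theorem prescribes for the carrier.\<close>

definition transport_cstar :: "('a \<Rightarrow> 'b) \<Rightarrow> ('b \<Rightarrow> 'a) \<Rightarrow> 'a cstar_algebra \<Rightarrow> 'b cstar_algebra" where
  "transport_cstar f g A = \<lparr>carrier = f ` carrier A,
     mult = (\<lambda>x y. f (mult A (g x) (g y))), one = f (one A), zero = f (zero A),
     add = (\<lambda>x y. f (add A (g x) (g y))), scale = (\<lambda>c x. f (scale A c (g x))),
     adj = (\<lambda>x. f (adj A (g x))), nrm = (\<lambda>x. nrm A (g x))\<rparr>"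

lemma transport_cstar_prob_space:
  assumes A: "cstar_prob_space A \<phi>" and gf: "\<And>x. g (f x) = x"
  shows "cstar_prob_space (transport_cstar f g A) (\<lambda>x. \<phi> (g x))"
proof -
  interpret A: cstar_prob_space A \<phi> by fact
  let ?B = "transport_cstar f g A"
  have sel: "carrier ?B = f ` carrier A" "mult ?B x y = f (mult A (g x) (g y))" "one ?B = f (one A)"
    "zero ?B = f (zero A)" "add ?B x y = f (add A (g x) (g y))" "scale ?B c x = f (scale A c (g x))"
    "adj ?B x = f (adj A (g x))" "nrm ?B x = nrm A (g x)" for x y c
    by (simp_all add: transport_cstar_def)
  have ring: "ring ?B"
  proof (rule ringI)
    show "abelian_group ?B"
    proof (rule abelian_groupI)
      fix x assume "x \<in> carrier ?B"
      then show "\<exists>y\<in>carrier ?B. y \<oplus>\<^bsub>?B\<^esub> x = \<zero>\<^bsub>?B\<^esub>"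
        by (intro bexI[of _ "f (\<ominus>\<^bsub>A\<^esub> g x)"]) (auto simp: sel gf A.l_neg)
    qed (auto simp: sel gf A.a_ac)
    show "monoid ?B"
      by (rule monoidI) (auto simp: sel gf A.m_assoc)
  qed (auto simp: sel gf A.l_distr A.r_distr)
  interpret B: ring ?B by fact
  have minus: "x \<ominus>\<^bsub>?B\<^esub> y = f (g x \<ominus>\<^bsub>A\<^esub> g y)" if "x \<in> carrier ?B" "y \<in> carrier ?B" for x y
  proof -
    have "\<ominus>\<^bsub>?B\<^esub> y = f (\<ominus>\<^bsub>A\<^esub> g y)"
      using that by (intro B.minus_equality) (auto simp: sel gf A.l_neg)
    then show ?thesis by (simp add: a_minus_def sel gf)
  qed
  show ?thesis
  proof (unfold_locales, goal_cases)
    case (18 X)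
    have gX: "g (X n) \<in> carrier A" for n using 18(1)[of n] by (auto simp: sel gf)
    have "\<exists>x\<in>carrier A. (\<lambda>n. nrm A (g (X n) \<ominus>\<^bsub>A\<^esub> x)) \<longlonglongrightarrow> 0"
      using 18(2) by (intro A.complete gX) (simp add: minus[OF 18(1) 18(1)] sel gf)
    then obtain x where x: "x \<in> carrier A" "(\<lambda>n. nrm A (g (X n) \<ominus>\<^bsub>A\<^esub> x)) \<longlonglongrightarrow> 0" by blast
    then have fx: "f x \<in> carrier ?B" by (simp add: sel)
    show ?case using x by (intro bexI[OF _ fx]) (simp add: minus[OF 18(1) fx] sel gf)
  qed (auto simp: sel gf A.scale_closed A.scale_right_distrib A.scale_left_distrib A.scale_scale A.scale_one
      A.mult_scale_left A.mult_scale_right A.adj_closed A.adj_add A.adj_scale A.adj_mult A.adj_adj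
      A.nrm_eq_zero_iff A.nrm_triangle A.nrm_scale A.nrm_mult A.cstar_identity A.state_add A.state_scale
      A.state_positive A.state_one dest: arg_cong[of _ _ g])
qed

lemma transport_lprod:
  assumes gf: "\<And>x. g (f x) = x"
  shows "lprod (transport_cstar f g A) (map (\<lambda>x. f (h x)) xs) = f (lprod A (map h xs))"
  by (induction xs) (simp_all add: transport_cstar_def gf)

section \<open>The Hilbert space of square-summable complex sequences\<close>

typedef l2 = "{f :: nat \<Rightarrow> complex. summable (\<lambda>n. (cmod (f n))\<^sup>2)}"
  morphisms coord Abs_l2
  by (rule exI[of _ "\<lambda>_. 0"]) simp

setup_lifting type_definition_l2

lemma summable_coord: "summable (\<lambda>n. (cmod (coord f n))\<^sup>2)"
  using coord[of f] by simp

lemma summable_inner_sequences: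
  fixes f g :: "nat \<Rightarrow> complex"
  assumes "summable (\<lambda>n. (cmod (f n))\<^sup>2)" "summable (\<lambda>n. (cmod (g n))\<^sup>2)"
  shows "summable (\<lambda>n. inner (f n) (g n))"
proof (rule summable_comparison_test')
  show "summable (\<lambda>n. (cmod (f n))\<^sup>2 + (cmod (g n))\<^sup>2)" using assms by (rule summable_add)
  fix n
  have "norm (inner (f n) (g n)) \<le> cmod (f n) * cmod (g n)"
    by (simp add: Cauchy_Schwarz_ineq2)
  also have "\<dots> \<le> (cmod (f n))\<^sup>2 + (cmod (g n))\<^sup>2"
  proof -
    have "0 \<le> cmod (f n) * cmod (g n)" by simp
    moreover have "2 * (cmod (f n) * cmod (g n)) \<le> (cmod (f n))\<^sup>2 + (cmod (g n))\<^sup>2"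
      using sum_squares_bound[of "cmod (f n)" "cmod (g n)"] by (simp add: mult.assoc)
    ultimately show ?thesis by linarith
  qed
  finally show "norm (inner (f n) (g n)) \<le> (cmod (f n))\<^sup>2 + (cmod (g n))\<^sup>2" .
qed

lemma summable_square_add:
  fixes f g :: "nat \<Rightarrow> complex"
  assumes "summable (\<lambda>n. (cmod (f n))\<^sup>2)" "summable (\<lambda>n. (cmod (g n))\<^sup>2)"
  shows "summable (\<lambda>n. (cmod (f n + g n))\<^sup>2)"
proof -
  have "(cmod (f n + g n))\<^sup>2 = (cmod (f n))\<^sup>2 + 2 * inner (f n) (g n) + (cmod (g n))\<^sup>2" for n
    by (simp add: power2_norm_eq_inner inner_add_left inner_add_right inner_commute)
  then show ?thesis
    using assms summable_inner_sequences[OF assms] by (auto intro!: summable_add summable_mult)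
qed

lemma summable_square_scale:
  fixes f :: "nat \<Rightarrow> complex"
  assumes "summable (\<lambda>n. (cmod (f n))\<^sup>2)"
  shows "summable (\<lambda>n. (cmod (c * f n))\<^sup>2)"
  using summable_mult[OF assms, of "(cmod c)\<^sup>2"] by (simp add: norm_mult power_mult_distrib)

instantiation l2 :: real_inner
begin

lift_definition zero_l2 :: l2 is "\<lambda>_. 0" by simp
lift_definition plus_l2 :: "l2 \<Rightarrow> l2 \<Rightarrow> l2" is "\<lambda>f g n. f n + g n" by (rule summable_square_add)
lift_definition uminus_l2 :: "l2 \<Rightarrow> l2" is "\<lambda>f n. - f n" by simp
lift_definition minus_l2 :: "l2 \<Rightarrow> l2 \<Rightarrow> l2" is "\<lambda>f g n. f n - g n"
  by (drule summable_square_add[where g = "\<lambda>n. - _ n"]) simp_all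
lift_definition scaleR_l2 :: "real \<Rightarrow> l2 \<Rightarrow> l2" is "\<lambda>r f n. r *\<^sub>R f n"
  unfolding scaleR_conv_of_real by (rule summable_square_scale)

definition inner_l2 :: "l2 \<Rightarrow> l2 \<Rightarrow> real" where
  "inner_l2 f g = (\<Sum>n. inner (coord f n) (coord g n))"
definition norm_l2 :: "l2 \<Rightarrow> real" where "norm_l2 f = sqrt (inner f f)"
definition dist_l2 :: "l2 \<Rightarrow> l2 \<Rightarrow> real" where "dist_l2 f g = norm (f - g)"
definition sgn_l2 :: "l2 \<Rightarrow> l2" where "sgn_l2 f = inverse (norm f) *\<^sub>R f"
definition uniformity_l2 :: "(l2 \<times> l2) filter" where
  "uniformity_l2 = (INF e\<in>{0 <..}. principal {(x, y). dist x y < e})"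
definition open_l2 :: "l2 set \<Rightarrow> bool" where
  "open_l2 S = (\<forall>x\<in>S. \<forall>\<^sub>F (x', y) in uniformity. x' = x \<longrightarrow> y \<in> S)"

instance
proof
  fix x y z :: l2 and r s :: real
  have sm: "summable (\<lambda>n. inner (coord x n) (coord y n))" for x y
    by (intro summable_inner_sequences summable_coord)
  show "x + y + z = x + (y + z)" "x + y = y + x" "0 + x = x" "- x + x = 0" "x - y = x + - y"
    "r *\<^sub>R (x + y) = r *\<^sub>R x + r *\<^sub>R y" "(r + s) *\<^sub>R x = r *\<^sub>R x + s *\<^sub>R x"
    "r *\<^sub>R s *\<^sub>R x = (r * s) *\<^sub>R x" "1 *\<^sub>R x = x"
    by (transfer; simp add: algebra_simps)+
  show "dist x y = norm (x - y)" by (rule dist_l2_def)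
  show "sgn x = inverse (norm x) *\<^sub>R x" by (rule sgn_l2_def)
  show "uniformity = (INF e\<in>{0 <..}. principal {(x, y :: l2). dist x y < e})"
    by (rule uniformity_l2_def)
  show "open U = (\<forall>x\<in>U. \<forall>\<^sub>F (x', y) in uniformity. x' = x \<longrightarrow> y \<in> U)" for U :: "l2 set"
    by (rule open_l2_def)
  show "inner x y = inner y x" by (simp add: inner_l2_def inner_commute)
  show "inner (x + y) z = inner x z + inner y z"
    unfolding inner_l2_def suminf_add[OF sm sm] by (simp add: plus_l2.rep_eq inner_add_left)
  show "inner (r *\<^sub>R x) y = r * inner x y"
    unfolding inner_l2_def suminf_mult[OF sm, symmetric] by (simp add: scaleR_l2.rep_eq)
  show "0 \<le> inner x x" unfolding inner_l2_def by (rule suminf_nonneg[OF sm]) simp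
  show "inner x x = 0 \<longleftrightarrow> x = 0"
  proof
    assume "inner x x = 0"
    then have "\<forall>n. inner (coord x n) (coord x n) = 0"
      unfolding inner_l2_def using suminf_eq_zero_iff[OF sm[of x x]] by simp
    then have "coord x = (\<lambda>_. 0)" by auto
    then show "x = 0" by transfer simp
  qed (simp add: inner_l2_def zero_l2.rep_eq)
  show "norm x = sqrt (inner x x)" by (rule norm_l2_def)
qed

end

lemma norm_l2_square: "(norm f)\<^sup>2 = (\<Sum>n. (cmod (coord f n))\<^sup>2)"
  by (simp add: power2_norm_eq_inner inner_l2_def)

lemma sum_coord_le: "(\<Sum>n<K. (cmod (coord f n))\<^sup>2) \<le> (norm f)\<^sup>2"
  unfolding norm_l2_square by (intro sum_le_suminf summable_coord) auto

lemma norm_coord_le: "cmod (coord f n) \<le> norm f"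
proof (rule power2_le_imp_le)
  have "(cmod (coord f n))\<^sup>2 \<le> (\<Sum>k<Suc n. (cmod (coord f k))\<^sup>2)"
    by (intro member_le_sum) auto
  then show "(cmod (coord f n))\<^sup>2 \<le> (norm f)\<^sup>2" using sum_coord_le by (rule order_trans)
qed simp

lemma l2_of_bounded_sums:
  fixes f :: "nat \<Rightarrow> complex"
  assumes le: "\<And>K. (\<Sum>n<K. (cmod (f n))\<^sup>2) \<le> c\<^sup>2" and c: "0 \<le> c"
  shows "coord (Abs_l2 f) = f" "norm (Abs_l2 f) \<le> c"
proof -
  have s: "summable (\<lambda>n. (cmod (f n))\<^sup>2)" by (rule summableI_nonneg_bounded[OF _ le]) simp
  then show eq: "coord (Abs_l2 f) = f" by (simp add: Abs_l2_inverse)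
  have "(norm (Abs_l2 f))\<^sup>2 \<le> c\<^sup>2"
    unfolding norm_l2_square eq by (rule suminf_le_const[OF s le])
  then show "norm (Abs_l2 f) \<le> c" using c by (rule power2_le_imp_le)
qed

instance l2 :: banach
proof
  fix X :: "nat \<Rightarrow> l2" assume X: "Cauchy X"
  have "Cauchy (\<lambda>n. coord (X n) k)" for k
  proof (rule metric_CauchyI)
    fix e :: real assume "e > 0"
    then obtain M where M: "\<And>m n. m \<ge> M \<Longrightarrow> n \<ge> M \<Longrightarrow> dist (X m) (X n) < e"
      using X by (metis metric_CauchyD)
    have "dist (coord (X m) k) (coord (X n) k) \<le> dist (X m) (X n)" for m n
      using norm_coord_le[of "X m - X n" k] by (simp add: dist_norm minus_l2.rep_eq)
    then show "\<exists>M. \<forall>m\<ge>M. \<forall>n\<ge>M. dist (coord (X m) k) (coord (X n) k) < e"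
      using M by (meson le_less_trans)
  qed
  then have "\<exists>l. (\<lambda>n. coord (X n) k) \<longlonglongrightarrow> l" for k by (simp add: Cauchy_convergent_iff convergent_def)
  then obtain f where f: "\<And>k. (\<lambda>n. coord (X n) k) \<longlonglongrightarrow> f k" by metis
  have close: "\<exists>M. \<forall>n\<ge>M. coord (Abs_l2 (\<lambda>k. coord (X n) k - f k)) = (\<lambda>k. coord (X n) k - f k) \<and>
      norm (Abs_l2 (\<lambda>k. coord (X n) k - f k)) \<le> e" if e: "e > 0" for e
  proof -
    obtain M where M: "\<And>m n. m \<ge> M \<Longrightarrow> n \<ge> M \<Longrightarrow> dist (X m) (X n) < e"
      using X e by (metis metric_CauchyD)
    have "(\<Sum>k<K. (cmod (coord (X n) k - f k))\<^sup>2) \<le> e\<^sup>2" if n: "n \<ge> M" for n K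
    proof (rule LIMSEQ_le_const2)
      show "(\<lambda>m. \<Sum>k<K. (cmod (coord (X n) k - coord (X m) k))\<^sup>2) \<longlonglongrightarrow> (\<Sum>k<K. (cmod (coord (X n) k - f k))\<^sup>2)"
        by (intro tendsto_intros f)
      have "(\<Sum>k<K. (cmod (coord (X n) k - coord (X m) k))\<^sup>2) \<le> e\<^sup>2" if "m \<ge> M" for m
      proof -
        have "(\<Sum>k<K. (cmod (coord (X n) k - coord (X m) k))\<^sup>2) \<le> (norm (X n - X m))\<^sup>2"
          using sum_coord_le[of "X n - X m" K] by (simp add: minus_l2.rep_eq)
        also have "\<dots> \<le> e\<^sup>2" using M[OF n that] by (intro power_mono) (auto simp: dist_norm)
        finally show ?thesis .
      qed
      then show "\<exists>N. \<forall>m\<ge>N. (\<Sum>k<K. (cmod (coord (X n) k - coord (X m) k))\<^sup>2) \<le> e\<^sup>2" by blast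
    qed
    then show ?thesis using l2_of_bounded_sums[of _ e] e by (metis less_imp_le)
  qed
  obtain n0 where n0: "coord (Abs_l2 (\<lambda>k. coord (X n0) k - f k)) = (\<lambda>k. coord (X n0) k - f k)"
    using close[of 1] by auto
  define F where "F = X n0 - Abs_l2 (\<lambda>k. coord (X n0) k - f k)"
  have F: "coord F = f" by (simp add: F_def minus_l2.rep_eq n0)
  have "X \<longlonglongrightarrow> F"
  proof (rule metric_LIMSEQ_I)
    fix e :: real assume "e > 0"
    then obtain M where M: "\<forall>n\<ge>M. norm (Abs_l2 (\<lambda>k. coord (X n) k - f k)) \<le> e / 2"
      using close[of "e / 2"] by auto
    have "Abs_l2 (\<lambda>k. coord (X n) k - f k) = X n - F" for n
    proof -
      have "coord (X n - F) = (\<lambda>k. coord (X n) k - f k)" by (simp add: minus_l2.rep_eq F)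
      then show ?thesis by (metis coord_inverse)
    qed
    then have "dist (X n) F < e" if "n \<ge> M" for n
      using M \<open>e > 0\<close> that by (fastforce simp: dist_norm)
    then show "\<exists>no. \<forall>n\<ge>no. dist (X n) F < e" by blast
  qed
  then show "convergent X" by (auto simp: convergent_def)
qed

lemma coord_simps:
  "coord (f + g) n = coord f n + coord g n" "coord (f - g) n = coord f n - coord g n"
  "coord (- f) n = - coord f n" "coord (r *\<^sub>R f) n = r *\<^sub>R coord f n" "coord 0 n = 0"
  by (simp_all add: plus_l2.rep_eq minus_l2.rep_eq uminus_l2.rep_eq scaleR_l2.rep_eq zero_l2.rep_eq)

lemma l2_eqI: "(\<And>n. coord f n = coord g n) \<Longrightarrow> f = g"
  by (metis coord_inject ext)

subsection \<open>Multiplication by the imaginary unit, and truncation\<close>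

lemma linear_operator_of_bound:
  assumes coord: "\<And>f. coord (T f) = t (coord f)" and bound: "\<And>f. norm (T f) \<le> K * norm f"
    and add: "\<And>f g n. t (\<lambda>n. f n + g n) n = t f n + t g n"
    and scale: "\<And>c f n. t (\<lambda>n. c * f n) n = c * t f n"
  shows "blinfun_apply (Blinfun T) = T"
proof (rule bounded_linear_Blinfun_apply, rule bounded_linear_intro)
  show "T (f + g) = T f + T g" for f g
    by (rule l2_eqI) (simp add: coord plus_l2.rep_eq add)
  show "T (r *\<^sub>R f) = r *\<^sub>R T f" for r f
    by (rule l2_eqI) (simp add: coord scaleR_l2.rep_eq scaleR_conv_of_real scale)
  show "norm (T f) \<le> norm f * K" for f
    using bound[of f] by (simp add: mult.commute)
qed

definition J_l2 :: "l2 \<Rightarrow>\<^sub>L l2" where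
  "J_l2 = Blinfun (\<lambda>f. Abs_l2 (\<lambda>n. \<i> * coord f n))"

lemma coord_J_l2: "coord (J_l2 f) n = \<i> * coord f n"
proof -
  have *: "coord (Abs_l2 (\<lambda>n. \<i> * coord f n)) = (\<lambda>n. \<i> * coord f n)"
    "norm (Abs_l2 (\<lambda>n. \<i> * coord f n)) \<le> norm f" for f
    using l2_of_bounded_sums[of "\<lambda>n. \<i> * coord f n" "norm f"] sum_coord_le[of f]
    by (simp_all add: norm_mult)
  have "blinfun_apply J_l2 = (\<lambda>f. Abs_l2 (\<lambda>n. \<i> * coord f n))"
    unfolding J_l2_def
    by (rule linear_operator_of_bound[where t = "\<lambda>f n. \<i> * f n" and K = 1]) (use * in \<open>simp_all add: algebra_simps\<close>)
  then show ?thesis by (simp add: *)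
qed

global_interpretation l2: complex_hilbert J_l2
proof
  show "J_l2 (J_l2 x) = - x" for x
    by (rule l2_eqI) (simp add: coord_J_l2 coord_simps flip: mult.assoc)
  show "inner (J_l2 x) y = - inner x (J_l2 y)" for x y
  proof -
    have "inner (\<i> * a) b = - inner a (\<i> * b)" for a b :: complex
      by (simp add: inner_complex_def)
    moreover have "summable (\<lambda>n. inner (coord x n) (\<i> * coord y n))"
      using summable_inner_sequences[OF summable_coord[of x] summable_coord[of "J_l2 y"]]
      by (simp add: coord_J_l2)
    ultimately show ?thesis unfolding inner_l2_def coord_J_l2 by (simp add: suminf_minus)
  qed
qed

definition trunc :: "nat \<Rightarrow> l2 \<Rightarrow> l2" where
  "trunc K f = Abs_l2 (\<lambda>n. if n < K then coord f n else 0)"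

lemma coord_trunc: "coord (trunc K f) n = (if n < K then coord f n else 0)"
proof -
  have "summable (\<lambda>n. (cmod (if n < K then coord f n else 0))\<^sup>2)"
    by (rule summable_finite[of "{..<K}"]) auto
  then show ?thesis by (simp add: trunc_def Abs_l2_inverse)
qed

lemma trunc_tendsto: "(\<lambda>K. trunc K f) \<longlonglongrightarrow> f"
proof -
  have "(norm (trunc K f - f))\<^sup>2 = (norm f)\<^sup>2 - (\<Sum>n<K. (cmod (coord f n))\<^sup>2)" for K
  proof -
    have "(norm (trunc K f - f))\<^sup>2 = (\<Sum>n. (cmod (coord f n))\<^sup>2 - (if n < K then (cmod (coord f n))\<^sup>2 else 0))"
      unfolding norm_l2_square by (intro arg_cong[of _ _ suminf]) (auto simp: coord_simps coord_trunc)
    also have "\<dots> = (\<Sum>n. (cmod (coord f n))\<^sup>2) - (\<Sum>n. if n < K then (cmod (coord f n))\<^sup>2 else 0)"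
      by (intro suminf_diff[symmetric] summable_coord summable_finite[of "{..<K}"]) auto
    also have "(\<Sum>n. if n < K then (cmod (coord f n))\<^sup>2 else 0) = (\<Sum>n<K. (cmod (coord f n))\<^sup>2)"
      by (subst suminf_finite[of "{..<K}"]) auto
    finally show ?thesis by (simp add: norm_l2_square)
  qed
  moreover have "(\<lambda>K. (norm f)\<^sup>2 - (\<Sum>n<K. (cmod (coord f n))\<^sup>2)) \<longlonglongrightarrow> (norm f)\<^sup>2 - (norm f)\<^sup>2"
    unfolding norm_l2_square by (intro tendsto_diff tendsto_const summable_LIMSEQ summable_coord)
  ultimately have "(\<lambda>K. (norm (trunc K f - f))\<^sup>2) \<longlonglongrightarrow> 0" by simp
  from tendsto_real_sqrt[OF this] have "(\<lambda>K. norm (trunc K f - f)) \<longlonglongrightarrow> 0" by simp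
  then show ?thesis using LIM_zero_iff tendsto_norm_zero_iff by blast
qed

lemma inner_l2_finite:
  assumes "\<And>n. n \<ge> K \<Longrightarrow> coord f n = 0"
  shows "inner f g = (\<Sum>n<K. inner (coord f n) (coord g n))"
  unfolding inner_l2_def using assms by (intro suminf_finite) (auto simp: not_less)

subsection \<open>Hermitian matrices with finite rows\<close>

text \<open>As the rows are finite, the matrix acts on all sequences, and the bound for finite sections
  passes to square-summable ones. Columns are finite by symmetry, so symmetry of the operator can be
  checked by rearranging finite sums against truncated sequences, which are dense.\<close>

lemma hermitian_matrix_operator:
  fixes B :: "nat \<Rightarrow> nat \<Rightarrow> complex"
  assumes herm: "\<And>m n. B n m = cnj (B m n)" and row: "\<And>m n. n \<ge> c m \<Longrightarrow> B m n = 0"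
    and bound: "\<And>M K f. (\<Sum>m<M. (cmod (\<Sum>n<K. B m n * f n))\<^sup>2) \<le> R\<^sup>2 * (\<Sum>n<K. (cmod (f n))\<^sup>2)"
    and R: "0 \<le> R"
  shows "\<exists>T. (\<forall>f m. coord (blinfun_apply T f) m = (\<Sum>n<c m. B m n * coord f n)) \<and> self_adjoint l2.operators T"
proof -
  define t where "t f m = (\<Sum>n<c m. B m n * f n)" for f :: "nat \<Rightarrow> complex" and m
  have t: "t f m = (\<Sum>n<K. B m n * f n)" if "c m \<le> K" for f m K
    unfolding t_def using that row by (intro sum.mono_neutral_left) (auto simp: not_less)
  have le: "(\<Sum>m<M. (cmod (t (coord f) m))\<^sup>2) \<le> (R * norm f)\<^sup>2" for M f
  proof -
    \<comment> \<open>A common bound for the supports of the first \<open>M\<close> rows.\<close>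
    define K where "K = (\<Sum>m<M. c m)"
    have "c m \<le> K" if "m < M" for m unfolding K_def using that by (intro member_le_sum) auto
    then have "t (coord f) m = (\<Sum>n<K. B m n * coord f n)" if "m < M" for m
      using t that by blast
    then have "(\<Sum>m<M. (cmod (t (coord f) m))\<^sup>2) = (\<Sum>m<M. (cmod (\<Sum>n<K. B m n * coord f n))\<^sup>2)"
      by (intro sum.cong refl) simp
    also have "\<dots> \<le> R\<^sup>2 * (\<Sum>n<K. (cmod (coord f n))\<^sup>2)" by (rule bound)
    also have "\<dots> \<le> R\<^sup>2 * (norm f)\<^sup>2" by (intro mult_left_mono sum_coord_le) simp
    finally show ?thesis by (simp add: power_mult_distrib)
  qed
  define T where "T = Blinfun (\<lambda>f. Abs_l2 (t (coord f)))"
  have ct: "coord (Abs_l2 (t (coord f))) = t (coord f)" "norm (Abs_l2 (t (coord f))) \<le> R * norm f" for f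
    using l2_of_bounded_sums[OF le] R by simp_all
  have T: "coord (T f) = t (coord f)" for f
  proof -
    have "blinfun_apply T = (\<lambda>f. Abs_l2 (t (coord f)))"
      unfolding T_def
      by (rule linear_operator_of_bound[where t = t and K = R])
        (use ct in \<open>simp_all add: t_def algebra_simps sum.distrib sum_distrib_left\<close>)
    then show ?thesis by (simp add: ct)
  qed
  have "l2.clinear_op T"
    unfolding l2.clinear_op_def
  proof
    fix f
    show "T (J_l2 f) = J_l2 (T f)"
      by (rule l2_eqI) (simp add: T t_def coord_J_l2 sum_distrib_left algebra_simps)
  qed
  moreover have "l2.adjoint_pair T T"
    unfolding l2.adjoint_pair_def
  proof (intro allI)
    fix f g
    have fin: "inner (T f) (trunc K g) = inner f (T (trunc K g))" for K
    proof -
      define L where "L = K + (\<Sum>m<K. c m)"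
      have L: "K \<le> L" "\<And>m. m < K \<Longrightarrow> c m \<le> L"
        unfolding L_def by (auto intro!: trans_le_add2 member_le_sum)
      have ip: "inner (b * x) y = inner x (cnj b * y)" for b x y :: complex
        by (simp add: inner_complex_def algebra_simps)
      have B0: "B n m = 0" if "m < K" "n \<ge> L" for m n
        using herm[of m n] row[of m n] L(2)[OF that(1)] that(2) by (simp add: herm[of n m])
      have tg: "coord (T (trunc K g)) n = (\<Sum>m<K. B n m * coord g m)" for n
      proof -
        have "coord (T (trunc K g)) n = (\<Sum>m<max (c n) K. B n m * coord (trunc K g) m)"
          unfolding T by (rule t) simp
        also have "\<dots> = (\<Sum>m<K. B n m * coord (trunc K g) m)"
          by (intro sum.mono_neutral_right) (auto simp: coord_trunc)
        finally show ?thesis by (simp add: coord_trunc)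
      qed
      have "inner (T f) (trunc K g) = inner (trunc K g) (T f)" by (rule inner_commute)
      also have "\<dots> = (\<Sum>m<K. inner (coord g m) (coord (T f) m))"
        by (subst inner_l2_finite[of K]) (auto simp: coord_trunc)
      also have "\<dots> = (\<Sum>m<K. \<Sum>n<L. inner (coord g m) (B m n * coord f n))"
        unfolding T using L(2) by (intro sum.cong) (auto simp: t[of _ L] inner_sum_right)
      also have "\<dots> = (\<Sum>n<L. \<Sum>m<K. inner (coord g m) (B m n * coord f n))" by (rule sum.swap)
      also have "\<dots> = (\<Sum>n<L. inner (\<Sum>m<K. B n m * coord g m) (coord f n))"
        by (simp add: inner_sum_left ip) (simp add: herm[symmetric])
      also have "\<dots> = inner (T (trunc K g)) f"
        by (subst inner_l2_finite[of L]) (auto simp: tg B0)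
      finally show ?thesis by (simp add: inner_commute)
    qed
    have "(\<lambda>K. inner (T f) (trunc K g)) \<longlonglongrightarrow> inner (T f) g"
      by (intro tendsto_inner tendsto_const trunc_tendsto)
    moreover have "(\<lambda>K. inner f (T (trunc K g))) \<longlonglongrightarrow> inner f (T g)"
      by (intro tendsto_inner tendsto_const blinfun.tendsto trunc_tendsto)
    ultimately show "inner (T f) g = inner f (T g)"
      unfolding fin by (rule LIMSEQ_unique)
  qed
  ultimately have "self_adjoint l2.operators T"
    by (auto simp: self_adjoint_def l2.adj_eq intro: l2.carrierI)
  moreover have "coord (T f) m = (\<Sum>n<c m. B m n * coord f n)" for f m by (simp add: T t_def)
  ultimately show ?thesis by blast
qed

section \<open>Realising a positive moment functional\<close>

text \<open>A polynomial in non-commuting self-adjoint letters is given by the list of its terms. Many lists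
  denote the same polynomial; they have the same inner products with all others, and only inner
  products matter here. Concatenation is addition.\<close>

type_synonym nc_poly = "(complex \<times> nat list) list"

definition smul :: "complex \<Rightarrow> nc_poly \<Rightarrow> nc_poly" where
  "smul c f = map (\<lambda>(d, u). (c * d, u)) f"

definition lmul :: "nat \<Rightarrow> nc_poly \<Rightarrow> nc_poly" where
  "lmul i f = map (\<lambda>(d, u). (d, i # u)) f"

definition word :: "nat list \<Rightarrow> nc_poly" where "word u = [(1, u)]"

text \<open>The form \<open>\<langle>f, g\<rangle> = M(f\<^sup>* g)\<close>; reversal of a word is its adjoint since the letters are self-adjoint.\<close>

definition moment_form :: "(nat list \<Rightarrow> complex) \<Rightarrow> nc_poly \<Rightarrow> nc_poly \<Rightarrow> complex" where
  "moment_form M f g = (\<Sum>(c, u)\<leftarrow>f. \<Sum>(d, v)\<leftarrow>g. cnj c * d * M (rev u @ v))"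

locale moment_functional =
  fixes M :: "nat list \<Rightarrow> complex" and R :: "nat \<Rightarrow> real"
  assumes unital: "M [] = 1"
    and positive: "moment_form M f f \<in> \<real>\<^sub>\<ge>\<^sub>0"
    and growth: "cmod (M w) \<le> prod_list (map R w)"
    and R_pos: "R i > 0"
begin

abbreviation ip :: "nc_poly \<Rightarrow> nc_poly \<Rightarrow> complex" where "ip \<equiv> moment_form M"

lemma ip_append_left: "ip (f @ g) h = ip f h + ip g h"
  by (simp add: moment_form_def)

lemma ip_append_right: "ip h (f @ g) = ip h f + ip h g"
  by (simp add: moment_form_def sum_list_addf case_prod_unfold)

lemma ip_Nil [simp]: "ip [] g = 0" "ip f [] = 0"
  by (simp_all add: moment_form_def case_prod_unfold)

lemma ip_smul_left: "ip (smul c f) g = cnj c * ip f g"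
  by (simp add: moment_form_def smul_def case_prod_unfold comp_def sum_list_const_mult[symmetric] mult.assoc)

lemma ip_smul_right: "ip f (smul c g) = c * ip f g"
  by (simp add: moment_form_def smul_def case_prod_unfold comp_def sum_list_const_mult[symmetric] ac_simps)

lemmas ip_simps = ip_append_left ip_append_right ip_smul_left ip_smul_right

lemma ip_lmul: "ip (lmul i f) g = ip f (lmul i g)"
  by (simp add: moment_form_def lmul_def case_prod_unfold comp_def)

lemma ip_word: "ip (word u) (word v) = M (rev u @ v)"
  by (simp add: moment_form_def word_def)

lemma ip_psd:
  "cnj s * s * ip f f + cnj s * t * ip f g + cnj t * s * ip g f + cnj t * t * ip g g \<in> \<real>\<^sub>\<ge>\<^sub>0"
proof -
  have "ip (smul s f @ smul t g) (smul s f @ smul t g) =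
      cnj s * s * ip f f + cnj s * t * ip f g + cnj t * s * ip g f + cnj t * t * ip g g"
    by (simp add: ip_simps algebra_simps)
  then show ?thesis using positive by metis
qed

lemma ip_cnj: "ip g f = cnj (ip f g)"
  by (rule psd_two_by_two(3)[OF ip_psd])

lemma ip_cauchy_schwarz: "(cmod (ip f g))\<^sup>2 \<le> Re (ip f f) * Re (ip g g)"
  by (rule psd_two_by_two(4)[OF ip_psd])

lemma ip_self: "ip f f = complex_of_real (Re (ip f f))" "0 \<le> Re (ip f f)"
  using positive[of f] by (auto simp: complex_nonneg_Reals_iff complex_eq_iff)

lemma ip_null:
  assumes "Re (ip f f) = 0"
  shows "ip f g = 0" "ip g f = 0"
  using ip_cauchy_schwarz[of f g] ip_cauchy_schwarz[of g f] assms by simp_all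

subsection \<open>Left multiplications are bounded\<close>

lemma ip_lmul_power: "ip ((lmul i ^^ a) f) ((lmul i ^^ b) g) = ip f ((lmul i ^^ (a + b)) g)"
proof (induction a arbitrary: b)
  case (Suc a)
  have "ip ((lmul i ^^ Suc a) f) ((lmul i ^^ b) g) = ip ((lmul i ^^ a) f) ((lmul i ^^ Suc b) g)"
    by (simp add: ip_lmul)
  then show ?case by (simp only: Suc.IH) simp
qed simp

lemma lmul_power: "(lmul i ^^ k) f = map (\<lambda>(d, u). (d, replicate k i @ u)) f"
proof (induction k)
  case (Suc k)
  then show ?case by (simp add: lmul_def comp_def case_prod_unfold)
qed (simp add: case_prod_unfold)

lemma prod_list_R_append: "prod_list (map R (u @ v)) = prod_list (map R u) * prod_list (map R v)"
  by simp

lemma ip_growth: "\<exists>C\<ge>0. \<forall>k. cmod (ip f ((lmul i ^^ k) f)) \<le> C * R i ^ k"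
proof -
  define n where "n = (\<Sum>(c, u)\<leftarrow>f. cmod c * prod_list (map R u))"
  have Rn: "0 \<le> prod_list (map R u)" for u
    by (induction u) (simp_all add: mult_nonneg_nonneg less_imp_le[OF R_pos])
  have "cmod (ip f ((lmul i ^^ k) f)) \<le> n * n * R i ^ k" for k
  proof -
    have rep: "prod_list (map R (replicate k i)) = R i ^ k" by (induction k) auto
    have rv: "prod_list (map R (rev u)) = prod_list (map R u)" for u
      by (induction u) (auto simp: mult.commute)
    have nl: "cmod (\<Sum>x\<leftarrow>xs. h x) \<le> (\<Sum>x\<leftarrow>xs. cmod (h x))" for h :: "'z \<Rightarrow> complex" and xs
      by (induction xs) (auto intro: norm_triangle_le)
    have "cmod (ip f ((lmul i ^^ k) f)) \<le>
        (\<Sum>x\<leftarrow>f. cmod (\<Sum>y\<leftarrow>f. cnj (fst x) * fst y * M (rev (snd x) @ replicate k i @ snd y)))"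
      using nl[of "\<lambda>x. \<Sum>y\<leftarrow>f. cnj (fst x) * fst y * M (rev (snd x) @ replicate k i @ snd y)" f]
      by (simp add: moment_form_def lmul_power case_prod_unfold comp_def)
    also have "\<dots> \<le> (\<Sum>x\<leftarrow>f. \<Sum>y\<leftarrow>f. cmod (cnj (fst x) * fst y * M (rev (snd x) @ replicate k i @ snd y)))"
      by (intro sum_list_mono nl)
    also have "\<dots> \<le> (\<Sum>x\<leftarrow>f. \<Sum>y\<leftarrow>f. (cmod (fst x) * prod_list (map R (snd x))) * ((cmod (fst y) * prod_list (map R (snd y))) * R i ^ k))"
    proof (intro sum_list_mono)
      fix x y
      have "cmod (cnj (fst x) * fst y * M (rev (snd x) @ replicate k i @ snd y)) =
          cmod (fst x) * cmod (fst y) * cmod (M (rev (snd x) @ replicate k i @ snd y))"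
        by (simp add: norm_mult)
      also have "\<dots> \<le> cmod (fst x) * cmod (fst y) * prod_list (map R (rev (snd x) @ replicate k i @ snd y))"
        by (intro mult_left_mono growth) simp
      also have "\<dots> = (cmod (fst x) * prod_list (map R (snd x))) * ((cmod (fst y) * prod_list (map R (snd y))) * R i ^ k)"
        unfolding prod_list_R_append rep rv by (simp only: ac_simps)
      finally show "cmod (cnj (fst x) * fst y * M (rev (snd x) @ replicate k i @ snd y)) \<le>
          (cmod (fst x) * prod_list (map R (snd x))) * ((cmod (fst y) * prod_list (map R (snd y))) * R i ^ k)" .
    qed
    also have "\<dots> = n * n * R i ^ k"
      unfolding n_def case_prod_unfold
      by (simp only: sum_list_const_mult sum_list_mult_const)
    finally show ?thesis .
  qed
  moreover have "0 \<le> n * n" by simp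
  ultimately show ?thesis by blast
qed

text \<open>Let \<open>c = \<langle>f, f\<rangle>\<close> and \<open>a n = \<langle>f, X\<^sup>k f\<rangle>\<close> with \<open>k = 2 ^ (n + 1)\<close>, where \<open>X\<close> is multiplication by the letter. By
  Cauchy-Schwarz \<open>(a n)\<^sup>2 \<le> c a (n + 1)\<close>, so if \<open>a 0 / c\<close> exceeded \<open>R\<^sup>2\<close>, then \<open>a n\<close> would outgrow
  every multiple of \<open>R\<^sup>k\<close>, against the growth condition.\<close>

lemma ip_lmul_bound: "Re (ip (lmul i f) (lmul i f)) \<le> (R i)\<^sup>2 * Re (ip f f)"
proof -
  define c where "c = Re (ip f f)"
  define a where "a n = Re (ip f ((lmul i ^^ (2 ^ Suc n)) f))" for n
  have sq: "ip ((lmul i ^^ k) f) ((lmul i ^^ k) f) = ip f ((lmul i ^^ (2 * k)) f)" for k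
    by (simp add: ip_lmul_power mult_2)
  have a0: "Re (ip (lmul i f) (lmul i f)) = a 0"
    using sq[of 1] by (simp add: a_def)
  have c0: "0 \<le> c" unfolding c_def by (rule ip_self)
  have a_nonneg: "0 \<le> a n" for n
    using ip_self(2)[of "(lmul i ^^ (2 ^ n)) f"] unfolding sq a_def by simp
  have step: "(a n)\<^sup>2 \<le> c * a (Suc n)" for n
  proof -
    have "(a n)\<^sup>2 \<le> (cmod (ip f ((lmul i ^^ (2 ^ Suc n)) f)))\<^sup>2"
      unfolding a_def using abs_Re_le_cmod by (metis abs_norm_cancel power2_le_iff_abs_le abs_ge_zero power2_abs power_mono)
    also have "\<dots> \<le> c * Re (ip ((lmul i ^^ (2 ^ Suc n)) f) ((lmul i ^^ (2 ^ Suc n)) f))"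
      unfolding c_def by (rule ip_cauchy_schwarz)
    also have "\<dots> = c * a (Suc n)" unfolding sq a_def by simp
    finally show ?thesis .
  qed
  obtain C where C: "0 \<le> C" "\<And>k. cmod (ip f ((lmul i ^^ k) f)) \<le> C * R i ^ k"
    using ip_growth by metis
  have "a 0 \<le> (R i)\<^sup>2 * c"
  proof (cases "c = 0")
    case True
    then show ?thesis using step[of 0] by simp
  next
    case False
    then have c: "c > 0" using c0 by simp
    have R2: "(R i)\<^sup>2 > 0" using R_pos[of i] by simp
    define q where "q = a 0 / c / (R i)\<^sup>2"
    have pow: "(a 0 / c) ^ (2 ^ n) \<le> a n / c" for n
    proof (induction n)
      case (Suc n)
      have "(a 0 / c) ^ (2 ^ Suc n) = ((a 0 / c) ^ (2 ^ n))\<^sup>2"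
        by (simp add: power_mult mult.commute flip: power_mult)
      also have "\<dots> \<le> (a n / c)\<^sup>2"
        using Suc a_nonneg[of 0] c by (intro power_mono) simp_all
      also have "\<dots> \<le> a (Suc n) / c"
        using step[of n] c by (simp add: power_divide power2_eq_square field_simps)
      finally show ?case .
    qed simp
    have bd: "q ^ (2 ^ n) \<le> C / c" for n
    proof -
      have "a n \<le> C * R i ^ (2 ^ Suc n)"
        unfolding a_def using C(2)[of "2 ^ Suc n"] complex_Re_le_cmod order_trans by blast
      also have "R i ^ (2 ^ Suc n) = ((R i)\<^sup>2) ^ (2 ^ n)" by (simp flip: power_mult)
      finally have an: "a n \<le> C * ((R i)\<^sup>2) ^ (2 ^ n)" .
      have "q ^ (2 ^ n) = (a 0 / c) ^ (2 ^ n) / ((R i)\<^sup>2) ^ (2 ^ n)"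
        unfolding q_def by (rule power_divide)
      also have "\<dots> \<le> (a n / c) / ((R i)\<^sup>2) ^ (2 ^ n)" using pow R2 by (intro divide_right_mono) auto
      also have "\<dots> \<le> (C * ((R i)\<^sup>2) ^ (2 ^ n) / c) / ((R i)\<^sup>2) ^ (2 ^ n)"
        using an c R2 by (intro divide_right_mono) auto
      also have "\<dots> = C / c" using R_pos[of i] by simp
      finally show ?thesis .
    qed
    have "q \<le> 1"
    proof (rule ccontr)
      assume "\<not> q \<le> 1"
      then have q: "1 < q" by simp
      obtain m where m: "C / c < q ^ m" using real_arch_pow[OF q] by blast
      have "q ^ m \<le> q ^ (2 ^ m)" using q by (intro power_increasing) (auto intro: less_imp_le less_exp)
      then show False using m bd[of m] by simp
    qed
    then show ?thesis using c R2 by (simp add: q_def field_simps)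
  qed
  then show ?thesis unfolding a0 c_def .
qed

subsection \<open>Orthonormalisation of the words\<close>

definition wd :: "nat \<Rightarrow> nc_poly" where "wd n = word (from_nat n)"

text \<open>Gram-Schmidt along an enumeration of the words. A word that depends on its predecessors
  contributes the empty list, that is zero, so each \<open>\<langle>onb n, onb n\<rangle>\<close> is \<open>0\<close> or \<open>1\<close>.\<close>

function onb :: "nat \<Rightarrow> nc_poly" where
  "onb n = (let r = wd n @ concat (map (\<lambda>k. smul (- ip (onb k) (wd n)) (onb k)) [0..<n])
     in if Re (ip r r) = 0 then [] else smul (complex_of_real (1 / sqrt (Re (ip r r)))) r)"
  by pat_completeness auto
termination by (relation "Wellfounded.measure id") auto

declare onb.simps [simp del]

definition resid :: "nat \<Rightarrow> nc_poly" where
  "resid n = wd n @ concat (map (\<lambda>k. smul (- ip (onb k) (wd n)) (onb k)) [0..<n])"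

lemma onb_eq: "onb n = (if Re (ip (resid n) (resid n)) = 0 then []
    else smul (complex_of_real (1 / sqrt (Re (ip (resid n) (resid n))))) (resid n))"
  by (subst onb.simps) (simp add: resid_def Let_def)

lemma ip_concat_right: "ip g (concat (map F [0..<n])) = (\<Sum>k<n. ip g (F k))"
  by (induction n) (simp_all add: ip_simps)

lemma ip_concat_left: "ip (concat (map F [0..<n])) g = (\<Sum>k<n. ip (F k) g)"
  by (induction n) (simp_all add: ip_simps)

lemma ip_resid: "ip g (resid n) = ip g (wd n) - (\<Sum>k<n. ip (onb k) (wd n) * ip g (onb k))"
  by (simp add: resid_def ip_simps ip_concat_right sum_negf)

lemma onb_self: "ip (onb n) (onb n) = (if onb n = [] then 0 else 1)"
proof (cases "Re (ip (resid n) (resid n)) = 0")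
  case True
  then show ?thesis by (simp add: onb_eq)
next
  case False
  then have pos: "Re (ip (resid n) (resid n)) > 0" using ip_self(2)[of "resid n"] by simp
  let ?c = "Re (ip (resid n) (resid n))"
  have o: "onb n = smul (complex_of_real (1 / sqrt ?c)) (resid n)" using False by (simp add: onb_eq)
  have "ip (onb n) (onb n) = complex_of_real (1 / sqrt ?c) * complex_of_real (1 / sqrt ?c) * ip (resid n) (resid n)"
    unfolding o by (simp add: ip_simps)
  also have "\<dots> = complex_of_real (1 / sqrt ?c * (1 / sqrt ?c) * ?c)"
    by (subst ip_self(1)) (simp only: of_real_mult)
  also have "1 / sqrt ?c * (1 / sqrt ?c) * ?c = 1"
    using pos by (simp add: field_simps)
  finally have *: "ip (onb n) (onb n) = 1" by simp
  then have "onb n \<noteq> []" by auto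
  then show ?thesis using * by simp
qed

lemma onb_orthogonal: "j < n \<Longrightarrow> ip (onb j) (onb n) = 0"
proof (induction n arbitrary: j rule: less_induct)
  case (less n)
  have orth: "ip (onb j) (onb k) = (if j = k then ip (onb j) (onb j) else 0)" if "k < n" for k
  proof -
    consider "j < k" | "k < j" | "j = k" by linarith
    then show ?thesis
    proof cases
      case 1
      then show ?thesis using less.IH[OF that] by simp
    next
      case 2
      then show ?thesis using less.IH[OF less.prems 2] ip_cnj[of "onb j" "onb k"] by simp
    qed simp
  qed
  have "ip (onb j) (resid n) = ip (onb j) (wd n) - (\<Sum>k<n. if j = k then ip (onb k) (wd n) * ip (onb j) (onb j) else 0)"
    unfolding ip_resid using orth by (intro arg_cong2[of _ _ _ _ minus] refl sum.cong) auto
  also have "\<dots> = ip (onb j) (wd n) - ip (onb j) (wd n) * ip (onb j) (onb j)"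
    using less.prems by (simp add: sum.delta)
  also have "\<dots> = 0" by (simp add: onb_self)
  finally show ?case by (simp add: onb_eq ip_simps)
qed

lemma onb_orthogonal': "j \<noteq> n \<Longrightarrow> ip (onb j) (onb n) = 0"
  using onb_orthogonal[of j n] onb_orthogonal[of n j] ip_cnj[of "onb j" "onb n"] by (cases "j < n") auto

lemma ip_wd_expand: "ip g (wd n) = (\<Sum>k<Suc n. ip g (onb k) * ip (onb k) (wd n))"
proof -
  let ?c = "Re (ip (resid n) (resid n))"
  have "ip g (resid n) = ip g (onb n) * ip (onb n) (wd n)"
  proof (cases "?c = 0")
    case True
    then show ?thesis by (simp add: onb_eq ip_null[OF True])
  next
    case False
    then have pos: "?c > 0" using ip_self(2)[of "resid n"] by simp
    have o: "onb n = smul (complex_of_real (1 / sqrt ?c)) (resid n)" using False by (simp add: onb_eq)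
    have "ip (onb n) (wd n) = ip (onb n) (resid n)"
      unfolding ip_resid by (simp add: onb_orthogonal')
    also have "\<dots> = complex_of_real (1 / sqrt ?c) * ip (resid n) (resid n)"
      by (subst o) (simp add: ip_simps)
    also have "\<dots> = complex_of_real (1 / sqrt ?c * ?c)"
      by (subst ip_self(1)) (simp only: of_real_mult)
    also have "1 / sqrt ?c * ?c = sqrt ?c" using pos by (simp add: real_div_sqrt)
    finally have "ip (onb n) (wd n) = complex_of_real (sqrt ?c)" .
    moreover have "ip g (onb n) = complex_of_real (1 / sqrt ?c) * ip g (resid n)"
      unfolding o by (simp add: ip_simps)
    ultimately have "ip g (onb n) * ip (onb n) (wd n) = complex_of_real (1 / sqrt ?c * sqrt ?c) * ip g (resid n)"
      by (simp only: of_real_mult ac_simps)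
    also have "1 / sqrt ?c * sqrt ?c = 1" using pos by simp
    finally show ?thesis by simp
  qed
  then show ?thesis unfolding ip_resid by (simp add: algebra_simps)
qed

lemma ip_onb_wd: "n < k \<Longrightarrow> ip (onb k) (wd n) = 0"
  by (subst ip_wd_expand) (auto intro!: sum.neutral simp: onb_orthogonal')

text \<open>The expansion of a polynomial in the orthonormal system is finite, and its length does not depend
  on the other argument of the form.\<close>

lemma parseval_exists:
  "\<exists>K0. \<forall>K\<ge>K0. (\<forall>k\<ge>K0. ip (onb k) f = 0) \<and> (\<forall>g. ip g f = (\<Sum>k<K. ip g (onb k) * ip (onb k) f))"
proof (induction f)
  case (Cons x f)
  then obtain K1 where K: "\<forall>K\<ge>K1. (\<forall>k\<ge>K1. ip (onb k) f = 0) \<and>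
      (\<forall>g. ip g f = (\<Sum>k<K. ip g (onb k) * ip (onb k) f))"
    by (rule exE)
  have K1: "ip (onb k) f = 0" if "k \<ge> K1" for k
    using K that by blast
  have K2: "ip g f = (\<Sum>k<K. ip g (onb k) * ip (onb k) f)" if "K \<ge> K1" for K g
    using K that by blast
  obtain c u where x: "x = (c, u)" by (cases x)
  define n where "n = to_nat u"
  have f: "x # f = smul c (wd n) @ f" by (simp add: x n_def wd_def word_def smul_def)
  let ?K0 = "max K1 (Suc n)"
  have wd: "ip g (wd n) = (\<Sum>k<K. ip g (onb k) * ip (onb k) (wd n))" if "K \<ge> Suc n" for K g
    by (subst ip_wd_expand, rule sum.mono_neutral_left) (use that in \<open>auto simp: ip_onb_wd\<close>)
  show ?case
  proof (intro exI[of _ ?K0] allI impI conjI)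
    fix K k assume "?K0 \<le> k"
    then show "ip (onb k) (x # f) = 0" unfolding f by (simp add: ip_simps K1 ip_onb_wd)
  next
    fix K g assume K: "?K0 \<le> K"
    have "ip g (x # f) = c * ip g (wd n) + ip g f" unfolding f by (simp add: ip_simps)
    also have "\<dots> = c * (\<Sum>k<K. ip g (onb k) * ip (onb k) (wd n)) + (\<Sum>k<K. ip g (onb k) * ip (onb k) f)"
      using K wd[of K g] K2[of K g] by simp
    also have "\<dots> = (\<Sum>k<K. ip g (onb k) * ip (onb k) (x # f))"
      unfolding f by (simp add: ip_simps sum_distrib_left sum.distrib[symmetric] algebra_simps)
    finally show "ip g (x # f) = (\<Sum>k<K. ip g (onb k) * ip (onb k) (x # f))" .
  qed
qed simp

definition supp_bound :: "nc_poly \<Rightarrow> nat" where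
  "supp_bound f = (SOME K0. \<forall>K\<ge>K0. (\<forall>k\<ge>K0. ip (onb k) f = 0) \<and>
     (\<forall>g. ip g f = (\<Sum>k<K. ip g (onb k) * ip (onb k) f)))"

lemma parseval:
  "k \<ge> supp_bound f \<Longrightarrow> ip (onb k) f = 0"
  "K \<ge> supp_bound f \<Longrightarrow> ip g f = (\<Sum>k<K. ip g (onb k) * ip (onb k) f)"
  using someI_ex[OF parseval_exists[of f]] unfolding supp_bound_def by blast+

lemma ip_self_sum:
  assumes "K \<ge> supp_bound f"
  shows "Re (ip f f) = (\<Sum>k<K. (cmod (ip (onb k) f))\<^sup>2)"
proof -
  have "ip f (onb k) * ip (onb k) f = complex_of_real ((cmod (ip (onb k) f))\<^sup>2)" for k
    using complex_norm_square[of "ip (onb k) f"] ip_cnj[of f "onb k"] by (simp add: mult.commute)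
  then have "ip f f = (\<Sum>k<K. complex_of_real ((cmod (ip (onb k) f))\<^sup>2))"
    using parseval(2)[OF assms, of f] by simp
  then show ?thesis by simp
qed

lemma bessel: "(\<Sum>k<K. (cmod (ip (onb k) f))\<^sup>2) \<le> Re (ip f f)"
proof -
  have "(\<Sum>k<K. (cmod (ip (onb k) f))\<^sup>2) \<le> (\<Sum>k<max K (supp_bound f). (cmod (ip (onb k) f))\<^sup>2)"
    by (intro sum_mono2) auto
  then show ?thesis using ip_self_sum[of f "max K (supp_bound f)"] by simp
qed

subsection \<open>The representation\<close>

definition vec :: "nc_poly \<Rightarrow> l2" where "vec f = Abs_l2 (\<lambda>k. ip (onb k) f)"

lemma coord_vec: "coord (vec f) k = ip (onb k) f"
  using l2_of_bounded_sums(1)[of "\<lambda>k. ip (onb k) f" "sqrt (Re (ip f f))"] bessel[of f] ip_self(2)[of f]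
  by (simp add: vec_def)

lemma inner_vec: "inner (vec f) (vec g) = Re (ip f g)"
proof -
  let ?K = "max (supp_bound f) (supp_bound g)"
  have "inner (vec f) (vec g) = (\<Sum>k<?K. inner (ip (onb k) f) (ip (onb k) g))"
    by (subst inner_l2_finite[of ?K]) (simp_all add: coord_vec parseval)
  also have "\<dots> = (\<Sum>k<?K. Re (ip f (onb k) * ip (onb k) g))"
    by (simp add: ip_cnj[of f] inner_complex_def)
  also have "\<dots> = Re (ip f g)" using parseval(2)[of g ?K f] by simp
  finally show ?thesis .
qed

lemma J_vec: "J_l2 (vec f) = vec (smul \<i> f)"
  by (rule l2_eqI) (simp add: coord_J_l2 coord_vec ip_simps)

text \<open>In the orthonormal system, multiplication by a letter maps every basis element to a finite
  combination of basis elements. Its matrix is Hermitian, as letters are self-adjoint, so the rows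
  are finite as well.\<close>

lemma lmul_operator_exists:
  "\<exists>T. self_adjoint l2.operators T \<and> (\<forall>f. blinfun_apply T (vec f) = vec (lmul i f))"
proof -
  define B where "B m n = ip (onb m) (lmul i (onb n))" for m n
  have herm: "B n m = cnj (B m n)" for m n
    unfolding B_def ip_lmul[where f = "onb n", symmetric] by (rule ip_cnj)
  let ?c = "\<lambda>m. supp_bound (lmul i (onb m))"
  have row: "B m n = 0" if "n \<ge> ?c m" for m n
    using parseval(1)[OF that] herm[of n m] by (simp add: B_def)
  have bound: "(\<Sum>m<N. (cmod (\<Sum>n<K. B m n * f n))\<^sup>2) \<le> (R i)\<^sup>2 * (\<Sum>n<K. (cmod (f n))\<^sup>2)" for N K f
  proof -
    define g where "g = concat (map (\<lambda>n. smul (f n) (onb n)) [0..<K])"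
    have "(\<Sum>n<K. B m n * f n) = ip (onb m) (lmul i g)" for m
    proof -
      have "ip (onb m) (lmul i g) = ip (lmul i (onb m)) g" by (rule ip_lmul[symmetric])
      also have "\<dots> = (\<Sum>n<K. f n * ip (lmul i (onb m)) (onb n))"
        unfolding g_def ip_concat_right by (simp add: ip_simps)
      finally show ?thesis by (simp add: B_def ip_lmul mult.commute)
    qed
    then have "(\<Sum>m<N. (cmod (\<Sum>n<K. B m n * f n))\<^sup>2) \<le> Re (ip (lmul i g) (lmul i g))"
      using bessel[of "lmul i g" N] by simp
    also have "\<dots> \<le> (R i)\<^sup>2 * Re (ip g g)" by (rule ip_lmul_bound)
    also have "Re (ip g g) \<le> (\<Sum>n<K. (cmod (f n))\<^sup>2)"
    proof -
      have "ip g g = (\<Sum>n<K. \<Sum>m<K. cnj (f n) * (f m * ip (onb n) (onb m)))"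
        unfolding g_def
        by (simp only: ip_concat_left) (simp only: ip_concat_right ip_simps sum_distrib_left,
            intro sum.cong refl, simp)
      also have "\<dots> = (\<Sum>n<K. \<Sum>m<K. if n = m then cnj (f n) * f n * ip (onb n) (onb n) else 0)"
        by (intro sum.cong refl) (auto simp: onb_orthogonal')
      also have "\<dots> = (\<Sum>n<K. cnj (f n) * f n * ip (onb n) (onb n))"
        by (intro sum.cong refl) (simp add: sum.delta)
      also have "\<dots> = (\<Sum>n<K. complex_of_real (if onb n = [] then 0 else (cmod (f n))\<^sup>2))"
        by (intro sum.cong refl) (simp add: onb_self complex_norm_square mult.commute del: of_real_power)
      finally have "Re (ip g g) = (\<Sum>n<K. if onb n = [] then 0 else (cmod (f n))\<^sup>2)" by simp
      also have "\<dots> \<le> (\<Sum>n<K. (cmod (f n))\<^sup>2)" by (intro sum_mono) auto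
      finally show ?thesis .
    qed
    finally show ?thesis using R_pos[of i] by (simp add: mult_left_mono)
  qed
  obtain T where T: "\<And>f m. coord (blinfun_apply T f) m = (\<Sum>n<?c m. B m n * coord f n)"
    and sa: "self_adjoint l2.operators T"
    using hermitian_matrix_operator[of B ?c "R i"] herm row bound R_pos[of i] by (metis less_imp_le)
  have "T (vec f) = vec (lmul i f)" for f
  proof (rule l2_eqI)
    fix m
    let ?K = "max (?c m) (supp_bound f)"
    have "coord (T (vec f)) m = (\<Sum>n<?c m. B m n * ip (onb n) f)" by (simp add: T coord_vec)
    also have "\<dots> = (\<Sum>n<?K. B m n * ip (onb n) f)"
      by (intro sum.mono_neutral_left) (auto simp: row)
    also have "\<dots> = (\<Sum>n<?K. ip (lmul i (onb m)) (onb n) * ip (onb n) f)" by (simp add: B_def ip_lmul)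
    also have "\<dots> = ip (lmul i (onb m)) f" using parseval(2)[of f ?K "lmul i (onb m)"] by simp
    finally show "coord (T (vec f)) m = coord (vec (lmul i f)) m" by (simp add: coord_vec ip_lmul)
  qed
  then show ?thesis using sa by blast
qed

text \<open>The vector state of the empty word recovers the functional, since applying the operators of a word
  to the empty word yields that word.\<close>

theorem moment_realization:
  "\<exists>(B :: cstar_universe cstar_algebra) \<Phi> b. cstar_prob_space B \<Phi> \<and>
     (\<forall>i. self_adjoint B (b i)) \<and> (\<forall>w. \<Phi> (lprod B (map b w)) = M w)"
proof -
  obtain T where T: "\<And>i. self_adjoint l2.operators (T i)" "\<And>i f. blinfun_apply (T i) (vec f) = vec (lmul i f)"
    using lmul_operator_exists by metis
  define v where "v = vec (word [])"
  have "inner v v = 1" by (simp add: v_def inner_vec ip_word unital)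
  then have v: "norm v = 1" by (simp add: norm_eq_sqrt_inner)
  note P = l2.cstar_prob_space_vector_state[OF v]
  have wordv: "lprod l2.operators (map T w) v = vec (word w)" for w
  proof (induction w)
    case (Cons i w)
    then show ?case by (simp add: T(2)) (simp add: lmul_def word_def)
  qed (simp add: v_def)
  have state: "l2.vector_state v (lprod l2.operators (map T w)) = M w" for w
    unfolding l2.vector_state_def wordv unfolding v_def J_vec inner_vec
    by (simp add: ip_simps ip_word complex_eq_iff)
  \<comment> \<open>\<open>Abs_l2\<close> is arbitrary on sequences that are not square-summable; decoding only evaluates an
     encoded operator on the others.\<close>
  define enc :: "(l2 \<Rightarrow>\<^sub>L l2) \<Rightarrow> cstar_universe" where "enc S = (\<lambda>x. coord (S (Abs_l2 x)))" for S
  define dec :: "cstar_universe \<Rightarrow> (l2 \<Rightarrow>\<^sub>L l2)" where "dec h = Blinfun (\<lambda>f. Abs_l2 (h (coord f)))" for h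
  have dec: "dec (enc S) = S" for S
    by (simp add: enc_def dec_def coord_inverse blinfun_apply_inverse)
  let ?B = "transport_cstar enc dec l2.operators" and ?b = "\<lambda>i. enc (T i)"
  have "cstar_prob_space ?B (\<lambda>x. l2.vector_state v (dec x))"
    by (rule transport_cstar_prob_space[where g = dec, OF P dec])
  moreover have "self_adjoint ?B (?b i)" for i
    using T(1)[of i] by (simp add: self_adjoint_def transport_cstar_def dec)
  moreover have "l2.vector_state v (dec (lprod ?B (map ?b w))) = M w" for w
    unfolding transport_lprod[where g = dec, OF dec] dec by (rule state)
  ultimately show ?thesis
    by (intro exI[of _ ?B] exI[of _ "\<lambda>x. l2.vector_state v (dec x)"] exI[of _ ?b] conjI allI)
qed

end

section \<open>The limit law\<close>

subsection \<open>Moment functionals of self-adjoint sequences\<close>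

lemma lprod_word_eq_ordered_prod:
  "lprod A (map x u) = ordered_prod A (\<lambda>k. x (u ! (k - 1))) {1..length u}"
proof -
  have "map (\<lambda>k. x (u ! (k - 1))) [1..<Suc (length u)] = map x u"
    by (rule nth_equalityI) (auto simp del: upt_Suc)
  then show ?thesis by (simp only: ordered_prod_eq_lprod sorted_list_of_set_Icc)
qed

lemma ordered_prod_eq_lprod_word:
  "ordered_prod A (\<lambda>k. x (i k)) V = lprod A (map x (map i (sorted_list_of_set V)))"
  by (simp add: ordered_prod_eq_lprod comp_def)

lemma (in unital_cstar_algebra) self_adjoint_finsum:
  assumes "finite J" "\<And>j. j \<in> J \<Longrightarrow> self_adjoint A (x j)"
  shows "self_adjoint A (\<Oplus>j\<in>J. x j)"
  using assms
proof (induction J rule: finite_induct)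
  case empty
  show ?case using adj_scale[of \<one> 0] by (simp add: self_adjoint_def scale_zero adj_one)
next
  case (insert j J)
  then have "x \<in> J \<rightarrow> carrier A" "x j \<in> carrier A" by (auto simp: self_adjoint_def)
  then show ?case using insert by (simp add: self_adjoint_def adj_add finsum_insert)
qed

context cstar_prob_space
begin

text \<open>The form is \<open>\<phi>((P f)\<^sup>* P f)\<close>, where \<open>P f\<close> evaluates the formal polynomial \<open>f\<close> at the given elements.\<close>

lemma moment_form_positive:
  assumes a: "\<And>i. self_adjoint A (a i)"
  shows "moment_form (\<lambda>w. \<phi> (lprod A (map a w))) f f \<in> \<real>\<^sub>\<ge>\<^sub>0"
proof -
  define P :: "nc_poly \<Rightarrow> 'a" where
    "P f = foldr (\<lambda>(c, u) y. c \<odot> lprod A (map a u) \<oplus> y) f \<zero>" for f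
  have P_simps: "P [] = \<zero>" "P ((c, u) # f) = c \<odot> lprod A (map a u) \<oplus> P f" for c u f
    by (simp_all add: P_def)
  have ac: "a i \<in> carrier A" for i using a by (simp add: self_adjoint_def)
  have lc: "lprod A (map a u) \<in> carrier A" for u using ac by (intro lprod_closed) auto
  have Pc: "P f \<in> carrier A" for f
    by (induction f) (auto simp: P_simps scale_closed lc)
  have adj: "adj A (lprod A (map a u)) = lprod A (map a (rev u))" for u
    using adj_lprod[of "map a u"] a by (auto simp: rev_map)
  have zero: "adj A \<zero> = \<zero>"
    using adj_scale[of \<one> 0] by (simp add: scale_zero adj_one)
  have right: "\<phi> (w \<otimes> P g) = (\<Sum>(d, v)\<leftarrow>g. d * \<phi> (w \<otimes> lprod A (map a v)))" if "w \<in> carrier A" for w g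
    using that by (induction g) (auto simp: P_simps state_zero r_distr mult_scale_right scale_closed lc Pc state_add state_scale)
  have left: "\<phi> (adj A (P f) \<otimes> z) = (\<Sum>(c, u)\<leftarrow>f. cnj c * \<phi> (lprod A (map a (rev u)) \<otimes> z))" if "z \<in> carrier A" for z f
    using that
    by (induction f) (auto simp: P_simps zero state_zero l_distr mult_scale_left scale_closed lc Pc
        state_add state_scale adj_add adj_scale adj adj_closed)
  have "\<phi> (adj A (P f) \<otimes> P f) = (\<Sum>(c, u)\<leftarrow>f. cnj c * (\<Sum>(d, v)\<leftarrow>f. d * \<phi> (lprod A (map a (rev u)) \<otimes> lprod A (map a v))))"
    unfolding left[OF Pc] by (intro arg_cong[of _ _ sum_list] map_cong) (auto simp: right lc)
  also have "\<dots> = moment_form (\<lambda>w. \<phi> (lprod A (map a w))) f f"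
  proof -
    have "lprod A (map a (rev u)) \<otimes> lprod A (map a v) = lprod A (map a (rev u @ v))" for u v
      unfolding map_append using ac by (intro lprod_append[symmetric]) auto
    then show ?thesis
      by (simp add: moment_form_def case_prod_unfold sum_list_const_mult[symmetric] mult.assoc)
  qed
  finally show ?thesis using state_positive[OF Pc] by metis
qed

lemma moment_functional_state:
  assumes a: "\<And>i. self_adjoint A (a i)"
  shows "moment_functional (\<lambda>w. \<phi> (lprod A (map a w))) (\<lambda>i. nrm A (a i) + 1)"
proof
  have ac: "a i \<in> carrier A" for i using a by (simp add: self_adjoint_def)
  show "\<phi> (lprod A (map a [])) = 1" by (simp add: state_one)
  show "moment_form (\<lambda>w. \<phi> (lprod A (map a w))) f f \<in> \<real>\<^sub>\<ge>\<^sub>0" for f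
    by (rule moment_form_positive[OF a])
  show "cmod (\<phi> (lprod A (map a w))) \<le> prod_list (map (\<lambda>i. nrm A (a i) + 1) w)" for w
  proof -
    have "cmod (\<phi> (lprod A (map a w))) \<le> prod_list (map (nrm A) (map a w))"
      using ac by (intro state_lprod_le) auto
    also have "\<dots> \<le> prod_list (map (\<lambda>i. nrm A (a i) + 1) w)"
      using nrm_nonneg[OF ac] by (induction w) (auto intro!: mult_mono prod_list_nonneg)
    finally show ?thesis .
  qed
  show "0 < nrm A (a i) + 1" for i using nrm_nonneg[OF ac[of i]] by simp
qed

end

lemma moment_form_positive_limit:
  assumes \<omega>: "\<omega> \<noteq> bot" and lim: "\<And>w. ((\<lambda>N. m N w) \<longlongrightarrow> M w) \<omega>"
    and pos: "eventually (\<lambda>N. moment_form (m N) f f \<in> \<real>\<^sub>\<ge>\<^sub>0) \<omega>"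
  shows "moment_form M f f \<in> \<real>\<^sub>\<ge>\<^sub>0"
proof -
  have "((\<lambda>N. moment_form (m N) f f) \<longlongrightarrow> moment_form M f f) \<omega>"
    unfolding moment_form_def case_prod_unfold
    by (intro tendsto_sum_list tendsto_mult tendsto_const lim)
  then show ?thesis
    using Lim_in_closed_set[OF closed_nonneg_Reals_complex pos \<omega>] by blast
qed

subsection \<open>Growth of sums over non-crossing partitions\<close>

text \<open>The bound on a product of weights over the blocks is a product over the positions, hence the same
  for all partitions, and there are at most \<open>4 ^ card V\<close> of them.\<close>

lemma sum_NC_on_growth:
  fixes \<kappa> :: "'i list \<Rightarrow> complex"
  assumes V: "finite V" and \<kappa>: "\<And>u. u \<noteq> [] \<Longrightarrow> cmod (\<kappa> u) \<le> prod_list (map g u)"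
    and g: "\<And>x. 0 \<le> g x"
  shows "cmod (\<Sum>P\<in>NC_on V. \<Prod>W\<in>P. \<kappa> (map i (sorted_list_of_set W))) \<le> (\<Prod>v\<in>V. 4 * g (i v))"
proof -
  have "cmod (\<Sum>P\<in>NC_on V. \<Prod>W\<in>P. \<kappa> (map i (sorted_list_of_set W))) \<le>
      (\<Sum>P\<in>NC_on V. (\<Prod>v\<in>V. g (i v)))"
  proof (rule order_trans[OF norm_sum sum_mono])
    fix P assume "P \<in> NC_on V"
    then have P: "partition_on V P" by (simp add: NC_on_def)
    have "cmod (\<Prod>W\<in>P. \<kappa> (map i (sorted_list_of_set W))) = (\<Prod>W\<in>P. cmod (\<kappa> (map i (sorted_list_of_set W))))"
      by (rule prod_norm[symmetric])
    also have "\<dots> \<le> (\<Prod>W\<in>P. \<Prod>v\<in>W. g (i v))"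
    proof (rule prod_mono, intro conjI norm_ge_zero)
      fix W assume W: "W \<in> P"
      have fin: "finite W" "W \<noteq> {}"
        using W P V by (auto simp: partition_on_def intro: finite_subset)
      have "cmod (\<kappa> (map i (sorted_list_of_set W))) \<le> prod_list (map g (map i (sorted_list_of_set W)))"
        using fin by (intro \<kappa>) auto
      also have "\<dots> = (\<Prod>v\<in>set (sorted_list_of_set W). g (i v))"
        by (subst prod.distinct_set_conv_list) (simp_all add: comp_def)
      finally show "cmod (\<kappa> (map i (sorted_list_of_set W))) \<le> (\<Prod>v\<in>W. g (i v))" using fin by simp
    qed
    also have "\<dots> = (\<Prod>v\<in>V. g (i v))" by (rule prod.partition[OF V P, symmetric])
    finally show "cmod (\<Prod>W\<in>P. \<kappa> (map i (sorted_list_of_set W))) \<le> (\<Prod>v\<in>V. g (i v))" .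
  qed
  also have "\<dots> = real (card (NC_on V)) * (\<Prod>v\<in>V. g (i v))" by simp
  also have "\<dots> \<le> 4 ^ card V * (\<Prod>v\<in>V. g (i v))"
  proof (rule mult_right_mono)
    show "real (card (NC_on V)) \<le> 4 ^ card V"
      using card_NC_on_le[OF V] by (metis of_nat_le_iff of_nat_numeral of_nat_power)
  qed (simp add: g prod_nonneg)
  also have "\<dots> = (\<Prod>v\<in>V. 4 * g (i v))" by (simp add: prod.distrib)
  finally show ?thesis .
qed

lemma free_cumulant_of_NC_moments:
  assumes n: "n \<ge> 1"
    and mom: "\<And>V. V \<subseteq> {1..n} \<Longrightarrow> \<phi> (ordered_prod B x V) = (\<Sum>P\<in>NC_on V. \<Prod>W\<in>P. k W)"
  shows "free_cumulant B \<phi> n x = k {1..n}"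
proof -
  have "free_cumulant B \<phi> n x =
      (\<Sum>P\<in>NC n. (\<Prod>V\<in>P. \<Sum>R\<in>NC_on V. \<Prod>W\<in>R. k W) * of_int (mobius_NC n P {{1..n}}))"
    unfolding free_cumulant_def partition_moment_def
  proof (intro sum.cong refl arg_cong2[of _ _ _ _ "(*)"] prod.cong)
    fix P V assume "P \<in> NC n" "V \<in> P"
    then show "\<phi> (ordered_prod B x V) = (\<Sum>R\<in>NC_on V. \<Prod>W\<in>R. k W)"
      by (intro mom) (auto simp: NC_def partition_on_def)
  qed
  then show ?thesis using mobius_inversion_of_moments[OF n] by simp
qed

theorem theorem2p8:
  fixes A :: "'a cstar_algebra" and \<phi> :: "'a \<Rightarrow> complex" and a :: "nat \<Rightarrow> 'a"
    and lam :: "nat \<Rightarrow> real" and lam_sup :: real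
    and C :: "nat \<Rightarrow> 'c cstar_algebra" and \<psi> :: "nat \<Rightarrow> 'c \<Rightarrow> complex"
    and p :: "nat \<Rightarrow> nat \<Rightarrow> 'c" and q :: "nat \<Rightarrow> nat \<Rightarrow> nat \<Rightarrow> 'c"
    and T :: "nat \<Rightarrow> 't cstar_algebra" and \<tau> :: "nat \<Rightarrow> 'a \<Rightarrow> 'c \<Rightarrow> 't"
    and \<eta> :: "nat \<Rightarrow> 't \<Rightarrow> complex" and s :: "nat \<Rightarrow> nat \<Rightarrow> 't"
  assumes "cstar_prob_space A \<phi>"
    and "\<And>i. self_adjoint A (a i)"
    and "\<And>i. lam i > 0" and "bdd_above (range lam)" and "lam_sup = (SUP i. lam i)"
    and "\<And>N. real N \<ge> lam_sup \<Longrightarrow> cstar_prob_space (C N) (\<psi> N)"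
    and "\<And>N i. real N \<ge> lam_sup \<Longrightarrow> projection (C N) (p N i)"
    and "\<And>N i. real N \<ge> lam_sup \<Longrightarrow> \<psi> N (p N i) = complex_of_real (lam i / real N)"
    and "\<And>N. real N \<ge> lam_sup \<Longrightarrow> spatial_tensor_product A (C N) (T N) (\<tau> N)"
    and "\<And>N. real N \<ge> lam_sup \<Longrightarrow> tensor_state A \<phi> (C N) (\<psi> N) (T N) (\<tau> N) (\<eta> N)"
    and "\<And>N j i. \<lbrakk>real N \<ge> lam_sup; j \<in> {1..N}\<rbrakk> \<Longrightarrow> q N j i \<in> carrier (C N)"
    and "\<And>N j i. \<lbrakk>real N \<ge> lam_sup; j \<in> {1..N}\<rbrakk> \<Longrightarrow> self_adjoint (T N) (\<tau> N (a i) (q N j i))"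
    and "\<And>N. real N \<ge> lam_sup \<Longrightarrow>
           free_sequences (T N) (\<eta> N) {1..N} (\<lambda>j i. \<tau> N (a i) (q N j i))"
    and "\<And>N j. \<lbrakk>real N \<ge> lam_sup; j \<in> {1..N}\<rbrakk> \<Longrightarrow>
           same_distribution (T N) (\<eta> N) (\<lambda>i. \<tau> N (a i) (q N j i))
                             (T N) (\<eta> N) (\<lambda>i. \<tau> N (a i) (p N i))"
    and "\<And>N i. real N \<ge> lam_sup \<Longrightarrow> s N i = (\<Oplus>\<^bsub>T N\<^esub>j\<in>{1..N}. \<tau> N (a i) (q N j i))"
  shows "\<exists>(B :: cstar_universe cstar_algebra) \<Phi> b \<omega>.
           cstar_prob_space B \<Phi> \<and>
           (\<forall>i. compound_free_poisson B \<Phi> (b i)) \<and>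
           free_ultrafilter \<omega> \<and>
           converges_in_distribution \<omega> T \<eta> s B \<Phi> b \<and>
           (\<forall>n\<ge>1. \<forall>i :: nat \<Rightarrow> nat. \<exists>L.
              ((\<lambda>N. of_nat N * \<psi> N (ordered_prod (C N) (\<lambda>k. p N (i k)) {1..n})) \<longlongrightarrow> L) \<omega> \<and>
              free_cumulant B \<Phi> n (\<lambda>k. b (i k)) =
                \<phi> (ordered_prod A (\<lambda>k. a (i k)) {1..n}) * L)"
proof -
  interpret A: cstar_prob_space A \<phi> by fact
  note sa = assms(2) and lam_pos = assms(3) and Cps = assms(6) and proj = assms(7) and \<psi>p = assms(8)
    and tensor = assms(9) and tstate = assms(10) and q_sa = assms(12) and free = assms(13)
    and same = assms(14) and s_eq = assms(15)
  have ac: "a i \<in> carrier A" for i using sa by (simp add: self_adjoint_def)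
  have pc: "p N i \<in> carrier (C N)" if "real N \<ge> lam_sup" for N i
    using proj[OF that] by (simp add: projection_def self_adjoint_def)
  have Tps: "cstar_prob_space (T N) (\<eta> N)" if "real N \<ge> lam_sup" for N
    using tstate[OF that] by (simp add: tensor_state_def)
  have lam_le: "lam i \<le> lam_sup" for i unfolding assms(5) by (rule cSUP_upper[OF _ assms(4)]) simp
  have lam_sup: "0 < lam_sup" using lam_pos[of 0] lam_le[of 0] by simp
  obtain \<omega> where \<omega>: "free_ultrafilter \<omega>" "\<omega> \<le> sequentially" using free_ultrafilter_exists by blast
  have \<omega>_bot: "\<omega> \<noteq> bot" using \<omega>(1) by (simp add: free_ultrafilter_def)
  have good: "eventually (\<lambda>N. real N \<ge> lam_sup) \<omega>"
    using \<omega>(2) eventually_ge_at_top[of "nat \<lceil>lam_sup\<rceil>"]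
    by (rule eventually_mono[OF filter_leD]) linarith

  have "\<exists>L. ((\<lambda>N. of_nat N * \<psi> N (lprod (C N) (map (p N) u))) \<longlongrightarrow> L) \<omega> \<and> cmod L \<le> lam_sup" if u: "u \<noteq> []" for u
  proof (rule bounded_converges_ultrafilter[OF \<omega>(1)])
    show "eventually (\<lambda>N. cmod (of_nat N * \<psi> N (lprod (C N) (map (p N) u))) \<le> lam_sup) \<omega>"
      using good
    proof eventually_elim
      case (elim N)
      interpret C: cstar_prob_space "C N" "\<psi> N" by (rule Cps[OF elim])
      have N: "real N > 0" using elim lam_sup by simp
      have "cmod (\<psi> N (lprod (C N) (map (p N) u))) \<le> lam_sup / real N"
      proof (rule C.state_projections_bound)
        fix x assume "x \<in> set (map (p N) u)"
        then obtain i where x: "x = p N i" by auto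
        show "projection (C N) x" unfolding x by (rule proj[OF elim])
        show "Re (\<psi> N x) \<le> lam_sup / real N"
          unfolding x \<psi>p[OF elim] using lam_le[of i] N by (simp add: divide_right_mono)
      qed (use u in simp)
      then show ?case using N by (simp add: norm_mult field_simps)
    qed
  qed
  then obtain L where L: "\<And>u. u \<noteq> [] \<Longrightarrow> ((\<lambda>N. of_nat N * \<psi> N (lprod (C N) (map (p N) u))) \<longlongrightarrow> L u) \<omega>"
    and L_le: "\<And>u. u \<noteq> [] \<Longrightarrow> cmod (L u) \<le> lam_sup" by metis
  define \<kappa> where "\<kappa> u = \<phi> (lprod A (map a u)) * L u" for u
  define F where "F N u = \<eta> N (lprod (T N) (map (\<lambda>i. \<tau> N (a i) (p N i)) u))" for N u
  have F_lim: "((\<lambda>N. of_nat N * F N u) \<longlongrightarrow> \<kappa> u) \<omega>" if u: "u \<noteq> []" for u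
  proof -
    have "eventually (\<lambda>N. \<phi> (lprod A (map a u)) * (of_nat N * \<psi> N (lprod (C N) (map (p N) u))) = of_nat N * F N u) \<omega>"
      using good
    proof eventually_elim
      case (elim N)
      have "F N u = \<phi> (lprod A (map a u)) * \<psi> N (lprod (C N) (map (p N) u))"
        unfolding F_def by (rule tensor_state_lprod[OF tensor[OF elim] tstate[OF elim] assms(1) Cps[OF elim] ac pc[OF elim]])
      then show ?case by simp
    qed
    then show ?thesis unfolding \<kappa>_def
      by (rule Lim_transform_eventually[OF tendsto_mult[OF tendsto_const L[OF u]]])
  qed

  define val where "val N = cstar_prob_space.coloured_moment (T N) (\<eta> N) (\<lambda>j i. \<tau> N (a i) (q N j i))" for N
  have free_ev: "eventually (\<lambda>N. free_iid_moments N (val N) (F N)) \<omega>"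
    using good
  proof eventually_elim
    case (elim N)
    interpret T: cstar_prob_space "T N" "\<eta> N" by (rule Tps[OF elim])
    show ?case unfolding val_def
    proof (rule T.free_sequences_moments[OF free[OF elim]])
      fix j u assume "j \<in> {1..N}"
      then have eq: "\<eta> N (ordered_prod (T N) (\<lambda>k. \<tau> N (a (i k)) (q N j (i k))) {1..m}) =
          \<eta> N (ordered_prod (T N) (\<lambda>k. \<tau> N (a (i k)) (p N (i k))) {1..m})" for m i
        using same[OF elim] unfolding same_distribution_def by blast
      show "\<eta> N (lprod (T N) (map (\<lambda>i. \<tau> N (a i) (q N j i)) u)) = F N u"
        unfolding F_def lprod_word_eq_ordered_prod by (rule eq)
    qed
  qed
  define K where "K i V = (\<Sum>P\<in>NC_on V. \<Prod>W\<in>P. \<kappa> (map i (sorted_list_of_set W)))" for i :: "nat \<Rightarrow> nat" and V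
  have lim: "((\<lambda>N. \<eta> N (lprod (T N) (map (s N) (map i (sorted_list_of_set V))))) \<longlongrightarrow> K i V) \<omega>"
    if V: "finite V" for i V
  proof -
    let ?vs = "sorted_list_of_set V"
    have "eventually (\<lambda>N. (\<Sum>j\<in>V \<rightarrow>\<^sub>E {1..N}. val N (map (\<lambda>v. (j v, [i v])) ?vs)) =
        \<eta> N (lprod (T N) (map (s N) (map i ?vs)))) \<omega>"
      using good
    proof eventually_elim
      case (elim N)
      interpret T: cstar_prob_space "T N" "\<eta> N" by (rule Tps[OF elim])
      let ?x = "\<lambda>j i. \<tau> N (a i) (q N j i)"
      have x: "?x j i \<in> carrier (T N)" if "j \<in> {1..N}" for j i
        using q_sa[OF elim that] by (simp add: self_adjoint_def)
      have sums: "map (s N) (map i ?vs) = map (\<lambda>v. \<Oplus>\<^bsub>T N\<^esub>j\<in>{1..N}. ?x j (i v)) ?vs"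
        by (simp add: s_eq[OF elim])
      have "\<eta> N (lprod (T N) (map (s N) (map i ?vs)))
          = (\<Sum>j\<in>set ?vs \<rightarrow>\<^sub>E {1..N}. \<eta> N (lprod (T N) (map (\<lambda>v. ?x (j v) (i v)) ?vs)))"
        unfolding sums
        by (rule T.state_prod_of_sums[OF x finite_atLeastAtMost distinct_sorted_list_of_set])
      also have "\<dots> = (\<Sum>j\<in>V \<rightarrow>\<^sub>E {1..N}. val N (map (\<lambda>v. (j v, [i v])) ?vs))"
      proof (rule sum.cong)
        show "set ?vs \<rightarrow>\<^sub>E {1..N} = V \<rightarrow>\<^sub>E {1..N}" using V by simp
        fix j assume j: "j \<in> V \<rightarrow>\<^sub>E {1..N}"
        have "map (\<lambda>(c, u). lprod (T N) (map (?x c) u)) (map (\<lambda>v. (j v, [i v])) ?vs) = map (\<lambda>v. ?x (j v) (i v)) ?vs"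
          unfolding map_map
        proof (rule map_cong[OF refl])
          fix v assume "v \<in> set ?vs"
          then have "j v \<in> {1..N}" using j V by (auto dest: PiE_mem)
          from x[OF this] show "((\<lambda>(c, u). lprod (T N) (map (?x c) u)) \<circ> (\<lambda>v. (j v, [i v]))) v = ?x (j v) (i v)"
            by simp
        qed
        then show "\<eta> N (lprod (T N) (map (\<lambda>v. ?x (j v) (i v)) ?vs)) = val N (map (\<lambda>v. (j v, [i v])) ?vs)"
          by (simp only: val_def T.coloured_moment_def)
      qed
      finally show ?case by simp
    qed
    moreover have "((\<lambda>N. \<Sum>j\<in>V \<rightarrow>\<^sub>E {1..N}. val N (map (\<lambda>v. (j v, [i v])) ?vs)) \<longlongrightarrow> K i V) \<omega>"
      unfolding K_def by (rule sum_colourings_limit[OF \<omega>(2) free_ev F_lim V])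
    ultimately show ?thesis by (rule Lim_transform_eventually[rotated])
  qed
  define M where "M w = K ((!) w) {0..<length w}" for w
  have M_lim: "((\<lambda>N. \<eta> N (lprod (T N) (map (s N) w))) \<longlongrightarrow> M w) \<omega>" for w
    using lim[of "{0..<length w}" "(!) w"] by (simp only: M_def sorted_list_of_set_range map_nth finite_atLeastLessThan)
  have M_K: "M (map i (sorted_list_of_set V)) = K i V" if "finite V" for i V
    by (rule tendsto_unique[OF \<omega>_bot M_lim lim[OF that]])

  \<comment> \<open>A weight carries one factor \<open>lam_sup\<close> however long the word is; as \<open>c \<ge> 1\<close> it may be charged to
     every letter. Adding \<open>1\<close> to the norm keeps the bounds positive.\<close>
  define c where "c = max 1 lam_sup"
  define g where "g i = c * (nrm A (a i) + 1)" for i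
  have c1: "1 \<le> c" by (simp add: c_def)
  have nn: "0 \<le> nrm A (a i)" for i by (rule A.nrm_nonneg[OF ac])
  have g_pos: "0 < g i" for i using nn[of i] c1 by (simp add: g_def)
  have \<kappa>_le: "cmod (\<kappa> u) \<le> prod_list (map g u)" if "u \<noteq> []" for u
  proof -
    have "prod_list (map (nrm A) (map a u)) * c \<le> prod_list (map g u)"
      using that
    proof (induction u rule: list_nonempty_induct)
      case (single i)
      show ?case using c1 by (simp add: g_def algebra_simps)
    next
      case (cons i u)
      have "nrm A (a i) \<le> g i"
        unfolding g_def using nn[of i] mult_mono[of 1 c "nrm A (a i)" "nrm A (a i) + 1"] c1 by simp
      moreover have "0 \<le> prod_list (map (nrm A) (map a u)) * c"
        using nn c1 by (intro mult_nonneg_nonneg prod_list_nonneg) auto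
      ultimately have "nrm A (a i) * (prod_list (map (nrm A) (map a u)) * c) \<le> g i * prod_list (map g u)"
        using cons.IH g_pos[of i] by (intro mult_mono) auto
      then show ?case by (simp add: mult.assoc)
    qed
    moreover have "cmod (\<kappa> u) \<le> prod_list (map (nrm A) (map a u)) * c"
      unfolding \<kappa>_def norm_mult
    proof (rule mult_mono)
      show "cmod (\<phi> (lprod A (map a u))) \<le> prod_list (map (nrm A) (map a u))"
        using ac by (intro A.state_lprod_le) auto
      show "cmod (L u) \<le> c" using L_le[OF that] by (simp add: c_def)
      show "0 \<le> prod_list (map (nrm A) (map a u))" using nn by (auto intro!: prod_list_nonneg)
    qed simp
    ultimately show ?thesis by simp
  qed
  have "moment_functional M (\<lambda>i. 4 * g i)"
  proof
    have "((\<lambda>N. \<eta> N (lprod (T N) (map (s N) []))) \<longlongrightarrow> 1) \<omega>"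
    proof (rule tendsto_eventually)
      show "eventually (\<lambda>N. \<eta> N (lprod (T N) (map (s N) [])) = 1) \<omega>"
        using good by eventually_elim (simp add: cstar_prob_space.state_one[OF Tps])
    qed
    then show "M [] = 1" by (rule tendsto_unique[OF \<omega>_bot M_lim])
    show "moment_form M f f \<in> \<real>\<^sub>\<ge>\<^sub>0" for f
    proof (rule moment_form_positive_limit[OF \<omega>_bot M_lim])
      show "eventually (\<lambda>N. moment_form (\<lambda>w. \<eta> N (lprod (T N) (map (s N) w))) f f \<in> \<real>\<^sub>\<ge>\<^sub>0) \<omega>"
        using good
      proof eventually_elim
        case (elim N)
        interpret T: cstar_prob_space "T N" "\<eta> N" by (rule Tps[OF elim])
        have "self_adjoint (T N) (s N i)" for i
          unfolding s_eq[OF elim] using q_sa[OF elim] by (intro T.self_adjoint_finsum) auto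
        then show ?case by (rule T.moment_form_positive)
      qed
    qed
    show "cmod (M w) \<le> prod_list (map (\<lambda>i. 4 * g i) w)" for w
    proof -
      have "cmod (M w) \<le> (\<Prod>v\<in>{0..<length w}. 4 * g (w ! v))"
        unfolding M_def K_def using \<kappa>_le g_pos
        by (intro sum_NC_on_growth) (auto intro: less_imp_le)
      also have "\<dots> = prod_list (map (\<lambda>i. 4 * g i) w)" by (simp add: prod.list_conv_set_nth)
      finally show ?thesis .
    qed
    show "0 < 4 * g i" for i using g_pos[of i] by simp
  qed
  from moment_functional.moment_realization[OF this] obtain B :: "cstar_universe cstar_algebra" and \<Phi> b where
    B: "cstar_prob_space B \<Phi>" and b: "\<And>i. self_adjoint B (b i)" and \<Phi>: "\<And>w. \<Phi> (lprod B (map b w)) = M w"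
    by blast

  have cumulant: "free_cumulant B \<Phi> n (\<lambda>k. b (i k)) = \<kappa> (map i (sorted_list_of_set {1..n}))" if n: "n \<ge> 1" for n i
  proof (rule free_cumulant_of_NC_moments[OF n])
    fix V assume "V \<subseteq> {1..n}"
    then have "finite V" by (rule finite_subset) simp
    then show "\<Phi> (ordered_prod B (\<lambda>k. b (i k)) V) = (\<Sum>P\<in>NC_on V. \<Prod>W\<in>P. \<kappa> (map i (sorted_list_of_set W)))"
      unfolding ordered_prod_eq_lprod_word \<Phi> K_def[symmetric] by (rule M_K)
  qed

  obtain D :: "cstar_universe cstar_algebra" and \<theta> d where
    D: "cstar_prob_space D \<theta>" and d: "\<And>i. self_adjoint D (d i)"
    and \<theta>: "\<And>w. \<theta> (lprod D (map d w)) = \<phi> (lprod A (map a w))"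
    using moment_functional.moment_realization[OF A.moment_functional_state[of a, OF sa]] by blast
  interpret D: cstar_prob_space D \<theta> by (rule D)
  have poisson: "compound_free_poisson B \<Phi> (b i)" for i
  proof -
    have "free_cumulant B \<Phi> n (\<lambda>_. b i) = complex_of_real (lam i) * \<theta> (d i [^]\<^bsub>D\<^esub> n)" if n: "n \<ge> 1" for n
    proof -
      have w: "map (\<lambda>_. i) (sorted_list_of_set {1..n}) = replicate n i"
        by (simp add: map_replicate_const)
      have ne: "replicate n i \<noteq> []" using n by simp
      have "((\<lambda>N. of_nat N * \<psi> N (lprod (C N) (map (p N) (replicate n i)))) \<longlongrightarrow> complex_of_real (lam i)) \<omega>"
      proof (rule tendsto_eventually)
        show "eventually (\<lambda>N. of_nat N * \<psi> N (lprod (C N) (map (p N) (replicate n i))) = complex_of_real (lam i)) \<omega>"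
          using good
        proof eventually_elim
          case (elim N)
          interpret C: cstar_prob_space "C N" "\<psi> N" by (rule Cps[OF elim])
          have pp: "p N i \<otimes>\<^bsub>C N\<^esub> p N i = p N i" using proj[OF elim] by (simp add: projection_def)
          have "lprod (C N) (replicate (Suc m) (p N i)) = p N i" for m
            using pp pc[OF elim, of i] by (induction m) simp_all
          from this[of "n - 1"] have "lprod (C N) (map (p N) (replicate n i)) = p N i" using n by simp
          then show ?case using \<psi>p[OF elim, of i] elim lam_sup by simp
        qed
      qed
      then have "L (replicate n i) = complex_of_real (lam i)"
        using tendsto_unique[OF \<omega>_bot L[OF ne]] by blast
      moreover have "\<theta> (d i [^]\<^bsub>D\<^esub> n) = \<phi> (lprod A (map a (replicate n i)))"
        using D.lprod_replicate[of "d i" n] d[of i] \<theta>[of "replicate n i"] by (simp add: self_adjoint_def)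
      ultimately show ?thesis
        using cumulant[OF n, of "\<lambda>_. i"] unfolding w \<kappa>_def by simp
    qed
    then show ?thesis
      unfolding compound_free_poisson_def using b[of i] lam_pos[of i] D d[of i]
      by (auto simp: self_adjoint_def)
  qed

  have conv: "converges_in_distribution \<omega> T \<eta> s B \<Phi> b"
    unfolding converges_in_distribution_def ordered_prod_eq_lprod_word \<Phi> using M_lim by blast

  have "\<exists>L. ((\<lambda>N. of_nat N * \<psi> N (ordered_prod (C N) (\<lambda>k. p N (i k)) {1..n})) \<longlongrightarrow> L) \<omega> \<and>
      free_cumulant B \<Phi> n (\<lambda>k. b (i k)) = \<phi> (ordered_prod A (\<lambda>k. a (i k)) {1..n}) * L" if n: "n \<ge> 1" for n i
  proof -
    have "map i (sorted_list_of_set {1..n}) \<noteq> []" using n by simp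
    from L[OF this] show ?thesis
      unfolding ordered_prod_eq_lprod_word cumulant[OF n] \<kappa>_def by blast
  qed
  then show ?thesis using B poisson \<omega>(1) conv by blast
qed

end
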